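(* Let $r\ge 1$ be a fixed integer. The following decision problem is $NP$-complete. Instance: a $(3,8r)$-biregular bipartite graph $G$. Question: does $G$ have a locally-balanced $2$-partition with an open neighborhood?
   Context: All graphs are finite, undirected, without loops or multiple edges. $V(G)$ denotes the vertex set of $G$, and $N_G(v)$ denotes the set of neighbors of a vertex $v$. A bipartite graph is $(a,b)$-biregular if all vertices in one part have degree $a$ and all vertices in the other part have degree $b$. A $2$-partition of a graph $G$ is a function $f:V(G)\to\{0,1\}$. A $2$-partition $f$ of $G$ is locally-balanced with an open neighborhood if for every $v\in V(G)$, $\bigl|\,|\{u\in N_G(v): f(u)=0\}|-|\{u\in N_G(v): f(u)=1\}|\,\bigr|\le 1$. *)

theory Defs
  imports
    "HOL-Library.FuncSet"
    "HOL-Computational_Algebra.Polynomial"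
    "Graph_Theory.Pair_Digraph"
begin

section \<open>Deterministic multi-tape Turing machines\<close>

datatype head_move = MoveLeft | Stay | MoveRight

text \<open>
  States and tape symbols are natural numbers. The symbol \<open>0\<close> is the blank, and the bits
  False and True are written as the symbols \<open>1\<close> and \<open>2\<close>; further work symbols are allowed.
  The transition function maps a state and the list of scanned symbols to the next state and,
  for each tape, the symbol to be written and the head movement.
\<close>

record turing_machine =
  num_tapes :: nat
  states :: "nat set"
  symbols :: "nat set"
  start :: nat
  halt :: nat
  delta :: "nat \<Rightarrow> nat list \<Rightarrow> nat \<times> (nat \<times> head_move) list"

definition wf_tm :: "turing_machine \<Rightarrow> bool" where
  "wf_tm M \<longleftrightarrow>
     num_tapes M \<ge> 1 \<and>
     finite (states M) \<and> start M \<in> states M \<and> halt M \<in> states M \<and>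
     finite (symbols M) \<and> {0, 1, 2} \<subseteq> symbols M \<and>
     (\<forall>q \<in> states M. \<forall>ss. length ss = num_tapes M \<and> set ss \<subseteq> symbols M \<longrightarrow>
        fst (delta M q ss) \<in> states M \<and>
        length (snd (delta M q ss)) = num_tapes M \<and>
        fst ` set (snd (delta M q ss)) \<subseteq> symbols M)"

text \<open>A tape is infinite in both directions; it is paired with the position of its head.\<close>

type_synonym tape = "int \<times> (int \<Rightarrow> nat)"
type_synonym config = "nat \<times> tape list"

fun scan :: "tape \<Rightarrow> nat" where
  "scan (h, t) = t h"

fun offset :: "head_move \<Rightarrow> int" where
  "offset MoveLeft = -1"
| "offset Stay = 0"
| "offset MoveRight = 1"

fun act :: "nat \<times> head_move \<Rightarrow> tape \<Rightarrow> tape" where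
  "act (s, m) (h, t) = (h + offset m, t(h := s))"

fun tm_step :: "turing_machine \<Rightarrow> config \<Rightarrow> config" where
  "tm_step M (q, ts) =
     (if q = halt M then (q, ts)
      else (let (q', as) = delta M q (map scan ts) in (q', map2 act as ts)))"

definition string_cells :: "bool list \<Rightarrow> int \<Rightarrow> nat" where
  "string_cells x i = (if 0 \<le> i \<and> i < int (length x) then (if x ! nat i then 2 else 1) else 0)"

definition init_config :: "turing_machine \<Rightarrow> bool list \<Rightarrow> config" where
  "init_config M x =
     (start M, (0, string_cells x) # replicate (num_tapes M - 1) (0, string_cells []))"

text \<open>
  The input is written on the first tape and the output is the whole content of the last tape.
  As halted configurations are left unchanged by \<^const>\<open>tm_step\<close>, the configuration after
  \<open>T n\<close> steps is the final one of every run of at most \<open>T n\<close> steps.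
\<close>

definition computes_in_time ::
    "turing_machine \<Rightarrow> (bool list \<Rightarrow> bool list) \<Rightarrow> (nat \<Rightarrow> nat) \<Rightarrow> bool" where
  "computes_in_time M f T \<longleftrightarrow>
     (\<forall>x. let (q, ts) = (tm_step M ^^ T (length x)) (init_config M x)
          in q = halt M \<and> snd (last ts) = string_cells (f x))"

definition polytime :: "(bool list \<Rightarrow> bool list) \<Rightarrow> bool" where
  "polytime f \<longleftrightarrow> (\<exists>M (p :: nat poly). wf_tm M \<and> computes_in_time M f (poly p))"


section \<open>NP-completeness\<close>

text \<open>Every bit of \<open>x\<close> is preceded by the marker True; the marker False ends \<open>x\<close>.\<close>

definition pair_code :: "bool list \<Rightarrow> bool list \<Rightarrow> bool list" where
  "pair_code x u = concat (map (\<lambda>b. [True, b]) x) @ False # u"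

definition NP :: "bool list set set" where
  "NP = {L. \<exists>V (p :: nat poly). polytime V \<and>
           (\<forall>x. x \<in> L \<longleftrightarrow> (\<exists>u. length u \<le> poly p (length x) \<and> V (pair_code x u) = [True]))}"

text \<open>
  A decision problem is given by the set \<open>D\<close> of (codes of) its instances and the set \<open>Y \<subseteq> D\<close> of
  its yes-instances. Strings outside \<open>D\<close> are to be rejected for membership in NP, and
  reductions must produce elements of \<open>D\<close>; in particular NP-completeness of \<open>(D, Y)\<close> entails
  NP-completeness of the language \<open>Y\<close>.
\<close>

definition NP_hard :: "bool list set \<Rightarrow> bool list set \<Rightarrow> bool" where
  "NP_hard D Y \<longleftrightarrow>
     (\<forall>L \<in> NP. \<exists>f. polytime f \<and> (\<forall>x. f x \<in> D \<and> (x \<in> L \<longleftrightarrow> f x \<in> Y)))"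

definition NP_complete :: "bool list set \<Rightarrow> bool list set \<Rightarrow> bool" where
  "NP_complete D Y \<longleftrightarrow> Y \<subseteq> D \<and> Y \<in> NP \<and> NP_hard D Y"


section \<open>Graphs and locally-balanced 2-partitions\<close>

text \<open>
  A finite undirected graph without loops or multiple edges is a \<^const>\<open>pair_graph\<close>, i.e. a
  finite, loopfree, symmetric digraph whose arcs are pairs of vertices.
\<close>

definition neighbors :: "'a pair_pre_digraph \<Rightarrow> 'a \<Rightarrow> 'a set" where
  "neighbors G v = {u. (v, u) \<in> parcs G}"

definition biregular_bipartite :: "nat \<Rightarrow> nat \<Rightarrow> 'a pair_pre_digraph \<Rightarrow> bool" where
  "biregular_bipartite a b G \<longleftrightarrow>
     (\<exists>A B. A \<union> B = pverts G \<and> A \<inter> B = {} \<and> parcs G \<subseteq> A \<times> B \<union> B \<times> A \<and>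
        (\<forall>v \<in> A. card (neighbors G v) = a) \<and> (\<forall>v \<in> B. card (neighbors G v) = b))"

definition two_partition :: "'a pair_pre_digraph \<Rightarrow> ('a \<Rightarrow> nat) \<Rightarrow> bool" where
  "two_partition G f \<longleftrightarrow> f \<in> pverts G \<rightarrow> {0, 1}"

definition locally_balanced_open :: "'a pair_pre_digraph \<Rightarrow> ('a \<Rightarrow> nat) \<Rightarrow> bool" where
  "locally_balanced_open G f \<longleftrightarrow>
     (\<forall>v \<in> pverts G.
        \<bar>int (card {u \<in> neighbors G v. f u = 0}) - int (card {u \<in> neighbors G v. f u = 1})\<bar> \<le> 1)"


section \<open>The decision problem\<close>

text \<open>
  Graphs with vertex set \<open>{0, \<dots>, n - 1}\<close> are coded by their adjacency matrix, row by row.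
\<close>

definition graph_code :: "nat pair_pre_digraph \<Rightarrow> bool list" where
  "graph_code G = (let n = card (pverts G) in
     concat (map (\<lambda>i. map (\<lambda>j. (i, j) \<in> parcs G) [0..<n]) [0..<n]))"

definition is_instance :: "nat \<Rightarrow> nat pair_pre_digraph \<Rightarrow> bool" where
  "is_instance r G \<longleftrightarrow>
     pair_graph G \<and> (\<exists>n. pverts G = {..<n}) \<and> biregular_bipartite 3 (8 * r) G"

definition LBP_instances :: "nat \<Rightarrow> bool list set" where
  "LBP_instances r = {graph_code G | G. is_instance r G}"

definition LBP_yes :: "nat \<Rightarrow> bool list set" where
  "LBP_yes r = {graph_code G | G. is_instance r G \<and>
     (\<exists>f. two_partition G f \<and> locally_balanced_open G f)}"

text \<open>The coding is faithful: different graphs have different codes.\<close>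

lemma length_graph_code: "length (graph_code G) = card (pverts G) * card (pverts G)"
  by (simp add: graph_code_def Let_def length_concat o_def sum_list_triv)

lemma concat_map_upt_eqD:
  assumes "concat (map (\<lambda>i. map (P i) [0..<n]) is) = concat (map (\<lambda>i. map (Q i) [0..<n]) is)"
    and "i \<in> set is" "j < n"
  shows "P i j = Q i j"
  using assms by (induction "is") auto

lemma graph_code_inj:
  assumes "graph_code G = graph_code H"
    and "pair_graph G" "pverts G = {..<m}" "pair_graph H" "pverts H = {..<n}"
  shows "G = H"
proof -
  interpret G: pair_graph G by fact
  interpret H: pair_graph H by fact
  have "m * m = n * n"
    using arg_cong[OF assms(1), of length] assms(3,5) by (simp add: length_graph_code)
  then have mn: "m = n"
    by (metis power2_eq_square power2_eq_imp_eq zero_le)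
  have eq: "(i, j) \<in> parcs G \<longleftrightarrow> (i, j) \<in> parcs H" if "i < n" "j < n" for i j
    using concat_map_upt_eqD[of "\<lambda>i j. (i, j) \<in> parcs G" n "[0..<n]" "\<lambda>i j. (i, j) \<in> parcs H" i j]
      assms(1,3,5) mn that by (simp add: graph_code_def)
  have "parcs G \<subseteq> {..<n} \<times> {..<n}" "parcs H \<subseteq> {..<n} \<times> {..<n}"
    using G.in_arcsD1 G.in_arcsD2 H.in_arcsD1 H.in_arcsD2 assms(3,5) mn by auto
  with eq have "parcs G = parcs H" by auto
  with assms(3,5) mn show ?thesis by simp
qed

lemma graph_code_in_LBP_yes_iff:
  assumes "is_instance r G"
  shows "graph_code G \<in> LBP_yes r \<longleftrightarrow> (\<exists>f. two_partition G f \<and> locally_balanced_open G f)"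
  using assms graph_code_inj unfolding LBP_yes_def is_instance_def by blast

end

(*
  Membership in NP and the hardness reduction both rest on one compilation. Expressions over unary numbers
  built from addition, truncated subtraction, access to the bits of the input and bounded sums are
  translated into multi-tape programs that use head positions as counters; all values stay
  polynomially bounded, hence so does the running time. Bounded quantifiers and counting are special
  sums, so it suffices to describe the bits of an output by a formula.

  A computation of a verifier is a tiling of a grid (time times position) in which a tile records the
  state, the scanned symbols, and for each tape the symbol of the cell and the direction in which the
  head lies; legal tilings are described by constraints on pairs of adjacent tiles. In the order
  encoding "tau(u) < a" of the tiles, such constraints become not-all-equal constraints on triples of
  Boolean variables, where repetitions express inequalities.

  Since a vertex of degree 3 is balanced iff its neighbours are not all equally coloured, a constraint
  is a vertex of degree 3. Removing a line from the Fano plane leaves six lines, and a colouring that is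
  constant on none of them is constant on the removed line. A cyclic chain of such gadgets replaces a variable by copies that are used only once. To make all degrees equal, take
  three copies of the structure and pad with triples formed by the three copies of one vertex: two
  copies coloured alike and one oppositely satisfy these. Finally, every triple is taken twice, so
  that colouring its two occurrences differently balances the vertices of degree 8r.
*)

theory Submission
  imports Defs "HOL-Library.Countable"
begin


section \<open>Structured programs on Turing machine tapes\<close>

text \<open>The adjacency matrix has to be given by one formula in the vertex numbers. This is why
  the graph contains a gadget for every position of each of the \<open>m * m * m\<close> triples of
  variables, constraint or not: all vertex numbers are then mixed-radix numerals, no constraint has
  to be located in a list, and a constraint only decides how the nine points of an array are joined.
  The 8 in \<open>8 * r\<close> comes from the degrees before padding: point 0 of a gadget belongs
  to two Fano planes with two remaining lines each, so it lies on 4 triples, and doubling the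
  triples gives 8. For \<open>r = 1\<close> this point gets no padding at all. A gadget has 6 points
  in 3 copies, that is 18 vertices of degree \<open>8 * r\<close>, which calls for
  \<open>18 * 8 * r / 3 = 48 * r\<close> vertices of degree 3, two for each of \<open>24 * r\<close>
  triples. Balance does not distinguish the two colours, so truth values exist only relative to one
  distinguished variable. The machine, and with it the number of tiles, is fixed while the input
  varies; relations between tiles can therefore enter the formulas as finite tables.\<close>

datatype com =
    Put nat nat head_move
  | Move nat head_move
  | Seq com com
  | Branch nat nat com com
  | Until nat nat com

instance head_move :: countable by countable_datatype
instance com :: countable by countable_datatype

fun cstep :: "com list \<times> (nat \<Rightarrow> tape) \<Rightarrow> com list \<times> (nat \<Rightarrow> tape)" where
  "cstep ([], \<sigma>) = ([], \<sigma>)"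
| "cstep (Put j s m # k, \<sigma>) = (k, \<sigma>(j := act (s, m) (\<sigma> j)))"
| "cstep (Move j m # k, \<sigma>) = (k, \<sigma>(j := act (scan (\<sigma> j), m) (\<sigma> j)))"
| "cstep (Seq a b # k, \<sigma>) = (a # b # k, \<sigma>)"
| "cstep (Branch j s a b # k, \<sigma>) = ((if scan (\<sigma> j) = s then a else b) # k, \<sigma>)"
| "cstep (Until j s a # k, \<sigma>) = (if scan (\<sigma> j) = s then k else a # Until j s a # k, \<sigma>)"

text \<open>A transition function sees the scanned symbols only. So \<open>cstep\<close> is split
  into the part that changes the stack and, in \<open>acts\<close>, the part that changes the
  tapes.\<close>

fun ctrl :: "com list \<Rightarrow> nat list \<Rightarrow> com list" where
  "ctrl [] ss = []"
| "ctrl (Put j s m # k) ss = k"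
| "ctrl (Move j m # k) ss = k"
| "ctrl (Seq a b # k) ss = a # b # k"
| "ctrl (Branch j s a b # k) ss = (if ss ! j = s then a else b) # k"
| "ctrl (Until j s a # k) ss = (if ss ! j = s then k else a # Until j s a # k)"

definition keep :: "nat list \<Rightarrow> (nat \<times> head_move) list" where
  "keep ss = map (\<lambda>s. (s, Stay)) ss"

fun acts :: "com list \<Rightarrow> nat list \<Rightarrow> (nat \<times> head_move) list" where
  "acts (Put j s m # k) ss = (keep ss)[j := (s, m)]"
| "acts (Move j m # k) ss = (keep ss)[j := (ss ! j, m)]"
| "acts k ss = keep ss"

text \<open>The control state is the stack of commands that remain to be executed. Only finitely many stacks
  are reachable from a given command, so they can be numbered and used as states.\<close>

fun reach :: "com \<Rightarrow> com list \<Rightarrow> com list set" where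
  "reach (Seq a b) k = insert (Seq a b # k) (reach a (b # k) \<union> reach b k)"
| "reach (Branch j s a b) k = insert (Branch j s a b # k) (reach a k \<union> reach b k)"
| "reach (Until j s a) k = insert (Until j s a # k) (reach a (Until j s a # k))"
| "reach c k = {c # k}"

lemma finite_reach: "finite (reach c k)"
  by (induction c arbitrary: k) auto

lemma reach_refl: "c # k \<in> reach c k"
  by (cases c) auto

text \<open>Induction over the command for all continuations: a step inside a subcommand stays among
  its own stacks until the subcommand ends, and the continuation then uncovered is \<open>k\<close>
  or again a reachable stack. This closes the state set under transitions.\<close>

lemma ctrl_reach: "l \<in> reach c k \<Longrightarrow> ctrl l ss \<in> insert k (reach c k)"
proof (induction c arbitrary: k)
  case (Seq a b)
  then show ?case using reach_refl[of a "b # k"] reach_refl[of b k] by fastforce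
next
  case (Branch j s a b)
  then consider "l = Branch j s a b # k" | "l \<in> reach a k" | "l \<in> reach b k" by auto
  then show ?case using reach_refl[of a k] reach_refl[of b k] Branch.IH by cases auto
next
  case (Until j s a)
  then consider "l = Until j s a # k" | "l \<in> reach a (Until j s a # k)" by auto
  then show ?case
    using reach_refl[of a "Until j s a # k"] Until.IH[of "Until j s a # k"] by cases auto
qed auto

fun wfc :: "nat \<Rightarrow> com \<Rightarrow> bool" where
  "wfc w (Put j s m) \<longleftrightarrow> j < w \<and> s \<le> 2"
| "wfc w (Move j m) \<longleftrightarrow> j < w"
| "wfc w (Seq a b) \<longleftrightarrow> wfc w a \<and> wfc w b"
| "wfc w (Branch j s a b) \<longleftrightarrow> j < w \<and> wfc w a \<and> wfc w b"
| "wfc w (Until j s a) \<longleftrightarrow> j < w \<and> wfc w a"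

lemma wfc_reach: "wfc w c \<Longrightarrow> list_all (wfc w) k \<Longrightarrow> l \<in> reach c k \<Longrightarrow> list_all (wfc w) l"
proof (induction c arbitrary: k)
  case (Seq a b)
  have "list_all (wfc w) (b # k)" using Seq.prems by simp
  then show ?case using Seq by fastforce
next
  case (Until j s a)
  have "list_all (wfc w) (Until j s a # k)" using Until.prems by simp
  then show ?case using Until by fastforce
qed auto

text \<open>Stacks become states through the numbering \<open>to_nat\<close> of a countable type.
  The empty stack, on which \<open>cstep\<close> is idle, is the halting state.\<close>

definition machine :: "nat \<Rightarrow> com \<Rightarrow> turing_machine" where
  "machine w c = \<lparr>num_tapes = w, states = to_nat ` insert [] (reach c []), symbols = {0, 1, 2},
     start = to_nat [c], halt = to_nat ([] :: com list),
     delta = (\<lambda>q ss. (to_nat (ctrl (from_nat q) ss), acts (from_nat q) ss))\<rparr>"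

lemma length_acts: "length (acts k ss) = length ss"
  by (cases "(k, ss)" rule: acts.cases) (auto simp: keep_def)

lemma acts_symbols:
  assumes "list_all (wfc w) k" "length ss = w" "set ss \<subseteq> {0, 1, 2}"
  shows "fst ` set (acts k ss) \<subseteq> {0, 1, 2}"
proof -
  have keep: "fst ` set (keep ss) \<subseteq> {0, 1, 2}"
    using assms(3) by (auto simp: keep_def)
  have upd: "fst ` set ((keep ss)[j := a]) \<subseteq> {0, 1, 2}" if "fst a \<in> {0, 1, 2}" for j a
  proof -
    have "fst ` set ((keep ss)[j := a]) \<subseteq> fst ` insert a (set (keep ss))"
      by (intro image_mono set_update_subset_insert)
    then show ?thesis by (rule order_trans) (use that keep in simp)
  qed
  show ?thesis
  proof (cases "(k, ss)" rule: acts.cases)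
    case (1 j s m k' ss')
    then have "s \<in> {0, 1, 2}" using assms(1) by auto
    then show ?thesis using upd[of "(s, m)" j] 1 by simp
  next
    case (2 j m k' ss')
    then have "j < length ss" using assms by auto
    then have "ss ! j \<in> {0, 1, 2}" using assms(3) nth_mem by blast
    then show ?thesis using upd[of "(ss ! j, m)" j] 2 by simp
  qed (use keep in auto)
qed

lemma wf_machine:
  assumes "wfc w c" "w \<ge> 1"
  shows "wf_tm (machine w c)"
proof -
  have "fst ` set (acts l ss) \<subseteq> {0, 1, 2}"
    if "l \<in> insert [] (reach c [])" "length ss = w" "set ss \<subseteq> {0, 1, 2}" for l ss
    using that wfc_reach[OF assms(1), of "[]" l] by (intro acts_symbols[of w]) auto
  moreover have "ctrl l ss \<in> insert [] (reach c [])" if "l \<in> insert [] (reach c [])" for l ss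
    using that ctrl_reach[of l c "[]" ss] by auto
  ultimately have "\<forall>q \<in> states (machine w c). \<forall>ss. length ss = w \<and> set ss \<subseteq> {0, 1, 2} \<longrightarrow>
      fst (delta (machine w c) q ss) \<in> states (machine w c) \<and>
      length (snd (delta (machine w c) q ss)) = w \<and> fst ` set (snd (delta (machine w c) q ss)) \<subseteq> {0, 1, 2}"
    unfolding machine_def turing_machine.simps
    by (intro ballI allI impI, elim imageE conjE) (simp only: from_nat_to_nat fst_conv snd_conv length_acts imageI)
  moreover have "num_tapes (machine w c) = w" "symbols (machine w c) = {0, 1, 2}"
    "finite (states (machine w c))" "start (machine w c) \<in> states (machine w c)"
    "halt (machine w c) \<in> states (machine w c)"
    using finite_reach reach_refl[of c "[]"] by (simp_all add: machine_def)
  ultimately show ?thesis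
    using assms(2) unfolding wf_tm_def by simp
qed

section \<open>Machine runs and program runs agree step by step\<close>

definition conf :: "nat \<Rightarrow> com list \<times> (nat \<Rightarrow> tape) \<Rightarrow> config" where
  "conf w = (\<lambda>(k, \<sigma>). (to_nat k, map \<sigma> [0..<w]))"

lemma act_keep: "act (scan t, Stay) t = t"
  by (cases t) auto

lemma map2_act_keep: "map2 act (keep (map (\<lambda>x. scan (\<sigma> x)) js)) (map \<sigma> js) = map \<sigma> js"
  by (induction js) (auto simp: keep_def act_keep)

lemma map2_act_upd:
  assumes "j < w"
  shows "map2 act ((keep (map (\<lambda>x. scan (\<sigma> x)) [0..<w]))[j := a]) (map \<sigma> [0..<w]) = map (\<sigma>(j := act a (\<sigma> j))) [0..<w]"
  using assms by (intro nth_equalityI) (auto simp: keep_def act_keep nth_list_update)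

lemma tm_step_machine:
  assumes "list_all (wfc w) k"
  shows "tm_step (machine w c) (conf w (k, \<sigma>)) = conf w (cstep (k, \<sigma>))"
  using assms
  by (cases "(k, \<sigma>)" rule: cstep.cases)
     (auto simp: conf_def machine_def Let_def map2_act_upd map2_act_keep o_def)

lemma cstep_wfc: "list_all (wfc w) k \<Longrightarrow> list_all (wfc w) (fst (cstep (k, \<sigma>)))"
  by (cases "(k, \<sigma>)" rule: cstep.cases) auto

lemma tm_steps_machine:
  assumes "list_all (wfc w) k"
  shows "(tm_step (machine w c) ^^ t) (conf w (k, \<sigma>)) = conf w ((cstep ^^ t) (k, \<sigma>))"
proof -
  have "(tm_step (machine w c) ^^ t) (conf w (k, \<sigma>)) = conf w ((cstep ^^ t) (k, \<sigma>))
    \<and> list_all (wfc w) (fst ((cstep ^^ t) (k, \<sigma>)))"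
  proof (induction t)
    case (Suc t)
    then show ?case
      by (cases "(cstep ^^ t) (k, \<sigma>)") (auto simp: tm_step_machine dest: cstep_wfc)
  qed (use assms in auto)
  then show ?thesis by blast
qed

text \<open>The step count \<open>t\<close> is chosen before the remaining stack \<open>k\<close>: a
  command never looks at what follows it, and the uniformity in \<open>k\<close> makes the rules for
  composition immediate.\<close>

definition exec :: "com \<Rightarrow> nat \<Rightarrow> (nat \<Rightarrow> tape) \<Rightarrow> (nat \<Rightarrow> tape) \<Rightarrow> bool" where
  "exec c B \<sigma> \<sigma>' \<longleftrightarrow> (\<exists>t \<le> B. \<forall>k. (cstep ^^ t) (c # k, \<sigma>) = (k, \<sigma>'))"

lemma execI: "(\<And>k. (cstep ^^ t) (c # k, \<sigma>) = (k, \<sigma>')) \<Longrightarrow> t \<le> B \<Longrightarrow> exec c B \<sigma> \<sigma>'"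
  unfolding exec_def by blast

lemma exec_mono: "exec c A \<sigma> \<sigma>' \<Longrightarrow> A \<le> B \<Longrightarrow> exec c B \<sigma> \<sigma>'"
  unfolding exec_def using le_trans by blast

lemma exec_Put: "exec (Put j s m) 1 \<sigma> (\<sigma>(j := act (s, m) (\<sigma> j)))"
  by (rule execI[of 1]) auto

lemma exec_Move: "exec (Move j m) 1 \<sigma> (\<sigma>(j := act (scan (\<sigma> j), m) (\<sigma> j)))"
  by (rule execI[of 1]) auto

lemma exec_Seq:
  assumes "exec a A \<sigma> \<sigma>1" "exec b B \<sigma>1 \<sigma>2"
  shows "exec (Seq a b) (A + B + 1) \<sigma> \<sigma>2"
proof -
  obtain t where t: "t \<le> A" "\<And>k. (cstep ^^ t) (a # k, \<sigma>) = (k, \<sigma>1)"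
    using assms(1) unfolding exec_def by blast
  obtain u where u: "u \<le> B" "\<And>k. (cstep ^^ u) (b # k, \<sigma>1) = (k, \<sigma>2)"
    using assms(2) unfolding exec_def by blast
  have "(cstep ^^ (u + (t + 1))) (Seq a b # k, \<sigma>) = (k, \<sigma>2)" for k
    by (simp only: funpow_add o_apply) (simp add: t u)
  then show ?thesis using t u by (intro execI[of "u + (t + 1)"]) auto
qed

lemma exec_Branch:
  assumes "exec (if scan (\<sigma> j) = s then a else b) B \<sigma> \<sigma>'"
  shows "exec (Branch j s a b) (B + 1) \<sigma> \<sigma>'"
proof -
  obtain t where t: "t \<le> B" "\<And>k. (cstep ^^ t) ((if scan (\<sigma> j) = s then a else b) # k, \<sigma>) = (k, \<sigma>')"
    using assms unfolding exec_def by blast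
  show ?thesis using t
    by (intro execI[of "t + 1"]) (simp_all only: funpow_add o_apply, simp_all)
qed

lemma exec_Until_done: "scan (\<sigma> j) = s \<Longrightarrow> exec (Until j s a) 1 \<sigma> \<sigma>"
  by (rule execI[of 1]) auto

lemma exec_Until_step:
  assumes "scan (\<sigma> j) \<noteq> s" "exec a A \<sigma> \<sigma>1" "exec (Until j s a) B \<sigma>1 \<sigma>2"
  shows "exec (Until j s a) (A + B + 1) \<sigma> \<sigma>2"
proof -
  obtain t where t: "t \<le> A" "\<And>k. (cstep ^^ t) (a # k, \<sigma>) = (k, \<sigma>1)"
    using assms(2) unfolding exec_def by blast
  obtain u where u: "u \<le> B" "\<And>k. (cstep ^^ u) (Until j s a # k, \<sigma>1) = (k, \<sigma>2)"
    using assms(3) unfolding exec_def by blast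
  have "(cstep ^^ (u + (t + 1))) (Until j s a # k, \<sigma>) = (k, \<sigma>2)" for k
    by (simp only: funpow_add o_apply) (simp add: t u assms(1))
  then show ?thesis using t u by (intro execI[of "u + (t + 1)"]) auto
qed

text \<open>The states are numbered by the iterations that remain, so the exit test succeeds exactly
  in \<open>S 0\<close>.\<close>

lemma exec_Until:
  assumes "\<And>i. i < n \<Longrightarrow> exec a B (S (Suc i)) (S i)"
    and "\<And>i. i \<le> n \<Longrightarrow> scan (S i j) = s \<longleftrightarrow> i = 0"
  shows "exec (Until j s a) (n * (B + 1) + 1) (S n) (S 0)"
  using assms
proof (induction n)
  case 0
  then show ?case using exec_Until_done[of "S 0" j s a] by simp
next
  case (Suc n)
  have "exec (Until j s a) (B + (n * (B + 1) + 1) + 1) (S (Suc n)) (S 0)"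
    using Suc by (intro exec_Until_step[of _ _ _ _ _ "S n"]) auto
  then show ?case by (rule exec_mono) simp
qed

definition start_tapes :: "bool list \<Rightarrow> nat \<Rightarrow> tape" where
  "start_tapes x j = (0, string_cells (if j = 0 then x else []))"

theorem polytimeI:
  assumes "wfc (Suc w) c"
    and "\<And>x. \<exists>\<sigma>. exec c (poly p (length x)) (start_tapes x) \<sigma> \<and> snd (\<sigma> w) = string_cells (f x)"
  shows "polytime f"
proof -
  let ?M = "machine (Suc w) c"
  have "let (q, ts) = (tm_step ?M ^^ poly p (length x)) (init_config ?M x)
        in q = halt ?M \<and> snd (last ts) = string_cells (f x)" for x
  proof -
    obtain \<sigma> t where t: "t \<le> poly p (length x)" "(cstep ^^ t) ([c], start_tapes x) = ([], \<sigma>)"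
        and \<sigma>: "snd (\<sigma> w) = string_cells (f x)"
      using assms(2)[of x] unfolding exec_def by blast
    \<comment> \<open>The machine is inspected after exactly \<open>poly p (length x)\<close> steps;
      ending earlier is harmless because the empty stack is idle.\<close>
    have "(cstep ^^ u) ([], \<sigma>) = ([], \<sigma>)" for u
      by (induction u) auto
    then have "(cstep ^^ (poly p (length x) - t + t)) ([c], start_tapes x) = ([], \<sigma>)"
      by (simp only: funpow_add o_apply t)
    then have final: "(cstep ^^ poly p (length x)) ([c], start_tapes x) = ([], \<sigma>)"
      using t(1) by simp
    have "init_config ?M x = conf (Suc w) ([c], start_tapes x)"
      unfolding init_config_def conf_def machine_def
      by (simp add: start_tapes_def map_upt_Suc map_replicate_const del: upt_Suc)
    then have "(tm_step ?M ^^ poly p (length x)) (init_config ?M x) = conf (Suc w) ([], \<sigma>)"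
      using tm_steps_machine[of "Suc w" "[c]"] assms(1) final by simp
    then show ?thesis
      using \<sigma> by (simp add: conf_def machine_def)
  qed
  then show ?thesis
    using wf_machine[OF assms(1)] unfolding polytime_def computes_in_time_def by auto
qed


section \<open>Compiling unary arithmetic with bounded sums\<close>

definition marker :: "int \<Rightarrow> nat" where
  "marker i = (if i = 0 then 1 else 0)"

text \<open>Tape 0 holds the input and tape \<open>w\<close> the output; every other tape is a counter whose value is its
  head position, the marker in cell 0 making the test for zero possible.\<close>

definition cfg :: "bool list \<Rightarrow> nat \<Rightarrow> bool list \<Rightarrow> (nat \<Rightarrow> nat) \<Rightarrow> nat \<Rightarrow> tape" where
  "cfg x w out \<rho> j =
     (if j = 0 then (int (\<rho> 0), string_cells x)
      else if j = w then (int (length out), string_cells out)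
      else (int (\<rho> j), if j < w then marker else string_cells []))"

lemma exec_inc:
  assumes "r \<noteq> w"
  shows "exec (Move r MoveRight) 1 (cfg x w out \<rho>) (cfg x w out (\<rho>(r := Suc (\<rho> r))))"
proof -
  have "(cfg x w out \<rho>)(r := act (scan (cfg x w out \<rho> r), MoveRight) (cfg x w out \<rho> r))
      = cfg x w out (\<rho>(r := Suc (\<rho> r)))"
    using assms by (auto simp: cfg_def fun_eq_iff)
  then show ?thesis using exec_Move by metis
qed

lemma exec_dec:
  assumes "r \<noteq> w" "\<rho> r > 0"
  shows "exec (Move r MoveLeft) 1 (cfg x w out \<rho>) (cfg x w out (\<rho>(r := \<rho> r - 1)))"
proof -
  have "(cfg x w out \<rho>)(r := act (scan (cfg x w out \<rho> r), MoveLeft) (cfg x w out \<rho> r))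
      = cfg x w out (\<rho>(r := \<rho> r - 1))"
    using assms by (auto simp: cfg_def fun_eq_iff)
  then show ?thesis using exec_Move by metis
qed

lemma exec_skip: "exec (Move r Stay) 1 \<sigma> \<sigma>"
  using exec_Move[of r Stay \<sigma>] by (simp add: act_keep)

lemma exec_output:
  assumes "w > 0"
  shows "exec (Put w (if b then 2 else 1) MoveRight) 1 (cfg x w out \<rho>) (cfg x w (out @ [b]) \<rho>)"
proof -
  have "(cfg x w out \<rho>)(w := act (if b then 2 else 1, MoveRight) (cfg x w out \<rho> w)) = cfg x w (out @ [b]) \<rho>"
    using assms by (auto simp: cfg_def fun_eq_iff nth_append string_cells_def)
  then show ?thesis using exec_Put by metis
qed

lemma scan_counter: "0 < r \<Longrightarrow> r < w \<Longrightarrow> scan (cfg x w out \<rho> r) = 1 \<longleftrightarrow> \<rho> r = 0"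
  by (simp add: cfg_def marker_def)

lemma scan_input: "scan (cfg x w out \<rho> 0) = (if \<rho> 0 < length x then if x ! \<rho> 0 then 2 else 1 else 0)"
  by (simp add: cfg_def string_cells_def)

definition drain :: "nat \<Rightarrow> nat \<Rightarrow> com" where
  "drain r t = Until r 1 (Seq (Move r MoveLeft) (Move t MoveRight))"

text \<open>Reading a counter destroys it. Moving its value into two counters at once leaves one
  copy to be used and one from which the old position can be restored.\<close>

definition drain2 :: "nat \<Rightarrow> nat \<Rightarrow> nat \<Rightarrow> com" where
  "drain2 r t u = Until r 1 (Seq (Move r MoveLeft) (Seq (Move t MoveRight) (Move u MoveRight)))"

text \<open>Cell 0 of the input tape carries input, not a marker, so the input head cannot test
  whether it is back. The distance is kept in counter \<open>r\<close> instead.\<close>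

definition rewind :: "nat \<Rightarrow> com" where
  "rewind r = Until r 1 (Seq (Move r MoveLeft) (Move 0 MoveLeft))"

lemma exec_count:
  assumes "0 < r" "r < w" "S (\<rho> r) = \<rho>" "\<And>i. i \<le> \<rho> r \<Longrightarrow> S i r = i"
    and "\<And>i. i < \<rho> r \<Longrightarrow> exec a B (cfg x w out (S (Suc i))) (cfg x w out (S i))"
    and "\<rho> r * (B + 1) + 1 \<le> A" "S 0 = \<rho>'"
  shows "exec (Until r 1 a) A (cfg x w out \<rho>) (cfg x w out \<rho>')"
proof -
  have "exec (Until r 1 a) (\<rho> r * (B + 1) + 1) (cfg x w out (S (\<rho> r))) (cfg x w out (S 0))"
    by (rule exec_Until[of "\<rho> r" _ _ "\<lambda>i. cfg x w out (S i)"])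
       (use assms in \<open>auto simp: scan_counter simp del: One_nat_def\<close>)
  then show ?thesis using assms(3,6,7) exec_mono by auto
qed

lemma exec_cong: "exec c B \<sigma> (cfg x w out \<rho>) \<Longrightarrow> \<rho> = \<rho>' \<Longrightarrow> exec c B \<sigma> (cfg x w out \<rho>')"
  by simp

lemma exec_Seq_le: "exec a A \<sigma> \<sigma>1 \<Longrightarrow> exec b B \<sigma>1 \<sigma>2 \<Longrightarrow> A + B + 1 \<le> C \<Longrightarrow> exec (Seq a b) C \<sigma> \<sigma>2"
  using exec_Seq exec_mono by blast

lemma exec_drain:
  assumes "0 < r" "r < w" "t \<noteq> w" "r \<noteq> t"
  shows "exec (drain r t) (4 * \<rho> r + 1) (cfg x w out \<rho>) (cfg x w out (\<rho>(r := 0, t := \<rho> t + \<rho> r)))"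
  unfolding drain_def
proof (rule exec_count[where S = "\<lambda>i. \<rho>(r := i, t := \<rho> t + (\<rho> r - i))" and B = 3])
  fix i assume i: "i < \<rho> r"
  let ?S = "\<lambda>i. \<rho>(r := i, t := \<rho> t + (\<rho> r - i))"
  show "exec (Seq (Move r MoveLeft) (Move t MoveRight)) 3 (cfg x w out (?S (Suc i))) (cfg x w out (?S i))"
    by (rule exec_Seq_le[OF exec_dec exec_cong[OF exec_inc]])
       (use assms i in \<open>auto simp: fun_eq_iff\<close>)
qed (use assms in auto)

lemma exec_drain2:
  assumes "0 < r" "r < w" "t \<noteq> w" "u \<noteq> w" "r \<noteq> t" "r \<noteq> u" "t \<noteq> u"
  shows "exec (drain2 r t u) (6 * \<rho> r + 1) (cfg x w out \<rho>)
    (cfg x w out (\<rho>(r := 0, t := \<rho> t + \<rho> r, u := \<rho> u + \<rho> r)))"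
  unfolding drain2_def
proof (rule exec_count[where S = "\<lambda>i. \<rho>(r := i, t := \<rho> t + (\<rho> r - i), u := \<rho> u + (\<rho> r - i))" and B = 5])
  fix i assume i: "i < \<rho> r"
  let ?S = "\<lambda>i. \<rho>(r := i, t := \<rho> t + (\<rho> r - i), u := \<rho> u + (\<rho> r - i))"
  show "exec (Seq (Move r MoveLeft) (Seq (Move t MoveRight) (Move u MoveRight))) 5 (cfg x w out (?S (Suc i))) (cfg x w out (?S i))"
    by (rule exec_Seq_le[OF exec_dec exec_Seq_le[OF exec_inc exec_cong[OF exec_inc]]])
       (use assms i in \<open>auto simp: fun_eq_iff\<close>)
qed (use assms in auto)

lemma exec_rewind:
  assumes "0 < r" "r < w" "w > 0" "\<rho> r \<le> \<rho> 0"
  shows "exec (rewind r) (4 * \<rho> r + 1) (cfg x w out \<rho>) (cfg x w out (\<rho>(r := 0, 0 := \<rho> 0 - \<rho> r)))"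
  unfolding rewind_def
proof (rule exec_count[where S = "\<lambda>i. \<rho>(r := i, 0 := \<rho> 0 - (\<rho> r - i))" and B = 3])
  fix i assume i: "i < \<rho> r"
  let ?S = "\<lambda>i. \<rho>(r := i, 0 := \<rho> 0 - (\<rho> r - i))"
  show "exec (Seq (Move r MoveLeft) (Move 0 MoveLeft)) 3 (cfg x w out (?S (Suc i))) (cfg x w out (?S i))"
    by (rule exec_Seq_le[OF exec_dec exec_cong[OF exec_dec]])
       (use assms i in \<open>auto simp: fun_eq_iff\<close>)
qed (use assms in auto)

section \<open>Expressions, their values and their translation\<close>

datatype expr =
    Var nat
  | Const nat
  | Len
  | Add expr expr
  | Monus expr expr
  | Bit expr
  | Sum expr expr

fun eval :: "bool list \<Rightarrow> (nat \<Rightarrow> nat) \<Rightarrow> expr \<Rightarrow> nat" where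
  "eval x \<rho> (Var i) = \<rho> i"
| "eval x \<rho> (Const c) = c"
| "eval x \<rho> Len = length x"
| "eval x \<rho> (Add a b) = eval x \<rho> a + eval x \<rho> b"
| "eval x \<rho> (Monus a b) = eval x \<rho> a - eval x \<rho> b"
| "eval x \<rho> (Bit a) = (if eval x \<rho> a < length x \<and> x ! eval x \<rho> a then 1 else 0)"
| "eval x \<rho> (Sum a b) = (\<Sum>i < eval x \<rho> a. eval x (case_nat i \<rho>) b)"

fun incs :: "nat \<Rightarrow> nat \<Rightarrow> com" where
  "incs t 0 = Move t Stay"
| "incs t (Suc n) = Seq (Move t MoveRight) (incs t n)"

text \<open>The value is put into counter \<open>t\<close>, where all counters from \<open>t\<close> on are initially 0. In the loop for a
  sum, counter \<open>t + 1\<close> runs downwards and is at the same time the bound variable.\<close>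

fun compile :: "(nat \<Rightarrow> nat) \<Rightarrow> nat \<Rightarrow> expr \<Rightarrow> com" where
  "compile vm t (Var i) = Seq (drain2 (vm i) t (t + 1)) (drain (t + 1) (vm i))"
| "compile vm t (Const c) = incs t c"
| "compile vm t Len =
     Seq (Until 0 0 (Seq (Move 0 MoveRight) (Seq (Move t MoveRight) (Move (t + 1) MoveRight))))
       (rewind (t + 1))"
| "compile vm t (Add a b) = Seq (compile vm t a) (Seq (compile vm (t + 1) b) (drain (t + 1) t))"
| "compile vm t (Monus a b) = Seq (compile vm t a) (Seq (compile vm (t + 1) b)
     (Until (t + 1) 1 (Seq (Move (t + 1) MoveLeft) (Branch t 1 (Move t Stay) (Move t MoveLeft)))))"
| "compile vm t (Bit a) = Seq (compile vm t a) (Seq (drain2 t 0 (t + 1))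
     (Seq (Branch 0 2 (Move t MoveRight) (Move t Stay)) (rewind (t + 1))))"
| "compile vm t (Sum a b) = Seq (compile vm (t + 1) a)
     (Until (t + 1) 1 (Seq (Move (t + 1) MoveLeft)
       (Seq (compile (case_nat (t + 1) vm) (t + 2) b) (drain (t + 2) t))))"

fun temps :: "expr \<Rightarrow> nat" where
  "temps (Add a b) = max (temps a) (temps b) + 1"
| "temps (Monus a b) = max (temps a) (temps b) + 1"
| "temps (Bit a) = temps a"
| "temps (Sum a b) = max (temps a) (temps b + 1) + 1"
| "temps e = 2"

lemma temps_ge: "temps e \<ge> 2"
  by (induction e) auto

text \<open>The argument bounds the input length and all variables. Under a sum the bound variable
  may be as large as the number of terms, so the bound for the environment grows from
  \<open>m\<close> to \<open>m + poly (val_bound a) m\<close>; hence the composition. The nesting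
  depth is fixed by the expression, so the result is still a polynomial.\<close>

fun val_bound :: "expr \<Rightarrow> nat poly" where
  "val_bound (Var i) = [:0, 1:]"
| "val_bound (Const c) = [:c:]"
| "val_bound Len = [:0, 1:]"
| "val_bound (Add a b) = val_bound a + val_bound b"
| "val_bound (Monus a b) = val_bound a"
| "val_bound (Bit a) = 1"
| "val_bound (Sum a b) = val_bound a * pcompose (val_bound b) ([:0, 1:] + val_bound a)"

fun time_bound :: "expr \<Rightarrow> nat poly" where
  "time_bound (Var i) = [:3, 10:]"
| "time_bound (Const c) = [:2 * c + 1:]"
| "time_bound Len = [:3, 10:]"
| "time_bound (Add a b) = time_bound a + time_bound b + 4 * val_bound b + 3"
| "time_bound (Monus a b) = time_bound a + time_bound b + 5 * val_bound b + 3"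
| "time_bound (Bit a) = time_bound a + 10 * val_bound a + 7"
| "time_bound (Sum a b) = time_bound a + 2 + val_bound a *
     (pcompose (time_bound b + 4 * val_bound b + 5) ([:0, 1:] + val_bound a))"

lemma poly_nat_mono:
  fixes p :: "nat poly"
  shows "m \<le> n \<Longrightarrow> poly p m \<le> poly p n"
  by (induction p) (auto intro: add_mono mult_mono)

lemma poly_numeral_nat [simp]: "poly (numeral k) (n :: nat) = numeral k"
  by (metis of_nat_numeral poly_of_nat)

lemma eval_bound:
  assumes "length x \<le> m" "\<And>i. \<rho> i \<le> m"
  shows "eval x \<rho> e \<le> poly (val_bound e) m"
  using assms
proof (induction e arbitrary: \<rho> m)
  case (Add a b)
  then show ?case by (simp add: add_mono)
next
  case (Monus a b)
  have "eval x \<rho> a \<le> poly (val_bound a) m" using Monus by blast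
  then show ?case by simp
next
  case (Sum a b)
  let ?A = "poly (val_bound a) m"
  have a: "eval x \<rho> a \<le> ?A" using Sum by blast
  have "eval x (case_nat i \<rho>) b \<le> poly (val_bound b) (m + ?A)" if "i < eval x \<rho> a" for i
    using that a Sum.prems by (intro Sum.IH) (auto split: nat.split intro: trans_le_add1)
  then have "(\<Sum>i < eval x \<rho> a. eval x (case_nat i \<rho>) b) \<le> (\<Sum>i < eval x \<rho> a. poly (val_bound b) (m + ?A))"
    by (intro sum_mono) auto
  also have "\<dots> \<le> ?A * poly (val_bound b) (m + ?A)"
    using a by (simp add: mult_right_mono)
  finally show ?case by (simp add: poly_pcompose)
qed auto

lemma exec_incs: "t \<noteq> w \<Longrightarrow> exec (incs t n) (2 * n + 1) (cfg x w out \<rho>) (cfg x w out (\<rho>(t := \<rho> t + n)))"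
proof (induction n arbitrary: \<rho>)
  case 0
  then show ?case using exec_skip by simp
next
  case (Suc n)
  show ?case unfolding incs.simps
    by (rule exec_Seq_le[OF exec_inc exec_cong[OF Suc.IH]]) (use Suc.prems in auto)
qed

text \<open>The invariant that makes the induction work: variables live in counters below
  \<open>t\<close>, everything from \<open>t\<close> on is 0, and the input head is at its origin.
  As the conclusion changes counter \<open>t\<close> only, temporaries are zero and the input head
  is home again after each subexpression.\<close>

lemma exec_compile:
  assumes "length x \<le> m" "\<And>i. \<rho> (vm i) \<le> m" "\<rho> 0 = 0" "\<And>j. t \<le> j \<Longrightarrow> \<rho> j = 0"
    and "\<And>i. 0 < vm i" "\<And>i. vm i < t" "t + temps e \<le> w"
  shows "exec (compile vm t e) (poly (time_bound e) m) (cfg x w out \<rho>)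
    (cfg x w out (\<rho>(t := eval x (\<rho> \<circ> vm) e)))"
  using assms
proof (induction e arbitrary: vm t \<rho> m)
  case (Var i)
  have vm: "vm i < t" "0 < vm i" "\<rho> (vm i) \<le> m" using Var.prems by auto
  show ?case unfolding compile.simps
    by (rule exec_Seq_le[OF exec_drain2 exec_cong[OF exec_drain]])
       (use Var.prems(4,7) vm in \<open>auto simp: fun_eq_iff\<close>)
next
  case (Const c)
  have "exec (compile vm t (Const c)) (2 * c + 1) (cfg x w out \<rho>) (cfg x w out (\<rho>(t := \<rho> t + c)))"
    unfolding compile.simps using Const.prems by (intro exec_incs) auto
  then show ?case using Const.prems(4)[of t] by (simp add: fun_upd_def)
next
  case Len
  \<comment> \<open>Here \<open>i\<close> is the number of input cells still ahead of the head.
    Counter \<open>t + 1\<close> duplicates the count and is used up by the way back.\<close>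
  let ?S = "\<lambda>i. \<rho>(0 := length x - i, t := length x - i, t + 1 := length x - i)"
  have tw: "t + 2 \<le> w" "\<rho> t = 0" "\<rho> (Suc t) = 0" "0 < t"
    using Len.prems(4)[of t] Len.prems(4)[of "Suc t"] Len.prems(6)[of 0] Len.prems(7) by auto
  have S: "?S (length x) = \<rho>"
    using tw Len.prems(3) by (auto simp: fun_eq_iff)
  have "exec (Until 0 0 (Seq (Move 0 MoveRight) (Seq (Move t MoveRight) (Move (t + 1) MoveRight))))
      (length x * (5 + 1) + 1) (cfg x w out (?S (length x))) (cfg x w out (?S 0))"
  proof (rule exec_Until[where S = "\<lambda>i. cfg x w out (?S i)"])
    fix i assume i: "i < length x"
    show "exec (Seq (Move 0 MoveRight) (Seq (Move t MoveRight) (Move (t + 1) MoveRight))) 5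
      (cfg x w out (?S (Suc i))) (cfg x w out (?S i))"
      by (rule exec_Seq_le[OF exec_inc exec_Seq_le[OF exec_inc exec_cong[OF exec_inc]]])
        (use tw i in \<open>auto simp: fun_eq_iff\<close>)
  qed (use tw in \<open>auto simp: scan_input\<close>)
  then have 1: "exec (Until 0 0 (Seq (Move 0 MoveRight) (Seq (Move t MoveRight) (Move (t + 1) MoveRight))))
      (length x * (5 + 1) + 1) (cfg x w out \<rho>) (cfg x w out (?S 0))"
    unfolding S .
  show ?case unfolding compile.simps
    by (rule exec_Seq_le[OF 1 exec_cong[OF exec_rewind]])
       (use tw Len.prems(1,3) in \<open>auto simp: fun_eq_iff\<close>)
next
  case (Add a b)
  let ?A = "eval x (\<rho> \<circ> vm) a" and ?B = "eval x (\<rho> \<circ> vm) b"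
  have tw: "Suc t < w" using Add.prems(7) temps_ge[of b] by simp
  have vt: "vm i \<noteq> t" for i using Add.prems(6)[of i] by simp
  have env: "\<rho>(t := ?A) \<circ> vm = \<rho> \<circ> vm" using vt by (auto simp: fun_eq_iff)
  have a: "exec (compile vm t a) (poly (time_bound a) m) (cfg x w out \<rho>) (cfg x w out (\<rho>(t := ?A)))"
    using Add.prems by (intro Add.IH) auto
  have b: "exec (compile vm (t + 1) b) (poly (time_bound b) m) (cfg x w out (\<rho>(t := ?A)))
      (cfg x w out (\<rho>(t := ?A, t + 1 := ?B)))"
  proof -
    have "exec (compile vm (t + 1) b) (poly (time_bound b) m) (cfg x w out (\<rho>(t := ?A)))
        (cfg x w out (\<rho>(t := ?A, t + 1 := eval x (\<rho>(t := ?A) \<circ> vm) b)))"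
    proof (rule Add.IH)
      show "vm i < t + 1" for i using Add.prems(6)[of i] by simp
    qed (use Add.prems vt in auto)
    then show ?thesis unfolding env .
  qed
  have "?B \<le> poly (val_bound b) m"
    using Add.prems by (intro eval_bound) auto
  then show ?case unfolding compile.simps using tw Add.prems(4)[of "Suc t"]
    by (intro exec_Seq_le[OF a exec_Seq_le[OF b exec_cong[OF exec_drain]]])
       (auto simp: fun_eq_iff o_def)
next
  case (Monus a b)
  let ?A = "eval x (\<rho> \<circ> vm) a" and ?B = "eval x (\<rho> \<circ> vm) b"
  have tw: "Suc t < w" "t > 0" using Monus.prems(6)[of 0] Monus.prems(7) temps_ge[of b] by simp_all
  have vt: "vm i \<noteq> t" for i using Monus.prems(6)[of i] by simp
  have env: "\<rho>(t := ?A) \<circ> vm = \<rho> \<circ> vm" using vt by (auto simp: fun_eq_iff)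
  have a: "exec (compile vm t a) (poly (time_bound a) m) (cfg x w out \<rho>) (cfg x w out (\<rho>(t := ?A)))"
    using Monus.prems by (intro Monus.IH) auto
  have b: "exec (compile vm (t + 1) b) (poly (time_bound b) m) (cfg x w out (\<rho>(t := ?A)))
      (cfg x w out (\<rho>(t := ?A, t + 1 := ?B)))"
  proof -
    have "exec (compile vm (t + 1) b) (poly (time_bound b) m) (cfg x w out (\<rho>(t := ?A)))
        (cfg x w out (\<rho>(t := ?A, t + 1 := eval x (\<rho>(t := ?A) \<circ> vm) b)))"
    proof (rule Monus.IH)
      show "vm i < t + 1" for i using Monus.prems(6)[of i] by simp
    qed (use Monus.prems vt in auto)
    then show ?thesis unfolding env .
  qed
  have B: "?B \<le> poly (val_bound b) m"
    using Monus.prems by (intro eval_bound) auto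
  \<comment> \<open>\<open>i\<close> units of the second value are still to be subtracted.
    Truncation happens unit by unit: once counter \<open>t\<close> is 0 the branch leaves it alone,
    as a head to the left of its marker would not represent a number.\<close>
  let ?S = "\<lambda>i. \<rho>(t := ?A - (?B - i), t + 1 := i)"
  have loop: "exec (Until (t + 1) 1 (Seq (Move (t + 1) MoveLeft) (Branch t 1 (Move t Stay) (Move t MoveLeft))))
      (5 * ?B + 1) (cfg x w out (\<rho>(t := ?A, t + 1 := ?B))) (cfg x w out (\<rho>(t := ?A - ?B)))"
  proof (rule exec_count[where S = ?S and B = 4])
    fix i assume "i < (\<rho>(t := ?A, t + 1 := ?B)) (t + 1)"
    then have i: "i < ?B" by simp
    have br: "exec (Branch t 1 (Move t Stay) (Move t MoveLeft)) 2
      (cfg x w out ((?S (Suc i))(t + 1 := i))) (cfg x w out (?S i))"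
    proof (rule exec_mono[OF exec_Branch])
      have "exec (Move t MoveLeft) 1 (cfg x w out ((?S (Suc i))(t + 1 := i))) (cfg x w out (?S i))"
        if "?A - (?B - Suc i) \<noteq> 0"
        by (rule exec_cong[OF exec_dec]) (use that tw i in \<open>auto simp: fun_eq_iff\<close>)
      moreover have "exec (Move t Stay) 1 (cfg x w out ((?S (Suc i))(t + 1 := i))) (cfg x w out (?S i))"
        if "?A - (?B - Suc i) = 0"
      proof -
        have "?A - (?B - i) = 0" using that i by simp
        then have "(?S (Suc i))(t + 1 := i) = ?S i" using that by (auto simp: fun_eq_iff)
        then show ?thesis using exec_skip by simp
      qed
      ultimately show "exec (if scan (cfg x w out ((?S (Suc i))(t + 1 := i)) t) = 1
        then Move t Stay else Move t MoveLeft) 1 (cfg x w out ((?S (Suc i))(t + 1 := i))) (cfg x w out (?S i))"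
        using tw by (subst scan_counter) auto
    qed simp
    show "exec (Seq (Move (t + 1) MoveLeft) (Branch t 1 (Move t Stay) (Move t MoveLeft))) 4
      (cfg x w out (?S (Suc i))) (cfg x w out (?S i))"
      by (rule exec_Seq_le[OF exec_cong[OF exec_dec] br]) (use tw in auto)
  qed (use tw Monus.prems(4)[of "Suc t"] in \<open>auto simp: fun_eq_iff\<close>)
  show ?case unfolding compile.simps using B
    by (intro exec_Seq_le[OF a exec_Seq_le[OF b exec_cong[OF loop]]]) (auto simp: o_def fun_eq_iff)
next
  case (Bit a)
  let ?A = "eval x (\<rho> \<circ> vm) a"
  have tw: "Suc t < w" "t > 0" "\<rho> t = 0" "\<rho> (Suc t) = 0"
    using Bit.prems(4)[of t] Bit.prems(4)[of "Suc t"] Bit.prems(6)[of 0] Bit.prems(7) temps_ge[of a] by simp_all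
  have a: "exec (compile vm t a) (poly (time_bound a) m) (cfg x w out \<rho>) (cfg x w out (\<rho>(t := ?A)))"
    using Bit.prems by (intro Bit.IH) auto
  have A: "?A \<le> poly (val_bound a) m"
    using Bit.prems by (intro eval_bound) auto
  let ?b = "eval x (\<rho> \<circ> vm) (Bit a)"
  let ?\<rho> = "\<rho>(0 := ?A, t + 1 := ?A)"
  have dr: "exec (drain2 t 0 (t + 1)) (6 * ?A + 1) (cfg x w out (\<rho>(t := ?A))) (cfg x w out ?\<rho>)"
    by (rule exec_mono[OF exec_cong[OF exec_drain2]]) (use tw Bit.prems(3) in \<open>auto simp: fun_eq_iff\<close>)
  have br: "exec (Branch 0 2 (Move t MoveRight) (Move t Stay)) 2 (cfg x w out ?\<rho>) (cfg x w out (?\<rho>(t := ?b)))"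
  proof (rule exec_mono[OF exec_Branch])
    have "?\<rho>(t := 0) = ?\<rho>" using tw by (auto simp: fun_eq_iff)
    then have "exec (Move t Stay) 1 (cfg x w out ?\<rho>) (cfg x w out (?\<rho>(t := 0)))"
      using exec_skip by simp
    moreover have "exec (Move t MoveRight) 1 (cfg x w out ?\<rho>) (cfg x w out (?\<rho>(t := 1)))"
      by (rule exec_cong[OF exec_inc]) (use tw in \<open>auto simp: fun_eq_iff\<close>)
    ultimately show "exec (if scan (cfg x w out ?\<rho> 0) = 2 then Move t MoveRight else Move t Stay) 1
      (cfg x w out ?\<rho>) (cfg x w out (?\<rho>(t := ?b)))"
      by (subst scan_input) auto
  qed simp
  have rw: "exec (rewind (t + 1)) (4 * ?A + 1) (cfg x w out (?\<rho>(t := ?b))) (cfg x w out (\<rho>(t := ?b)))"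
    by (rule exec_mono[OF exec_cong[OF exec_rewind]]) (use tw Bit.prems(3) in \<open>auto simp: fun_eq_iff\<close>)
  show ?case unfolding compile.simps
    by (rule exec_Seq_le[OF a exec_Seq_le[OF dr exec_Seq_le[OF br rw order.refl] order.refl]])
       (use A in simp)
next
  case (Sum a b)
  let ?A = "eval x (\<rho> \<circ> vm) a" and ?g = "\<lambda>i. eval x (case_nat i (\<rho> \<circ> vm)) b"
  let ?m = "m + poly (val_bound a) m"
  have tw: "Suc (Suc t) < w" "t > 0" using Sum.prems(6)[of 0] Sum.prems(7) temps_ge[of b] by simp_all
  have t0: "\<rho> t = 0" "\<rho> (Suc t) = 0" "\<rho> (Suc (Suc t)) = 0" using Sum.prems(4) by auto
  have A: "?A \<le> poly (val_bound a) m"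
    using Sum.prems by (intro eval_bound) auto
  have a: "exec (compile vm (t + 1) a) (poly (time_bound a) m) (cfg x w out \<rho>) (cfg x w out (\<rho>(t + 1 := ?A)))"
    using Sum.prems by (intro Sum.IH) (auto simp: less_Suc_eq)
  \<comment> \<open>The bound variable runs downwards, so the accumulator holds the terms from
    \<open>i\<close> on and the loop ends with the full sum at \<open>i = 0\<close>.\<close>
  let ?S = "\<lambda>i. \<rho>(t := (\<Sum>k = i..<?A. ?g k), t + 1 := i)"
  let ?T = "poly (time_bound b + 4 * val_bound b + 4) ?m"
  have loop: "exec (Until (t + 1) 1 (Seq (Move (t + 1) MoveLeft)
       (Seq (compile (case_nat (t + 1) vm) (t + 2) b) (drain (t + 2) t)))) (?A * (?T + 1) + 1)
       (cfg x w out (\<rho>(t + 1 := ?A))) (cfg x w out (\<rho>(t := (\<Sum>i<?A. ?g i))))"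
  proof (rule exec_count[where S = ?S and B = ?T])
    fix i assume "i < (\<rho>(t + 1 := ?A)) (t + 1)"
    then have i: "i < ?A" by simp
    let ?\<rho> = "(?S (Suc i))(t + 1 := i)"
    have env: "?\<rho> \<circ> case_nat (t + 1) vm = case_nat i (\<rho> \<circ> vm)"
    proof
      fix j
      show "(?\<rho> \<circ> case_nat (t + 1) vm) j = case_nat i (\<rho> \<circ> vm) j"
        using Sum.prems(6)[of "j - 1"] by (cases j) auto
    qed
    have le: "case_nat i (\<rho> \<circ> vm) j \<le> ?m" for j
      using i A Sum.prems(2)[of "j - 1"] by (auto split: nat.split)
    have "exec (compile (case_nat (t + 1) vm) (t + 2) b) (poly (time_bound b) ?m)
        (cfg x w out ?\<rho>) (cfg x w out (?\<rho>(t + 2 := eval x (?\<rho> \<circ> case_nat (t + 1) vm) b)))"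
    proof (rule Sum.IH)
      show "?\<rho> (case_nat (t + 1) vm j) \<le> ?m" for j
        using le[of j] fun_cong[OF env, of j] by (simp only: o_apply)
      show "0 < case_nat (t + 1) vm j" for j
        using Sum.prems(5) by (auto split: nat.split)
      show "case_nat (t + 1) vm j < t + 2" for j
        using Sum.prems(6)[of "j - 1"] by (auto split: nat.split)
    qed (use Sum.prems tw in auto)
    then have b: "exec (compile (case_nat (t + 1) vm) (t + 2) b) (poly (time_bound b) ?m)
        (cfg x w out ?\<rho>) (cfg x w out (?\<rho>(t + 2 := ?g i)))"
      unfolding env .
    have g: "?g i \<le> poly (val_bound b) ?m"
      using Sum.prems(1) le by (intro eval_bound) auto
    have sum: "(\<Sum>k = i..<?A. ?g k) = ?g i + (\<Sum>k = Suc i..<?A. ?g k)"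
      using i by (rule sum.atLeast_Suc_lessThan)
    have dr: "exec (drain (t + 2) t) (4 * ?g i + 1) (cfg x w out (?\<rho>(t + 2 := ?g i))) (cfg x w out (?S i))"
      by (rule exec_mono[OF exec_cong[OF exec_drain]]) (use tw t0 sum in \<open>auto simp: fun_eq_iff\<close>)
    have d: "exec (Move (t + 1) MoveLeft) 1 (cfg x w out (?S (Suc i))) (cfg x w out ?\<rho>)"
      by (rule exec_cong[OF exec_dec]) (use tw in auto)
    show "exec (Seq (Move (t + 1) MoveLeft) (Seq (compile (case_nat (t + 1) vm) (t + 2) b) (drain (t + 2) t)))
        ?T (cfg x w out (?S (Suc i))) (cfg x w out (?S i))"
      by (rule exec_Seq_le[OF d exec_Seq_le[OF b dr order.refl]]) (use g in simp)
  qed (use tw t0 in \<open>auto simp: fun_eq_iff atLeast0LessThan\<close>)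
  have "?A * (?T + 1) \<le> poly (val_bound a) m * (?T + 1)"
    using A by (rule mult_right_mono) simp
  then have time: "poly (time_bound a) m + (?A * (?T + 1) + 1) + 1 \<le> poly (time_bound (Sum a b)) m"
    by (simp add: poly_pcompose ac_simps)
  show ?case unfolding compile.simps
    using exec_Seq_le[OF a loop time] by (simp add: o_def fun_upd_def)
qed

section \<open>Writing a table of bits\<close>

fun marks :: "nat \<Rightarrow> com" where
  "marks 0 = Move 0 Stay"
| "marks (Suc n) = Seq (Put (Suc n) 1 Stay) (marks n)"

lemma exec_marks:
  "exec (marks n) (2 * n + 1) \<sigma> (\<lambda>j. if 0 < j \<and> j \<le> n then act (1, Stay) (\<sigma> j) else \<sigma> j)"
proof (induction n arbitrary: \<sigma>)
  case 0
  have "(\<lambda>j. if 0 < j \<and> j \<le> 0 then act (1, Stay) (\<sigma> j) else \<sigma> j) = \<sigma>" by auto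
  then show ?case using exec_skip by simp
next
  case (Suc n)
  let ?\<sigma> = "\<sigma>(Suc n := act (1, Stay) (\<sigma> (Suc n)))"
  have "(\<lambda>j. if 0 < j \<and> j \<le> n then act (1, Stay) (?\<sigma> j) else ?\<sigma> j)
      = (\<lambda>j. if 0 < j \<and> j \<le> Suc n then act (1, Stay) (\<sigma> j) else \<sigma> j)"
    by (auto simp: fun_eq_iff le_Suc_eq)
  then show ?case unfolding marks.simps
    using exec_Seq_le[OF exec_Put[of "Suc n" 1 Stay \<sigma>] Suc.IH] by simp
qed

lemma marks_start_tapes:
  assumes "w > 0"
  shows "(\<lambda>j. if 0 < j \<and> j \<le> w - 1 then act (1, Stay) (start_tapes x j) else start_tapes x j)
    = cfg x w [] (\<lambda>_. 0)"
  using assms by (auto simp: start_tapes_def cfg_def marker_def string_cells_def fun_eq_iff)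

text \<open>Loops can only count down to zero while the output is written with ascending index, so
  two counters are kept: counter 2 holds the number of bits still to be written, counter 3 the
  current index, which is variable 0 of \<open>e\<close>. All other variables are mapped to counter
  1, which stays 0.\<close>

definition table_loop :: "nat \<Rightarrow> expr \<Rightarrow> com" where
  "table_loop w e = Until 2 1 (Seq (Move 2 MoveLeft)
     (Seq (compile (case_nat 3 (\<lambda>_. 1)) 4 e)
     (Seq (Branch 4 1 (Put w 1 MoveRight) (Put w 2 MoveRight))
     (Seq (Until 4 1 (Move 4 MoveLeft)) (Move 3 MoveRight)))))"

definition table_com :: "nat \<Rightarrow> expr \<Rightarrow> expr \<Rightarrow> com" where
  "table_com w l e = Seq (marks (w - 1)) (Seq (compile (\<lambda>_. 1) 2 l) (table_loop w e))"

lemma exec_table_loop: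
  fixes e :: expr and k m n :: nat
  defines "T \<equiv> poly (time_bound e + 2 * val_bound e + 9) m"
  assumes "length x \<le> m" "k + n \<le> m" "4 + temps e \<le> w"
  shows "exec (table_loop w e) (n * (T + 1) + 1) (cfg x w out ((\<lambda>_. 0)(2 := n, 3 := k)))
    (cfg x w (out @ map (\<lambda>i. eval x (case_nat i (\<lambda>_. 0)) e \<noteq> 0) [k..<k + n])
      ((\<lambda>_. 0)(3 := k + n)))"
  using assms(3)
proof (induction n arbitrary: k out)
  case 0
  have "(\<lambda>_ :: nat. 0 :: nat)(2 := 0, 3 := k) = (\<lambda>_. 0)(3 := k)" by auto
  then show ?case
    using exec_Until_done[of "cfg x w out ((\<lambda>_. 0)(3 := k))" 2 1] assms(4)
    unfolding table_loop_def by (subst (asm) scan_counter) (auto simp: fun_upd_def)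
next
  case (Suc n)
  let ?v = "eval x (case_nat k (\<lambda>_. 0)) e"
  let ?\<rho> = "(\<lambda>_. 0 :: nat)(2 := n, 3 := k)" and ?vm = "case_nat 3 (\<lambda>_. 1 :: nat)"
  have w: "6 \<le> w" using assms(4) temps_ge[of e] by simp
  have env: "?\<rho> \<circ> ?vm = case_nat k (\<lambda>_. 0)"
    by (auto simp: fun_eq_iff split: nat.split)
  have le: "case_nat k (\<lambda>_. 0) i \<le> m" for i
    using Suc.prems by (auto split: nat.split)
  have v: "?v \<le> poly (val_bound e) m"
    using assms(2) le by (rule eval_bound)
  have 1: "exec (Move 2 MoveLeft) 1 (cfg x w out ((\<lambda>_. 0)(2 := Suc n, 3 := k))) (cfg x w out ?\<rho>)"
    by (rule exec_cong[OF exec_dec]) (use w in auto)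
  have "exec (compile ?vm 4 e) (poly (time_bound e) m) (cfg x w out ?\<rho>)
      (cfg x w out (?\<rho>(4 := eval x (?\<rho> \<circ> ?vm) e)))"
  proof (rule exec_compile)
    show "?\<rho> (?vm i) \<le> m" for i using Suc.prems by (cases i) auto
  qed (use assms(2,4) in \<open>auto split: nat.split\<close>)
  then have 2: "exec (compile ?vm 4 e) (poly (time_bound e) m) (cfg x w out ?\<rho>) (cfg x w out (?\<rho>(4 := ?v)))"
    unfolding env .
  let ?out = "out @ [?v \<noteq> 0]"
  have 3: "exec (Branch 4 1 (Put w 1 MoveRight) (Put w 2 MoveRight)) 2
      (cfg x w out (?\<rho>(4 := ?v))) (cfg x w ?out (?\<rho>(4 := ?v)))"
  proof (rule exec_mono[OF exec_Branch])
    show "exec (if scan (cfg x w out (?\<rho>(4 := ?v)) 4) = 1 then Put w 1 MoveRight else Put w 2 MoveRight) 1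
        (cfg x w out (?\<rho>(4 := ?v))) (cfg x w ?out (?\<rho>(4 := ?v)))"
      using w exec_output[of w "?v \<noteq> 0" x out "?\<rho>(4 := ?v)"]
      by (subst scan_counter) (auto split: if_splits)
  qed simp
  have 4: "exec (Until 4 1 (Move 4 MoveLeft)) (2 * ?v + 1) (cfg x w ?out (?\<rho>(4 := ?v))) (cfg x w ?out ?\<rho>)"
  proof (rule exec_count[where S = "\<lambda>i. ?\<rho>(4 := i)" and B = 1])
    show "exec (Move 4 MoveLeft) 1 (cfg x w ?out (?\<rho>(4 := Suc i))) (cfg x w ?out (?\<rho>(4 := i)))" for i
      by (rule exec_cong[OF exec_dec]) (use w in auto)
  qed (use w in auto)
  have 5: "exec (Move 3 MoveRight) 1 (cfg x w ?out ?\<rho>) (cfg x w ?out ((\<lambda>_. 0)(2 := n, 3 := Suc k)))"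
    by (rule exec_cong[OF exec_inc]) (use w in auto)
  have body: "exec (Seq (Move 2 MoveLeft) (Seq (compile ?vm 4 e)
       (Seq (Branch 4 1 (Put w 1 MoveRight) (Put w 2 MoveRight))
       (Seq (Until 4 1 (Move 4 MoveLeft)) (Move 3 MoveRight))))) T
     (cfg x w out ((\<lambda>_. 0)(2 := Suc n, 3 := k))) (cfg x w ?out ((\<lambda>_. 0)(2 := n, 3 := Suc k)))"
    by (rule exec_Seq_le[OF 1 exec_Seq_le[OF 2 exec_Seq_le[OF 3 exec_Seq_le[OF 4 5 order.refl] order.refl] order.refl]])
       (use v in \<open>simp add: T_def\<close>)
  have "exec (table_loop w e) (T + (n * (T + 1) + 1) + 1) (cfg x w out ((\<lambda>_. 0)(2 := Suc n, 3 := k)))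
    (cfg x w (?out @ map (\<lambda>i. eval x (case_nat i (\<lambda>_. 0)) e \<noteq> 0) [Suc k..<Suc k + n])
      ((\<lambda>_. 0)(3 := Suc k + n)))"
    unfolding table_loop_def
    by (rule exec_Until_step[OF _ body Suc.IH[of "Suc k" ?out, unfolded table_loop_def]])
       (use w Suc.prems in \<open>subst scan_counter, auto\<close>)
  moreover have "map f [k..<k + Suc n] = f k # map f [Suc k..<Suc k + n]" for f :: "nat \<Rightarrow> bool"
    by (simp add: upt_conv_Cons del: upt_Suc)
  moreover have "T + (n * (T + 1) + 1) + 1 = Suc n * (T + 1) + 1" "Suc k + n = k + Suc n"
    by simp_all
  ultimately show ?case by (simp only: append.simps append_assoc)
qed

lemma wfc_incs: "t < w \<Longrightarrow> wfc w (incs t n)"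
  by (induction n) auto

lemma wfc_compile:
  assumes "t + temps e \<le> w" "\<And>i. vm i < t"
  shows "wfc w (compile vm t e)"
  using assms
proof (induction e arbitrary: vm t)
  case (Var i)
  have "vm i < t" using Var by blast
  then show ?case using Var.prems(1) by (simp add: drain_def drain2_def)
next
  case (Const c)
  then show ?case by (simp add: wfc_incs)
next
  case Len
  then show ?case by (simp add: rewind_def)
next
  case (Bit a)
  then show ?case using temps_ge[of a] by (simp add: drain2_def rewind_def)
next
  case (Sum a b)
  have "wfc w (compile (case_nat (t + 1) vm) (t + 2) b)"
  proof (rule Sum.IH)
    show "case_nat (t + 1) vm i < t + 2" for i
      using Sum.prems(2)[of "i - 1"] by (auto split: nat.split)
  qed (use Sum.prems(1) in auto)
  moreover have "wfc w (compile vm (t + 1) a)"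
    using Sum by (intro Sum.IH) (auto simp: less_Suc_eq)
  ultimately show ?case using Sum.prems(1) temps_ge[of b] by (auto simp: drain_def max_def split: if_splits)
next
  case (Add a b)
  have "wfc w (compile vm (t + 1) b)" "wfc w (compile vm t a)"
    using Add by (auto intro!: Add.IH simp: less_Suc_eq)
  then show ?case using Add.prems(1) temps_ge[of b] by (simp add: drain_def)
next
  case (Monus a b)
  have "wfc w (compile vm (t + 1) b)" "wfc w (compile vm t a)"
    using Monus by (auto intro!: Monus.IH simp: less_Suc_eq)
  then show ?case using Monus.prems(1) temps_ge[of b] by simp
qed

lemma wfc_marks: "n < w \<Longrightarrow> wfc w (marks n)"
  by (induction n) auto

theorem polytime_table:
  "polytime (\<lambda>x. map (\<lambda>k. eval x (case_nat k (\<lambda>_. 0)) e \<noteq> 0) [0..<eval x (\<lambda>_. 0) l])"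
proof -
  define w where "w = 4 + temps e + temps l"
  define T where "T = time_bound e + 2 * val_bound e + 10"
  define p where "p = [:2 * w + 3:] + time_bound l + val_bound l * pcompose T ([:0, 1:] + val_bound l)"
  have w: "4 + temps e \<le> w" "2 + temps l \<le> w" "6 \<le> w"
    using temps_ge[of e] by (simp_all add: w_def)
  show ?thesis
  proof (rule polytimeI[of w "table_com w l e" p])
    show "wfc (Suc w) (table_com w l e)"
      using w wfc_compile[of 2 l "Suc w" "\<lambda>_. 1"] wfc_compile[of 4 e "Suc w" "case_nat 3 (\<lambda>_. 1)"]
        wfc_marks[of "w - 1" "Suc w"]
      by (auto simp: table_com_def table_loop_def split: nat.splits)
  next
    fix x
    let ?n = "length x" and ?l = "eval x (\<lambda>_. 0) l"
    let ?m = "?n + poly (val_bound l) ?n"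
    have l: "?l \<le> poly (val_bound l) ?n" by (rule eval_bound) auto
    have 1: "exec (marks (w - 1)) (2 * w) (start_tapes x) (cfg x w [] (\<lambda>_. 0))"
      using exec_mono[OF exec_marks[of "w - 1" "start_tapes x"]] marks_start_tapes[of w x] w by simp
    have "exec (compile (\<lambda>_. 1) 2 l) (poly (time_bound l) ?n) (cfg x w [] (\<lambda>_. 0))
      (cfg x w [] ((\<lambda>_. 0)(2 := eval x ((\<lambda>_. 0) \<circ> (\<lambda>_. 1 :: nat)) l)))"
      by (rule exec_compile) (use w in auto)
    moreover have "(\<lambda>_ :: nat. 0 :: nat)(2 := ?l) = (\<lambda>_. 0)(2 := ?l, 3 := 0)" by auto
    ultimately have 2: "exec (compile (\<lambda>_. 1) 2 l) (poly (time_bound l) ?n) (cfg x w [] (\<lambda>_. 0))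
      (cfg x w [] ((\<lambda>_. 0)(2 := ?l, 3 := 0)))"
      by (simp add: o_def)
    let ?out = "map (\<lambda>i. eval x (case_nat i (\<lambda>_. 0)) e \<noteq> 0) [0..<?l]"
    have 3: "exec (table_loop w e) (?l * poly T ?m + 1) (cfg x w [] ((\<lambda>_. 0)(2 := ?l, 3 := 0)))
        (cfg x w ?out ((\<lambda>_. 0)(3 := ?l)))"
      using exec_table_loop[of x ?m 0 ?l e w "[]"] w l by (simp add: T_def ac_simps)
    have "?l * poly T ?m \<le> poly (val_bound l) ?n * poly T ?m"
      using l by (rule mult_right_mono) simp
    then have "exec (table_com w l e) (poly p ?n) (start_tapes x) (cfg x w ?out ((\<lambda>_. 0)(3 := ?l)))"
      unfolding table_com_def
      by (intro exec_Seq_le[OF 1 exec_Seq_le[OF 2 3 order.refl]]) (simp add: p_def poly_pcompose)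
    moreover have "snd (cfg x w ?out ((\<lambda>_. 0)(3 := ?l)) w) = string_cells ?out"
      using w by (simp add: cfg_def)
    ultimately show "\<exists>\<sigma>. exec (table_com w l e) (poly p ?n) (start_tapes x) \<sigma> \<and> snd (\<sigma> w) = string_cells ?out"
      by blast
  qed
qed


section \<open>Definable functions are computable in polynomial time\<close>

fun rename :: "(nat \<Rightarrow> nat) \<Rightarrow> expr \<Rightarrow> expr" where
  "rename f (Var i) = Var (f i)"
| "rename f (Const c) = Const c"
| "rename f Len = Len"
| "rename f (Add a b) = Add (rename f a) (rename f b)"
| "rename f (Monus a b) = Monus (rename f a) (rename f b)"
| "rename f (Bit a) = Bit (rename f a)"
| "rename f (Sum a b) = Sum (rename f a) (rename (case_nat 0 (\<lambda>k. Suc (f k))) b)"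

lemma eval_rename: "eval x \<rho> (rename f e) = eval x (\<lambda>i. \<rho> (f i)) e"
proof (induction e arbitrary: \<rho> f)
  case (Sum a b)
  have "(\<lambda>j. case_nat i \<rho> (case_nat 0 (\<lambda>k. Suc (f k)) j)) = case_nat i (\<lambda>j. \<rho> (f j))" for i
    by (auto simp: fun_eq_iff split: nat.split)
  then show ?case by (simp add: Sum)
qed auto

fun subst :: "(nat \<Rightarrow> expr) \<Rightarrow> expr \<Rightarrow> expr" where
  "subst s (Var i) = s i"
| "subst s (Const c) = Const c"
| "subst s Len = Len"
| "subst s (Add a b) = Add (subst s a) (subst s b)"
| "subst s (Monus a b) = Monus (subst s a) (subst s b)"
| "subst s (Bit a) = Bit (subst s a)"
| "subst s (Sum a b) = Sum (subst s a) (subst (case_nat (Var 0) (\<lambda>k. rename Suc (s k))) b)"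

lemma eval_subst: "eval x \<rho> (subst s e) = eval x (\<lambda>i. eval x \<rho> (s i)) e"
proof (induction e arbitrary: \<rho> s)
  case (Sum a b)
  have "(\<lambda>j. eval x (case_nat i \<rho>) (case_nat (Var 0) (\<lambda>k. rename Suc (s k)) j))
      = case_nat i (\<lambda>j. eval x \<rho> (s j))" for i
    by (auto simp: fun_eq_iff eval_rename split: nat.split)
  then show ?case by (simp add: Sum)
qed auto

text \<open>In \<open>\<rho>\<close> the variables are numbered from the innermost bound one, as in de Bruijn notation.\<close>

definition definable :: "(bool list \<Rightarrow> (nat \<Rightarrow> nat) \<Rightarrow> nat) \<Rightarrow> bool" where
  "definable f \<longleftrightarrow> (\<exists>e. \<forall>x \<rho>. f x \<rho> = eval x \<rho> e)"

definition decidable :: "(bool list \<Rightarrow> (nat \<Rightarrow> nat) \<Rightarrow> bool) \<Rightarrow> bool" where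
  "decidable P \<longleftrightarrow> definable (\<lambda>x \<rho>. of_bool (P x \<rho>))"

lemma definableI: "(\<And>x \<rho>. f x \<rho> = eval x \<rho> e) \<Longrightarrow> definable f"
  unfolding definable_def by blast

lemma definableE:
  assumes "definable f"
  obtains e where "\<And>x \<rho>. f x \<rho> = eval x \<rho> e"
  using assms unfolding definable_def by blast

lemma definable_cong: "definable f \<Longrightarrow> (\<And>x \<rho>. g x \<rho> = f x \<rho>) \<Longrightarrow> definable g"
  unfolding definable_def by simp

lemma decidableI: "definable f \<Longrightarrow> (\<And>x \<rho>. of_bool (P x \<rho>) = f x \<rho>) \<Longrightarrow> decidable P"
  unfolding decidable_def definable_def by simp

lemma definable_var: "definable (\<lambda>x \<rho>. \<rho> k)"
  by (rule definableI[of _ "Var k"]) simp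

lemma definable_const: "definable (\<lambda>x \<rho>. c)"
  by (rule definableI[of _ "Const c"]) simp

lemma definable_length: "definable (\<lambda>x \<rho>. length x)"
  by (rule definableI[of _ Len]) simp

lemma definable_add: "definable f \<Longrightarrow> definable g \<Longrightarrow> definable (\<lambda>x \<rho>. f x \<rho> + g x \<rho>)"
  by (elim definableE, rule definableI[of _ "Add _ _"]) auto

lemma definable_monus: "definable f \<Longrightarrow> definable g \<Longrightarrow> definable (\<lambda>x \<rho>. f x \<rho> - g x \<rho>)"
  by (elim definableE, rule definableI[of _ "Monus _ _"]) auto

lemma definable_Suc: "definable f \<Longrightarrow> definable (\<lambda>x \<rho>. Suc (f x \<rho>))"
  using definable_add[OF _ definable_const[of 1]] by simp

text \<open>The summand is given with its outer variables and its bound variable separated. Under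
  the binder these are \<open>\<rho>\<close> shifted by one and \<open>\<rho> 0\<close>; this form
  lets the rule be applied backwards by unification.\<close>

lemma definable_sum:
  assumes "definable f" "definable (\<lambda>x \<rho>. g x (\<lambda>k. \<rho> (Suc k)) (\<rho> 0))"
  shows "definable (\<lambda>x \<rho>. \<Sum>i < f x \<rho>. g x \<rho> i)"
proof -
  obtain a where a: "\<And>x \<rho>. f x \<rho> = eval x \<rho> a" using assms(1) definableE by blast
  obtain b where b: "\<And>x \<rho>. g x (\<lambda>k. \<rho> (Suc k)) (\<rho> 0) = eval x \<rho> b"
    using definableE[OF assms(2)] by blast
  have "g x \<rho> i = eval x (case_nat i \<rho>) b" for x \<rho> i
    using b[of x "case_nat i \<rho>"] by simp
  then show ?thesis by (intro definableI[of _ "Sum a b"]) (simp add: a)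
qed

text \<open>Definability shown once for arguments in fixed variables can thereby be reused for
  arbitrary definable arguments, also under binders, where variable numbers have shifted.\<close>

lemma definable_subst:
  assumes "definable f" "\<And>i. definable (\<lambda>x \<rho>. \<theta> x \<rho> i)"
  shows "definable (\<lambda>x \<rho>. f x (\<theta> x \<rho>))"
proof -
  obtain a where a: "\<And>x \<rho>. f x \<rho> = eval x \<rho> a" using assms(1) definableE by blast
  obtain s where s: "\<And>i x \<rho>. \<theta> x \<rho> i = eval x \<rho> (s i)"
    using assms(2) unfolding definable_def by metis
  have "f x (\<theta> x \<rho>) = eval x \<rho> (subst s a)" for x \<rho>
    unfolding a eval_subst s[symmetric] ..
  then show ?thesis by (rule definableI)
qed

lemma definable_shift: "definable f \<Longrightarrow> definable (\<lambda>x \<rho>. f x (\<lambda>k. \<rho> (Suc k)))"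
  by (rule definable_subst[where \<theta> = "\<lambda>x \<rho> k. \<rho> (Suc k)"]) (auto intro: definable_var)

lemma definable_mult:
  assumes "definable f" "definable g"
  shows "definable (\<lambda>x \<rho>. f x \<rho> * g x \<rho>)"
  using definable_sum[OF assms(1), of "\<lambda>x \<rho> i. g x \<rho>"] definable_shift[OF assms(2)] by simp

lemma definable_of_bool: "decidable P \<Longrightarrow> definable (\<lambda>x \<rho>. of_bool (P x \<rho>))"
  unfolding decidable_def .

lemma decidable_const: "decidable (\<lambda>x \<rho>. c)"
  unfolding decidable_def by (rule definable_const)

lemma decidable_not: "decidable P \<Longrightarrow> decidable (\<lambda>x \<rho>. \<not> P x \<rho>)"
  unfolding decidable_def
  by (rule definable_cong[OF definable_monus[OF definable_const[of 1]]]) auto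

lemma decidable_conj: "decidable P \<Longrightarrow> decidable Q \<Longrightarrow> decidable (\<lambda>x \<rho>. P x \<rho> \<and> Q x \<rho>)"
  by (rule decidableI[OF definable_mult[of "\<lambda>x \<rho>. of_bool (P x \<rho>)" "\<lambda>x \<rho>. of_bool (Q x \<rho>)"]])
     (auto simp: decidable_def)

lemma decidable_disj: "decidable P \<Longrightarrow> decidable Q \<Longrightarrow> decidable (\<lambda>x \<rho>. P x \<rho> \<or> Q x \<rho>)"
  using decidable_not[OF decidable_conj[OF decidable_not[of P] decidable_not[of Q]]] by simp

lemma decidable_imp: "decidable P \<Longrightarrow> decidable Q \<Longrightarrow> decidable (\<lambda>x \<rho>. P x \<rho> \<longrightarrow> Q x \<rho>)"
  using decidable_disj[OF decidable_not[of P], of Q] by simp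

lemma decidable_le: "definable f \<Longrightarrow> definable g \<Longrightarrow> decidable (\<lambda>x \<rho>. f x \<rho> \<le> g x \<rho>)"
  by (rule decidableI[of "\<lambda>x \<rho>. 1 - (f x \<rho> - g x \<rho>)"]) (simp_all add: definable_monus definable_const)

lemma decidable_less: "definable f \<Longrightarrow> definable g \<Longrightarrow> decidable (\<lambda>x \<rho>. f x \<rho> < g x \<rho>)"
  using decidable_not[OF decidable_le[of g f]] by (simp add: not_le)

lemma decidable_eq: "definable f \<Longrightarrow> definable g \<Longrightarrow> decidable (\<lambda>x \<rho>. f x \<rho> = g x \<rho>)"
  using decidable_conj[OF decidable_le[of f g] decidable_le[of g f]] by (simp add: order_eq_iff)

lemma sum_of_bool_pos: "0 < (\<Sum>i<n. of_bool (P i) :: nat) \<longleftrightarrow> (\<exists>i<n. P i)" for n :: nat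
  by (induction n) (auto simp: less_Suc_eq)

lemma decidable_ex:
  assumes "definable f" "decidable (\<lambda>x \<rho>. P x (\<lambda>k. \<rho> (Suc k)) (\<rho> 0))"
  shows "decidable (\<lambda>x \<rho>. \<exists>i < f x \<rho>. P x \<rho> i)"
proof -
  have "definable (\<lambda>x \<rho>. \<Sum>i < f x \<rho>. of_bool (P x \<rho> i))"
    using assms unfolding decidable_def by (rule definable_sum)
  then have "decidable (\<lambda>x \<rho>. 0 < (\<Sum>i < f x \<rho>. of_bool (P x \<rho> i) :: nat))"
    by (intro decidable_less definable_const)
  then show ?thesis by (simp only: sum_of_bool_pos)
qed

lemma decidable_all:
  assumes "definable f" "decidable (\<lambda>x \<rho>. P x (\<lambda>k. \<rho> (Suc k)) (\<rho> 0))"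
  shows "decidable (\<lambda>x \<rho>. \<forall>i < f x \<rho>. P x \<rho> i)"
  using decidable_not[OF decidable_ex[OF assms(1) decidable_not[OF assms(2)]]] by simp

lemma sum_of_bool_card: "(\<Sum>i<n. of_bool (P i) :: nat) = card {i. i < n \<and> P i}" for n :: nat
proof -
  have "{..<n} \<inter> {i. P i} = {i. i < n \<and> P i}" by auto
  then show ?thesis by (simp add: sum_of_bool_eq)
qed

lemma definable_card:
  assumes "definable f" "decidable (\<lambda>x \<rho>. P x (\<lambda>k. \<rho> (Suc k)) (\<rho> 0))"
  shows "definable (\<lambda>x \<rho>. card {i. i < f x \<rho> \<and> P x \<rho> i})"
proof (rule definable_cong)
  show "definable (\<lambda>x \<rho>. \<Sum>i < f x \<rho>. of_bool (P x \<rho> i))"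
    using assms unfolding decidable_def by (rule definable_sum)
  show "card {i. i < f x \<rho> \<and> P x \<rho> i} = (\<Sum>i < f x \<rho>. of_bool (P x \<rho> i))" for x \<rho>
    by (simp add: sum_of_bool_card)
qed

lemma definable_if:
  assumes "decidable P" "definable f" "definable g"
  shows "definable (\<lambda>x \<rho>. if P x \<rho> then f x \<rho> else g x \<rho>)"
proof (rule definable_cong)
  show "definable (\<lambda>x \<rho>. of_bool (P x \<rho>) * f x \<rho> + (1 - of_bool (P x \<rho>)) * g x \<rho>)"
    using assms unfolding decidable_def
    by (intro definable_add definable_mult definable_monus definable_const)
qed auto

lemma decidable_if:
  assumes "decidable P" "decidable Q" "decidable R"
  shows "decidable (\<lambda>x \<rho>. if P x \<rho> then Q x \<rho> else R x \<rho>)"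
  using assms decidable_conj[OF decidable_imp[of P Q] decidable_imp[OF decidable_not[of P], of R]]
  by (simp add: if_bool_eq_conj)

text \<open>The quotient is the number of positive multiples of \<open>b\<close> up to
  \<open>a\<close>, and it never exceeds \<open>a\<close>; so a sum with \<open>a\<close> terms
  suffices to count them.\<close>

lemma div_eq_sum: "(a :: nat) div b = (if b = 0 then 0 else \<Sum>i<a. of_bool (Suc i * b \<le> a))"
proof (cases "b = 0")
  case False
  have "Suc i * b \<le> a \<longleftrightarrow> i < a div b" for i
    using False less_eq_div_iff_mult_less_eq[of b "Suc i" a] by (simp add: Suc_le_eq)
  then have "(\<Sum>i<a. of_bool (Suc i * b \<le> a)) = card {i. i < a \<and> i < a div b}"
    by (simp only: sum_of_bool_card)
  also have "{i. i < a \<and> i < a div b} = {..<a div b}"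
    by (auto intro: less_le_trans[OF _ div_le_dividend])
  finally show ?thesis using False by simp
qed simp

lemma definable_div:
  assumes "definable f" "definable g"
  shows "definable (\<lambda>x \<rho>. f x \<rho> div g x \<rho>)"
proof (rule definable_cong[OF _ div_eq_sum])
  show "definable (\<lambda>x \<rho>. if g x \<rho> = 0 then 0 else \<Sum>i < f x \<rho>. of_bool (Suc i * g x \<rho> \<le> f x \<rho>))"
    by (intro definable_if decidable_eq definable_sum definable_of_bool decidable_le definable_mult
        definable_Suc definable_const assms definable_var definable_shift[OF assms(1)] definable_shift[OF assms(2)])
qed

lemma definable_mod:
  assumes "definable f" "definable g"
  shows "definable (\<lambda>x \<rho>. f x \<rho> mod g x \<rho>)"
  by (rule definable_cong[OF definable_monus[OF assms(1) definable_mult[OF assms(2) definable_div[OF assms]]]])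
     (simp add: minus_mult_div_eq_mod)

lemma definable_poly: "definable f \<Longrightarrow> definable (\<lambda>x \<rho>. poly p (f x \<rho>))"
  by (induction p) (auto intro!: definable_const definable_add definable_mult)

lemma decidable_bit:
  assumes "definable f"
  shows "decidable (\<lambda>x \<rho>. f x \<rho> < length x \<and> x ! f x \<rho>)"
proof -
  obtain a where a: "\<And>x \<rho>. f x \<rho> = eval x \<rho> a" using assms definableE by blast
  show ?thesis unfolding decidable_def by (rule definableI[of _ "Bit a"]) (simp add: a)
qed

text \<open>A fixed finite table becomes a disjunction of equations. In this way arbitrary relations
  on tiles, for which no algorithm is given, may occur in formulas.\<close>

lemma decidable_finite:
  assumes "finite S" "definable f"
  shows "decidable (\<lambda>x \<rho>. f x \<rho> \<in> S)"
  using assms(1)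
proof (induction S)
  case (insert a S)
  then show ?case using assms(2)
    by (auto intro!: decidable_disj decidable_eq definable_const)
qed (simp add: decidable_const)

lemma decidable_finite2:
  assumes "finite S" "definable f" "definable g"
  shows "decidable (\<lambda>x \<rho>. (f x \<rho>, g x \<rho>) \<in> S)"
  using assms(1)
proof (induction S)
  case (insert a S)
  then show ?case using assms(2,3)
    by (cases a) (auto intro!: decidable_disj decidable_conj decidable_eq definable_const)
qed (simp add: decidable_const)

lemmas definability = definable_const decidable_const definable_var definable_length definable_add
  definable_monus definable_Suc definable_mult definable_sum definable_of_bool definable_card
  definable_if definable_div definable_mod definable_poly
  decidable_not decidable_conj decidable_disj decidable_imp decidable_le decidable_less
  decidable_eq decidable_ex decidable_all decidable_if

lemma definable_comp1:
  assumes "definable (\<lambda>x \<rho>. F x (\<rho> 0))" "definable a"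
  shows "definable (\<lambda>x \<rho>. F x (a x \<rho>))"
  using definable_subst[OF assms(1), of "\<lambda>x \<rho> i. a x \<rho>"] assms(2) by simp

lemma definable_comp3:
  assumes "definable (\<lambda>x \<rho>. F x (\<rho> 0) (\<rho> 1) (\<rho> 2))" "definable a" "definable b" "definable c"
  shows "definable (\<lambda>x \<rho>. F x (a x \<rho>) (b x \<rho>) (c x \<rho>))"
proof -
  have "definable (\<lambda>x \<rho>. if i = 0 then a x \<rho> else if i = 1 then b x \<rho> else c x \<rho>)" for i :: nat
    using assms(2-) by (cases "i = 0"; cases "i = 1") simp_all
  from definable_subst[where \<theta> = "\<lambda>x \<rho> i. if i = 0 then a x \<rho> else if i = 1 then b x \<rho> else c x \<rho>", OF assms(1) this] show ?thesis by simp
qed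

lemma definable_comp4:
  assumes "definable (\<lambda>x \<rho>. F x (\<rho> 0) (\<rho> 1) (\<rho> 2) (\<rho> 3))"
    "definable a" "definable b" "definable c" "definable d"
  shows "definable (\<lambda>x \<rho>. F x (a x \<rho>) (b x \<rho>) (c x \<rho>) (d x \<rho>))"
proof -
  have "definable (\<lambda>x \<rho>. if i = 0 then a x \<rho> else if i = 1 then b x \<rho> else if i = 2 then c x \<rho> else d x \<rho>)"
    for i :: nat
    using assms(2-) by (cases "i = 0"; cases "i = 1"; cases "i = 2") simp_all
  from definable_subst[where \<theta> = "\<lambda>x \<rho> i. if i = 0 then a x \<rho> else if i = 1 then b x \<rho> else if i = 2 then c x \<rho> else d x \<rho>", OF assms(1) this] show ?thesis by simp
qed

lemma decidable_comp3:
  assumes "decidable (\<lambda>x \<rho>. F x (\<rho> 0) (\<rho> 1) (\<rho> 2))" "definable a" "definable b" "definable c"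
  shows "decidable (\<lambda>x \<rho>. F x (a x \<rho>) (b x \<rho>) (c x \<rho>))"
  using assms unfolding decidable_def by (rule definable_comp3)

lemma decidable_comp4:
  assumes "decidable (\<lambda>x \<rho>. F x (\<rho> 0) (\<rho> 1) (\<rho> 2) (\<rho> 3))"
    "definable a" "definable b" "definable c" "definable d"
  shows "decidable (\<lambda>x \<rho>. F x (a x \<rho>) (b x \<rho>) (c x \<rho>) (d x \<rho>))"
  using assms unfolding decidable_def by (rule definable_comp4)

text \<open>Both the verifier for membership in NP and the reduction for hardness obtain their
  running time from here: it is enough to define the output length and to decide each output
  bit.\<close>

theorem polytime_definable:
  assumes "definable (\<lambda>x \<rho>. l x)" "decidable (\<lambda>x \<rho>. P x (\<rho> 0))"
  shows "polytime (\<lambda>x. map (P x) [0..<l x])"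
proof -
  obtain a where a: "\<And>x \<rho>. l x = eval x \<rho> a"
    using assms(1) unfolding definable_def by blast
  obtain b where b: "\<And>x \<rho>. of_bool (P x (\<rho> 0)) = eval x \<rho> b"
    using assms(2) unfolding decidable_def definable_def by blast
  have "P x = (\<lambda>k. eval x (case_nat k (\<lambda>_. 0)) b \<noteq> 0)" for x
    by (simp add: fun_eq_iff b[symmetric])
  then show ?thesis using polytime_table[of b a] a[of _ "\<lambda>_. 0"] by simp
qed


section \<open>The problem belongs to NP\<close>

definition graph_on :: "nat \<Rightarrow> (nat \<Rightarrow> nat \<Rightarrow> bool) \<Rightarrow> nat pair_pre_digraph" where
  "graph_on n adj = \<lparr>pverts = {..<n}, parcs = {(i, j). i < n \<and> j < n \<and> adj i j}\<rparr>"

lemma graph_on_simps [simp]: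
  "pverts (graph_on n adj) = {..<n}"
  "parcs (graph_on n adj) = {(i, j). i < n \<and> j < n \<and> adj i j}"
  by (simp_all add: graph_on_def)

lemma neighbors_graph_on: "i < n \<Longrightarrow> neighbors (graph_on n adj) i = {j. j < n \<and> adj i j}"
  by (auto simp: neighbors_def)

lemma pair_graph_graph_on:
  assumes "\<And>i j. i < n \<Longrightarrow> j < n \<Longrightarrow> adj i j \<Longrightarrow> adj j i \<and> i \<noteq> j"
  shows "pair_graph (graph_on n adj)"
proof -
  have "finite (parcs (graph_on n adj))"
    by (rule finite_subset[of _ "{..<n} \<times> {..<n}"]) auto
  moreover have "symmetric (with_proj (graph_on n adj))"
    using assms by (auto simp: symmetric_def arcs_ends_def arc_to_ends_def with_proj_def intro!: symI)
  ultimately show ?thesis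
    using assms by unfold_locales auto
qed

lemma pair_graph_eq_graph_on:
  assumes "pair_graph G" "pverts G = {..<n}"
  shows "G = graph_on n (\<lambda>i j. (i, j) \<in> parcs G)"
    and "\<And>i j. (i, j) \<in> parcs G \<Longrightarrow> i < n \<and> j < n \<and> (j, i) \<in> parcs G"
proof -
  interpret pair_graph G by fact
  show *: "i < n \<and> j < n \<and> (j, i) \<in> parcs G" if "(i, j) \<in> parcs G" for i j
    using that in_arcsD1 in_arcsD2 assms(2) arcs_symmetric by auto
  show "G = graph_on n (\<lambda>i j. (i, j) \<in> parcs G)"
    using assms(2) * by (intro pair_pre_digraph.equality) auto
qed

lemma concat_map_upt:
  "concat (map (\<lambda>i. map (f i) [0..<n]) [0..<m]) = map (\<lambda>k. f (k div n) (k mod n)) [0..<m * n]"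
proof (induction m)
  case (Suc m)
  have "map (\<lambda>k. f (k div n) (k mod n)) [m * n..<m * n + n] = map (f m) [0..<n]"
    by (rule nth_equalityI) auto
  moreover have "[0..<Suc m * n] = [0..<m * n] @ [m * n..<m * n + n]"
    using upt_add_eq_append[of 0 "m * n" n] by (simp add: add.commute)
  ultimately show ?case using Suc by simp
qed simp

lemma graph_code_graph_on:
  "graph_code (graph_on n adj) = map (\<lambda>k. adj (k div n) (k mod n)) [0..<n * n]"
proof -
  have "graph_code (graph_on n adj) =
      concat (map (\<lambda>i. map (\<lambda>j. i < n \<and> j < n \<and> adj i j) [0..<n]) [0..<n])"
    by (simp add: graph_code_def)
  also have "\<dots> = map (\<lambda>k. adj (k div n) (k mod n)) [0..<n * n]"
    unfolding concat_map_upt by (cases "n = 0") (auto simp: less_mult_imp_div_less)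
  finally show ?thesis .
qed

lemma pair_code_simps:
  "pair_code [] u = False # u"
  "pair_code (b # x) u = True # b # pair_code x u"
  by (simp_all add: pair_code_def)

lemma length_pair_code: "length (pair_code x u) = 2 * length x + 1 + length u"
  by (induction x) (auto simp: pair_code_simps)

lemma nth_pair_code_marker: "i < length x \<Longrightarrow> pair_code x u ! (2 * i)"
proof (induction x arbitrary: i)
  case (Cons b x)
  then show ?case by (cases i) (auto simp: pair_code_simps)
qed simp

lemma nth_pair_code_left: "i < length x \<Longrightarrow> pair_code x u ! Suc (2 * i) = x ! i"
proof (induction x arbitrary: i)
  case (Cons b x)
  then show ?case by (cases i) (auto simp: pair_code_simps)
qed simp

lemma nth_pair_code_end: "\<not> pair_code x u ! (2 * length x)"
  by (induction x) (auto simp: pair_code_simps)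

lemma nth_pair_code_right: "pair_code x u ! Suc (2 * length x + i) = u ! i"
  by (induction x) (auto simp: pair_code_simps)

section \<open>Decoding a graph and a colouring from a pair of strings\<close>

definition bit_at :: "bool list \<Rightarrow> nat \<Rightarrow> bool" where
  "bit_at y k \<longleftrightarrow> k < length y \<and> y ! k"

text \<open>Markers occupy the even positions, so the first component ends at the first even
  position that does not carry True.\<close>

definition fst_length :: "bool list \<Rightarrow> nat" where
  "fst_length y = card {i. i < length y \<and> (\<forall>j < Suc i. bit_at y (2 * j))}"

text \<open>The integer square root of \<open>fst_length y\<close>, obtained as the number of
  positive integers whose square does not exceed it.\<close>

definition side :: "bool list \<Rightarrow> nat" where
  "side y = card {i. i < fst_length y \<and> Suc i * Suc i \<le> fst_length y}"

definition adj_at :: "bool list \<Rightarrow> nat \<Rightarrow> nat \<Rightarrow> bool" where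
  "adj_at y i j \<longleftrightarrow> bit_at y (Suc (2 * (i * side y + j)))"

definition colour_at :: "bool list \<Rightarrow> nat \<Rightarrow> bool" where
  "colour_at y i \<longleftrightarrow> bit_at y (Suc (2 * fst_length y + i))"

definition degree_at :: "bool list \<Rightarrow> nat \<Rightarrow> nat" where
  "degree_at y i = card {j. j < side y \<and> adj_at y i j}"

definition zeros_at :: "bool list \<Rightarrow> nat \<Rightarrow> nat" where
  "zeros_at y i = card {j. j < side y \<and> adj_at y i j \<and> \<not> colour_at y j}"

definition ones_at :: "bool list \<Rightarrow> nat \<Rightarrow> nat" where
  "ones_at y i = card {j. j < side y \<and> adj_at y i j \<and> colour_at y j}"

text \<open>The two sides of the graph are not guessed but recognised by the degrees 3 and
  \<open>d\<close>. For \<open>d \<noteq> 3\<close> these classes are disjoint, and an edge between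
  different degrees cannot be a loop. The first condition says that the string has the length of an
  adjacency matrix.\<close>

definition verified :: "nat \<Rightarrow> bool list \<Rightarrow> bool" where
  "verified d y \<longleftrightarrow> fst_length y = side y * side y \<and>
     (\<forall>i < side y. (degree_at y i = 3 \<or> degree_at y i = d) \<and>
        (\<forall>j < side y. adj_at y i j \<longrightarrow> adj_at y j i \<and>
           (degree_at y i = 3 \<and> degree_at y j = d \<or> degree_at y i = d \<and> degree_at y j = 3)) \<and>
        zeros_at y i \<le> ones_at y i + 1 \<and> ones_at y i \<le> zeros_at y i + 1)"

lemma decidable_bit_at: "definable f \<Longrightarrow> decidable (\<lambda>x \<rho>. bit_at x (f x \<rho>))"
  unfolding bit_at_def by (rule decidable_bit)

lemma definable_fst_length: "definable (\<lambda>x \<rho>. fst_length x)"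
  unfolding fst_length_def by (intro definability decidable_bit_at)

lemma definable_side: "definable (\<lambda>x \<rho>. side x)"
  unfolding side_def by (intro definability definable_fst_length)

lemma decidable_adj_at: "definable f \<Longrightarrow> definable g \<Longrightarrow> decidable (\<lambda>x \<rho>. adj_at x (f x \<rho>) (g x \<rho>))"
  unfolding adj_at_def by (intro definability definable_side decidable_bit_at)

lemma decidable_colour_at: "definable f \<Longrightarrow> decidable (\<lambda>x \<rho>. colour_at x (f x \<rho>))"
  unfolding colour_at_def by (intro definability definable_fst_length decidable_bit_at)

lemma definable_degree_at: "definable f \<Longrightarrow> definable (\<lambda>x \<rho>. degree_at x (f x \<rho>))"
  by (rule definable_comp1)
    (unfold degree_at_def, intro definability definable_side decidable_adj_at)

lemma definable_zeros_at: "definable f \<Longrightarrow> definable (\<lambda>x \<rho>. zeros_at x (f x \<rho>))"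
  by (rule definable_comp1)
    (unfold zeros_at_def, intro definability definable_side decidable_adj_at decidable_colour_at)

lemma definable_ones_at: "definable f \<Longrightarrow> definable (\<lambda>x \<rho>. ones_at x (f x \<rho>))"
  by (rule definable_comp1)
    (unfold ones_at_def, intro definability definable_side decidable_adj_at decidable_colour_at)

lemma decidable_verified: "decidable (\<lambda>x \<rho>. verified d x)"
  unfolding verified_def
  by (intro definability definable_fst_length definable_side decidable_adj_at definable_degree_at
      definable_zeros_at definable_ones_at)

lemma polytime_verified: "polytime (\<lambda>y. [verified d y])"
proof -
  have "polytime (\<lambda>y. map (\<lambda>_. verified d y) [0..<1])"
    by (rule polytime_definable[of "\<lambda>_. 1"]) (intro definability decidable_verified)+
  then show ?thesis by simp
qed

lemma bit_at_pair_code: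
  "i < length x \<Longrightarrow> bit_at (pair_code x u) (2 * i)"
  "\<not> bit_at (pair_code x u) (2 * length x)"
  "i < length x \<Longrightarrow> bit_at (pair_code x u) (Suc (2 * i)) \<longleftrightarrow> x ! i"
  "bit_at (pair_code x u) (Suc (2 * length x + i)) \<longleftrightarrow> i < length u \<and> u ! i"
  by (auto simp: bit_at_def length_pair_code nth_pair_code_marker nth_pair_code_left
      nth_pair_code_end nth_pair_code_right)

lemma fst_length_pair_code: "fst_length (pair_code x u) = length x"
proof -
  have "{i. i < length (pair_code x u) \<and> (\<forall>j < Suc i. bit_at (pair_code x u) (2 * j))} = {..<length x}"
  proof (intro set_eqI iffI)
    fix i assume "i \<in> {i. i < length (pair_code x u) \<and> (\<forall>j < Suc i. bit_at (pair_code x u) (2 * j))}"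
    then show "i \<in> {..<length x}"
      using bit_at_pair_code(2)[of x u] by (auto simp: less_Suc_eq_le intro: ccontr)
  qed (auto simp: length_pair_code bit_at_pair_code)
  then show ?thesis by (simp add: fst_length_def)
qed

lemma side_pair_code:
  assumes "length x = n * n"
  shows "side (pair_code x u) = n"
proof -
  have "Suc i * Suc i \<le> n * n \<longleftrightarrow> Suc i \<le> n" for i
    by (simp only: power2_nat_le_eq_le flip: power2_eq_square)
  moreover have "i < n * n" if "i < n" for i
    using that le_square[of n] by (rule less_le_trans)
  ultimately have "{i. i < n * n \<and> Suc i * Suc i \<le> n * n} = {..<n}"
    unfolding Suc_le_eq by blast
  then show ?thesis by (simp add: side_def fst_length_pair_code assms)
qed

lemma balanced_iff: "\<bar>int a - int b\<bar> \<le> 1 \<longleftrightarrow> a \<le> b + 1 \<and> b \<le> a + 1"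
  by linarith

lemma verified_graph_code:
  assumes "pair_graph G" "pverts G = {..<n}" "biregular_bipartite 3 d G"
    and "locally_balanced_open G f" "two_partition G f"
  shows "verified d (pair_code (graph_code G) (map (\<lambda>i. f i = 1) [0..<n]))"
proof -
  define adj where "adj i j \<longleftrightarrow> (i, j) \<in> parcs G" for i j
  let ?x = "graph_code G" and ?u = "map (\<lambda>i. f i = 1) [0..<n]"
  let ?y = "pair_code ?x ?u"
  have G: "G = graph_on n adj"
    using pair_graph_eq_graph_on(1)[OF assms(1,2)] by (simp add: adj_def[abs_def])
  have sym: "adj i j \<Longrightarrow> adj j i" for i j
    using pair_graph_eq_graph_on(2)[OF assms(1,2)] by (simp add: adj_def)
  have x: "?x = map (\<lambda>k. adj (k div n) (k mod n)) [0..<n * n]"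
    by (subst G) (rule graph_code_graph_on)
  have side: "side ?y = n" by (rule side_pair_code) (simp add: x)
  have adj: "adj_at ?y i j \<longleftrightarrow> adj i j" if "i < n" "j < n" for i j
  proof -
    have "i * n + j < Suc i * n" using that by simp
    also have "\<dots> \<le> n * n" using that by (intro mult_right_mono) auto
    finally have "i * n + j < n * n" .
    then show ?thesis
      unfolding adj_at_def side using that by (subst bit_at_pair_code) (simp_all add: x)
  qed
  have nb: "{j. j < n \<and> adj_at ?y i j \<and> P j} = {j \<in> neighbors G i. P j}" if "i < n" for i P
    using that adj by (subst G) (auto simp: neighbors_graph_on)
  have deg: "degree_at ?y i = card (neighbors G i)" if "i < n" for i
    unfolding degree_at_def side using nb[OF that, of "\<lambda>_. True"] by simp
  have colour: "colour_at ?y i \<longleftrightarrow> f i = 1" if "i < n" for i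
    using that bit_at_pair_code(4)[of ?x ?u i] by (simp add: colour_at_def fst_length_pair_code)
  have f01: "f j = 0 \<or> f j = 1" if "j < n" for j
    using assms(2,5) that by (auto simp: two_partition_def)
  have "zeros_at ?y i = card {j \<in> neighbors G i. f j = 0}"
       "ones_at ?y i = card {j \<in> neighbors G i. f j = 1}" if "i < n" for i
  proof -
    have "{j. j < n \<and> adj_at ?y i j \<and> \<not> colour_at ?y j} = {j. j < n \<and> adj_at ?y i j \<and> f j = 0}"
      using colour f01 by force
    then show "zeros_at ?y i = card {j \<in> neighbors G i. f j = 0}"
      unfolding zeros_at_def side using nb[OF that] by simp
    have "{j. j < n \<and> adj_at ?y i j \<and> colour_at ?y j} = {j. j < n \<and> adj_at ?y i j \<and> f j = 1}"
      using colour by blast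
    then show "ones_at ?y i = card {j \<in> neighbors G i. f j = 1}"
      unfolding ones_at_def side using nb[OF that] by simp
  qed
  then have "zeros_at ?y i \<le> ones_at ?y i + 1 \<and> ones_at ?y i \<le> zeros_at ?y i + 1" if "i < n" for i
    using assms(2,4) that unfolding locally_balanced_open_def balanced_iff by simp
  moreover obtain A B where AB: "A \<union> B = {..<n}" "parcs G \<subseteq> A \<times> B \<union> B \<times> A"
      "\<And>v. v \<in> A \<Longrightarrow> card (neighbors G v) = 3" "\<And>v. v \<in> B \<Longrightarrow> card (neighbors G v) = d"
    using assms(2,3) unfolding biregular_bipartite_def by auto
  have "degree_at ?y i = 3 \<or> degree_at ?y i = d" if "i < n" for i
    using AB that deg[OF that] by fastforce
  moreover have "degree_at ?y i = 3 \<and> degree_at ?y j = d \<or> degree_at ?y i = d \<and> degree_at ?y j = 3"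
    if "i < n" "j < n" "adj i j" for i j
    using AB that deg by (auto simp: adj_def)
  ultimately show ?thesis
    unfolding verified_def side using adj sym by (auto simp: fst_length_pair_code x)
qed

lemma graph_code_of_verified:
  assumes "verified d (pair_code x u)" "d \<noteq> 3"
  obtains G n f where "x = graph_code G" "pair_graph G" "pverts G = {..<n}"
    "biregular_bipartite 3 d G" "two_partition G f" "locally_balanced_open G f"
proof -
  define n where "n = side (pair_code x u)"
  define adj where "adj = adj_at (pair_code x u)"
  define f :: "nat \<Rightarrow> nat" where "f i = of_bool (colour_at (pair_code x u) i)" for i
  let ?G = "graph_on n adj"
  have x: "length x = n * n"
    using assms(1) by (simp add: verified_def fst_length_pair_code n_def)
  have f01: "f j = 0 \<longleftrightarrow> \<not> colour_at (pair_code x u) j" "f j = 1 \<longleftrightarrow> colour_at (pair_code x u) j" for j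
    by (simp_all add: f_def)
  have v: "card {j. j < n \<and> adj i j} = 3 \<or> card {j. j < n \<and> adj i j} = d"
      "card {j. j < n \<and> adj i j \<and> f j = 0} \<le> card {j. j < n \<and> adj i j \<and> f j = 1} + 1"
      "card {j. j < n \<and> adj i j \<and> f j = 1} \<le> card {j. j < n \<and> adj i j \<and> f j = 0} + 1" if "i < n" for i
    using assms(1) that
    unfolding verified_def n_def[symmetric] degree_at_def zeros_at_def ones_at_def adj_def[symmetric] f01
    by blast+
  have e: "adj j i" "card {k. k < n \<and> adj i k} = 3 \<and> card {k. k < n \<and> adj j k} = d \<or>
      card {k. k < n \<and> adj i k} = d \<and> card {k. k < n \<and> adj j k} = 3" if "i < n" "j < n" "adj i j" for i j
    using assms(1) that
    unfolding verified_def n_def[symmetric] degree_at_def adj_def[symmetric] by auto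
  have nb: "neighbors ?G i = {j. j < n \<and> adj i j}" if "i < n" for i
    using that by (rule neighbors_graph_on)
  show thesis
  proof
    have "adj (k div n) (k mod n) = x ! k" if "k < n * n" for k
    proof -
      have "k div n * n + k mod n = k" by simp
      then show ?thesis
        unfolding adj_def adj_at_def n_def[symmetric] using that x by (simp add: bit_at_pair_code)
    qed
    then show "x = graph_code ?G"
      unfolding graph_code_graph_on by (intro nth_equalityI) (auto simp: x)
    show "pair_graph ?G"
      using e assms(2) by (intro pair_graph_graph_on) metis
    show "biregular_bipartite 3 d ?G"
      unfolding biregular_bipartite_def
    proof (intro exI conjI)
      show "{i. i < n \<and> card {k. k < n \<and> adj i k} = 3} \<union> {i. i < n \<and> card {k. k < n \<and> adj i k} = d} = pverts ?G"
        using v(1) by auto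
      show "parcs ?G \<subseteq> {i. i < n \<and> card {k. k < n \<and> adj i k} = 3} \<times> {i. i < n \<and> card {k. k < n \<and> adj i k} = d} \<union>
          {i. i < n \<and> card {k. k < n \<and> adj i k} = d} \<times> {i. i < n \<and> card {k. k < n \<and> adj i k} = 3}"
        using e(2) by auto
    qed (use assms(2) nb in auto)
    show "two_partition ?G f" by (auto simp: two_partition_def f_def)
    have "{j \<in> neighbors ?G i. P j} = {j. j < n \<and> adj i j \<and> P j}" if "i < n" for i P
      using nb[OF that] by auto
    then show "locally_balanced_open ?G f"
      unfolding locally_balanced_open_def balanced_iff using v by simp
  qed simp
qed

theorem LBP_yes_in_NP: "LBP_yes r \<in> NP"
proof -
  have ne: "8 * r \<noteq> 3" by presburger
  have "x \<in> LBP_yes r \<longleftrightarrow>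
      (\<exists>u. length u \<le> poly [:0, 1:] (length x) \<and> [verified (8 * r) (pair_code x u)] = [True])" for x
  proof
    assume "x \<in> LBP_yes r"
    then obtain G f n where G: "x = graph_code G" "pair_graph G" "pverts G = {..<n}"
        "biregular_bipartite 3 (8 * r) G" "two_partition G f" "locally_balanced_open G f"
      unfolding LBP_yes_def is_instance_def by blast
    \<comment> \<open>The witness is the colouring, which has \<open>n \<le> n * n\<close> bits, so
      the identity serves as bound for its length.\<close>
    have "length x = n * n" by (simp add: G(1,3) length_graph_code)
    then show "\<exists>u. length u \<le> poly [:0, 1:] (length x) \<and> [verified (8 * r) (pair_code x u)] = [True]"
      using verified_graph_code[OF G(2-4,6,5)] G(1)
      by (intro exI[of _ "map (\<lambda>i. f i = 1) [0..<n]"]) simp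
  next
    assume "\<exists>u. length u \<le> poly [:0, 1:] (length x) \<and> [verified (8 * r) (pair_code x u)] = [True]"
    then obtain u where "verified (8 * r) (pair_code x u)" by auto
    then obtain G n f where "x = graph_code G" "pair_graph G" "pverts G = {..<n}"
        "biregular_bipartite 3 (8 * r) G" "two_partition G f" "locally_balanced_open G f"
      by (rule graph_code_of_verified[OF _ ne])
    then show "x \<in> LBP_yes r" unfolding LBP_yes_def is_instance_def by blast
  qed
  then show ?thesis
    unfolding NP_def using polytime_verified by blast
qed


section \<open>From equality-linked hypergraphs to biregular graphs\<close>

text \<open>Gadget \<open>\<gamma>\<close> is a Fano plane without the line formed by point 0 of \<open>\<gamma>\<close>, point 0 of the next gadget
  and point 1 of \<open>\<gamma>\<close>; the remaining four points are numbered 2 to 5.\<close>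

definition points :: "(nat \<Rightarrow> nat) \<Rightarrow> nat \<Rightarrow> nat \<Rightarrow> (nat \<times> nat) set" where
  "points nxt \<gamma> l =
     (if l = 0 then {(\<gamma>, 0), (\<gamma>, 2), (\<gamma>, 3)}
      else if l = 1 then {(\<gamma>, 0), (\<gamma>, 4), (\<gamma>, 5)}
      else if l = 2 then {(nxt \<gamma>, 0), (\<gamma>, 2), (\<gamma>, 4)}
      else if l = 3 then {(nxt \<gamma>, 0), (\<gamma>, 3), (\<gamma>, 5)}
      else if l = 4 then {(\<gamma>, 1), (\<gamma>, 2), (\<gamma>, 5)}
      else {(\<gamma>, 1), (\<gamma>, 3), (\<gamma>, 4)})"

lemma card_points: "card (points nxt \<gamma> l) = 3"
  by (auto simp: points_def)

lemma radix: "d < b \<Longrightarrow> (q * b + d) div b = q" "d < b \<Longrightarrow> (q * b + d) mod b = d" for q b d :: nat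
  by simp_all

lemma radix_less:
  fixes a b d k :: nat
  assumes "a < b" "d < k"
  shows "a * k + d < b * k"
proof -
  have "a * k + d < Suc a * k" using assms(2) by simp
  also have "\<dots> \<le> b * k" using assms(1) by (intro mult_right_mono) auto
  finally show ?thesis .
qed

text \<open>Point 1 of gadget \<open>\<gamma>\<close> is the copy of a variable that is used at position \<open>pos \<gamma>\<close> of the triple \<open>trip \<gamma>\<close>,
  and \<open>R\<close> selects the triples that are constraints.\<close>

locale gadgets =
  fixes r M g :: nat and trip pos nxt :: "nat \<Rightarrow> nat" and R :: "nat \<Rightarrow> bool"
  assumes r: "r \<ge> 1"
    and slots: "bij_betw (\<lambda>\<gamma>. (trip \<gamma>, pos \<gamma>)) {..<g} ({..<M} \<times> {..<3})"
    and nxt: "bij_betw nxt {..<g} {..<g}"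
begin

text \<open>The vertices of degree \<open>8 * r\<close> are the points \<open>(\<gamma>', j, \<kappa>)\<close> of three copies \<open>\<kappa>\<close> of the structure. A triple
  gives a 3 by 3 array of points (three positions, three copies). If it is a constraint, we connect
  the points within each copy, otherwise the three copies of each position: the degrees do not
  depend on \<open>R\<close>. The numbers \<open>s > 18\<close> are the padding.\<close>

definition inc :: "nat \<Rightarrow> nat \<Rightarrow> nat \<times> nat \<times> nat \<Rightarrow> bool" where
  "inc \<gamma> s = (\<lambda>(\<gamma>', j, \<kappa>).
     if s < 18 then \<kappa> = s mod 3 \<and> (\<gamma>', j) \<in> points nxt \<gamma> (s div 3)
     else if s = 18 then j = 1 \<and> (if R (trip \<gamma>) then trip \<gamma>' = trip \<gamma> \<and> \<kappa> = pos \<gamma> else \<gamma>' = \<gamma>)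
     else \<gamma>' = \<gamma> \<and> j = s mod 6)"

lemma nxt_less: "\<gamma> < g \<Longrightarrow> nxt \<gamma> < g"
  using bij_betwE[OF nxt] by simp

lemma pos_less: "\<gamma> < g \<Longrightarrow> pos \<gamma> < 3" and trip_less: "\<gamma> < g \<Longrightarrow> trip \<gamma> < M"
  using bij_betwE[OF slots] by simp_all

lemma slot_ex1:
  assumes "e < M" "c < 3"
  shows "\<exists>\<gamma><g. trip \<gamma> = e \<and> pos \<gamma> = c"
proof -
  have "(e, c) \<in> (\<lambda>\<gamma>. (trip \<gamma>, pos \<gamma>)) ` {..<g}"
    using bij_betw_imp_surj_on[OF slots] assms by simp
  then show ?thesis by auto
qed

lemma slot_inj: "\<gamma> < g \<Longrightarrow> \<gamma>' < g \<Longrightarrow> trip \<gamma> = trip \<gamma>' \<Longrightarrow> pos \<gamma> = pos \<gamma>' \<Longrightarrow> \<gamma> = \<gamma>'"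
  by (rule inj_onD[OF bij_betw_imp_inj_on[OF slots]]) simp_all

lemma card_trip:
  assumes "e < M"
  shows "card {\<gamma>. \<gamma> < g \<and> trip \<gamma> = e} = 3"
proof -
  have "bij_betw pos {\<gamma>. \<gamma> < g \<and> trip \<gamma> = e} {..<3}"
  proof (rule bij_betw_imageI)
    show "inj_on pos {\<gamma>. \<gamma> < g \<and> trip \<gamma> = e}"
      by (rule inj_onI) (auto intro: slot_inj)
    show "pos ` {\<gamma>. \<gamma> < g \<and> trip \<gamma> = e} = {..<3}"
      using slot_ex1[OF assms] by (auto simp: pos_less)
  qed
  then show ?thesis by (simp add: bij_betw_same_card)
qed

section \<open>Degrees of triples and points\<close>

abbreviation "lower \<equiv> {..<g} \<times> {..<6 :: nat} \<times> {..<3 :: nat}"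

lemma card_lower:
  assumes "\<gamma> < g" "s < 24 * r"
  shows "card {b \<in> lower. inc \<gamma> s b} = 3"
proof -
  consider "s < 18" | "s = 18" "R (trip \<gamma>)" | "s = 18" "\<not> R (trip \<gamma>)" | "18 < s" by linarith
  then show ?thesis
  proof cases
    case 1
    have "points nxt \<gamma> (s div 3) \<subseteq> {..<g} \<times> {..<6}"
      using assms(1) nxt_less by (auto simp: points_def)
    then have "{b \<in> lower. inc \<gamma> s b} = (\<lambda>(\<gamma>', j). (\<gamma>', j, s mod 3)) ` points nxt \<gamma> (s div 3)"
      using 1 by (auto simp: inc_def image_iff)
    moreover have "inj_on (\<lambda>(\<gamma>', j). (\<gamma>', j, s mod 3)) (points nxt \<gamma> (s div 3))"
      by (auto simp: inj_on_def)
    ultimately show ?thesis by (simp only: card_image card_points)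
  next
    case 2
    have "{b \<in> lower. inc \<gamma> s b} = (\<lambda>\<gamma>'. (\<gamma>', 1, pos \<gamma>)) ` {\<gamma>'. \<gamma>' < g \<and> trip \<gamma>' = trip \<gamma>}"
      using 2 pos_less[OF assms(1)] by (auto simp: inc_def image_iff)
    then show ?thesis using card_trip[OF trip_less[OF assms(1)]] by (simp add: card_image inj_on_def)
  next
    case 3
    have "{b \<in> lower. inc \<gamma> s b} = (\<lambda>\<kappa>. (\<gamma>, 1, \<kappa>)) ` {..<3}"
      using 3 assms(1) by (auto simp: inc_def image_iff)
    then show ?thesis by (simp add: card_image inj_on_def)
  next
    case 4
    have "{b \<in> lower. inc \<gamma> s b} = (\<lambda>\<kappa>. (\<gamma>, s mod 6, \<kappa>)) ` {..<3}"
      using 4 assms(1) by (auto simp: inc_def image_iff)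
    then show ?thesis by (simp add: card_image inj_on_def)
  qed
qed

text \<open>Residue 0 gets one padding triple less because 18, a multiple of 6, is reserved for the
  array of a triple. This is exactly what point 0 requires, which lies on one line more than the
  points 2 to 5.\<close>

lemma card_pads:
  assumes "j < 6"
  shows "card {s. 18 < s \<and> s < 24 * r \<and> s mod 6 = j} = (if j = 0 then 4 * r - 4 else 4 * r - 3)"
proof -
  let ?q = "if j = 0 then 4 else 3 :: nat"
  have "{s. 18 < s \<and> s < 24 * r \<and> s mod 6 = j} = (\<lambda>q. 6 * q + j) ` {?q..<4 * r}"
  proof (intro set_eqI iffI)
    fix s assume s: "s \<in> {s. 18 < s \<and> s < 24 * r \<and> s mod 6 = j}"
    then have "s = 6 * (s div 6) + j" by simp presburger
    moreover have "s div 6 \<in> {?q..<4 * r}" using s by (auto; presburger)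
    ultimately show "s \<in> (\<lambda>q. 6 * q + j) ` {?q..<4 * r}" by blast
  qed (use assms in \<open>auto split: if_splits\<close>)
  then show ?thesis by (simp add: card_image inj_on_def)
qed

text \<open>Every point of a Fano plane lies on three lines, and the removed line costs each of its
  points one of them. Point 0 plays this part in its own gadget and in the preceding one
  \<open>\<gamma>0\<close>, so it has 2 + 2 lines, while point 1 has 2.\<close>

lemma card_lines:
  assumes "\<gamma>' < g" "j < 6" "\<kappa> < 3"
  shows "card {(\<gamma>, s). \<gamma> < g \<and> s < 18 \<and> inc \<gamma> s (\<gamma>', j, \<kappa>)} = (if j = 0 then 4 else if j = 1 then 2 else 3)"
proof -
  let ?L = "{(\<gamma>, l). \<gamma> < g \<and> l < 6 \<and> (\<gamma>', j) \<in> points nxt \<gamma> l}"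
  have "{(\<gamma>, s). \<gamma> < g \<and> s < 18 \<and> inc \<gamma> s (\<gamma>', j, \<kappa>)} = (\<lambda>(\<gamma>, l). (\<gamma>, 3 * l + \<kappa>)) ` ?L"
  proof (intro set_eqI iffI)
    fix a assume "a \<in> {(\<gamma>, s). \<gamma> < g \<and> s < 18 \<and> inc \<gamma> s (\<gamma>', j, \<kappa>)}"
    then obtain \<gamma> s where a: "a = (\<gamma>, s)" "\<gamma> < g" "s < 18" "\<kappa> = s mod 3" "(\<gamma>', j) \<in> points nxt \<gamma> (s div 3)"
      by (auto simp: inc_def)
    then have "a = (\<lambda>(\<gamma>, l). (\<gamma>, 3 * l + \<kappa>)) (\<gamma>, s div 3)" "(\<gamma>, s div 3) \<in> ?L" by auto
    then show "a \<in> (\<lambda>(\<gamma>, l). (\<gamma>, 3 * l + \<kappa>)) ` ?L" by (rule image_eqI)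
  qed (use assms(3) in \<open>auto simp: inc_def\<close>)
  then have eq: "card {(\<gamma>, s). \<gamma> < g \<and> s < 18 \<and> inc \<gamma> s (\<gamma>', j, \<kappa>)} = card ?L"
    by (simp add: card_image inj_on_def)
  obtain \<gamma>0 where \<gamma>0: "\<gamma>0 < g" "nxt \<gamma>0 = \<gamma>'"
  proof -
    have "\<gamma>' \<in> nxt ` {..<g}" using bij_betw_imp_surj_on[OF nxt] assms(1) by simp
    then show ?thesis using that by blast
  qed
  have uniq: "nxt \<gamma> = \<gamma>' \<longleftrightarrow> \<gamma> = \<gamma>0" if "\<gamma> < g" for \<gamma>
    using bij_betw_imp_inj_on[OF nxt] \<gamma>0 that by (auto dest: inj_onD)
  have l6: "l < 6 \<longleftrightarrow> l = 0 \<or> l = 1 \<or> l = 2 \<or> l = 3 \<or> l = 4 \<or> l = 5" for l :: nat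
    by linarith
  consider "j = 0" | "j = 1" | "j = 2" | "j = 3" | "j = 4" | "j = 5" using assms(2) by linarith
  then have "card ?L = (if j = 0 then 4 else if j = 1 then 2 else 3)"
  proof cases
    case 1
    then have "?L = {(\<gamma>', 0), (\<gamma>', 1), (\<gamma>0, 2), (\<gamma>0, 3)}"
      using assms(1) \<gamma>0 uniq by (auto simp: points_def l6 split: if_splits)
    then show ?thesis using 1 by simp
  next
    case 2
    then have "?L = {(\<gamma>', 4), (\<gamma>', 5)}"
      using assms(1) by (auto simp: points_def l6 split: if_splits)
    then show ?thesis using 2 by simp
  next
    case 3
    then have "?L = {(\<gamma>', 0), (\<gamma>', 2), (\<gamma>', 4)}"
      using assms(1) by (auto simp: points_def l6 split: if_splits)
    then show ?thesis using 3 by simp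
  next
    case 4
    then have "?L = {(\<gamma>', 0), (\<gamma>', 3), (\<gamma>', 5)}"
      using assms(1) by (auto simp: points_def l6 split: if_splits)
    then show ?thesis using 4 by simp
  next
    case 5
    then have "?L = {(\<gamma>', 1), (\<gamma>', 2), (\<gamma>', 5)}"
      using assms(1) by (auto simp: points_def l6 split: if_splits)
    then show ?thesis using 5 by simp
  next
    case 6
    then have "?L = {(\<gamma>', 1), (\<gamma>', 3), (\<gamma>', 4)}"
      using assms(1) by (auto simp: points_def l6 split: if_splits)
    then show ?thesis using 6 by simp
  qed
  with eq show ?thesis by simp
qed

text \<open>A cell of the 3 by 3 array of a triple lies in exactly one row and exactly one column.
  For a constraint the relevant triple of points is named by the slot \<open>\<gamma>1\<close> whose
  position equals the copy, otherwise by the slot itself.\<close>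

lemma card_row:
  assumes "\<gamma>' < g" "\<kappa> < 3"
  shows "card {\<gamma>. \<gamma> < g \<and> inc \<gamma> 18 (\<gamma>', j, \<kappa>)} = (if j = 1 then 1 else 0)"
proof (cases "j = 1")
  case True
  obtain \<gamma>1 where "\<gamma>1 < g" "trip \<gamma>1 = trip \<gamma>'" "pos \<gamma>1 = \<kappa>"
    using slot_ex1[OF trip_less[OF assms(1)] assms(2)] by blast
  then have "{\<gamma>. \<gamma> < g \<and> inc \<gamma> 18 (\<gamma>', j, \<kappa>)} = {if R (trip \<gamma>') then \<gamma>1 else \<gamma>'}"
    using True assms by (auto simp: inc_def split: if_splits intro: slot_inj)
  then show ?thesis using True by simp
qed (simp add: inc_def)

text \<open>Lines, array and padding contribute \<open>4 + 0 + (4 * r - 4)\<close> for point 0,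
  \<open>2 + 1 + (4 * r - 3)\<close> for point 1 and \<open>3 + 0 + (4 * r - 3)\<close> for the
  others.\<close>

lemma card_upper:
  assumes "\<gamma>' < g" "j < 6" "\<kappa> < 3"
  shows "card {(\<gamma>, s). \<gamma> < g \<and> s < 24 * r \<and> inc \<gamma> s (\<gamma>', j, \<kappa>)} = 4 * r"
proof -
  let ?b = "(\<gamma>', j, \<kappa>)"
  let ?L = "{(\<gamma>, s). \<gamma> < g \<and> s < 18 \<and> inc \<gamma> s ?b}"
  let ?W = "(\<lambda>\<gamma>. (\<gamma>, 18 :: nat)) ` {\<gamma>. \<gamma> < g \<and> inc \<gamma> 18 ?b}"
  let ?P = "Pair \<gamma>' ` {s. 18 < s \<and> s < 24 * r \<and> s mod 6 = j}"
  have split: "{(\<gamma>, s). \<gamma> < g \<and> s < 24 * r \<and> inc \<gamma> s ?b} = ?L \<union> (?W \<union> ?P)"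
  proof (intro set_eqI iffI)
    fix a assume "a \<in> {(\<gamma>, s). \<gamma> < g \<and> s < 24 * r \<and> inc \<gamma> s ?b}"
    then obtain \<gamma> s where "a = (\<gamma>, s)" "\<gamma> < g" "s < 24 * r" "inc \<gamma> s ?b" by auto
    then show "a \<in> ?L \<union> (?W \<union> ?P)"
      by (cases s "18 :: nat" rule: linorder_cases) (auto simp: inc_def)
  qed (use assms(1) r in \<open>auto simp: inc_def\<close>)
  have fin: "finite ?L" "finite ?W" "finite ?P"
    by (auto intro: finite_subset[of _ "{..<g} \<times> {..<18 :: nat}"])
  have "card (?L \<union> (?W \<union> ?P)) = card ?L + (card ?W + card ?P)"
    using fin by (subst card_Un_disjoint card_Un_disjoint; auto)+
  then show ?thesis
    unfolding split using card_lines[OF assms] card_row[OF assms(1,3)] card_pads[OF assms(2)] r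
    by (simp add: card_image inj_on_def split: if_splits)
qed

section \<open>Numbering of the vertices\<close>

definition upper_size :: nat where "upper_size = 48 * r * g"
definition size :: nat where "size = upper_size + 18 * g"

text \<open>The last component tells the two occurrences of a triple apart. Being the lowest digit
  it is the parity of the vertex number, which later serves as the colour.\<close>

definition dec_up :: "nat \<Rightarrow> nat \<times> nat \<times> nat" where
  "dec_up a = (a div 2 div (24 * r), a div 2 mod (24 * r), a mod 2)"
definition enc_up :: "nat \<times> nat \<times> nat \<Rightarrow> nat" where
  "enc_up = (\<lambda>(\<gamma>, s, d). (\<gamma> * (24 * r) + s) * 2 + d)"
definition dec_low :: "nat \<Rightarrow> nat \<times> nat \<times> nat" where
  "dec_low b = (b div 3 div 6, b div 3 mod 6, b mod 3)"
definition enc_low :: "nat \<times> nat \<times> nat \<Rightarrow> nat" where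
  "enc_low = (\<lambda>(\<gamma>, j, \<kappa>). (\<gamma> * 6 + j) * 3 + \<kappa>)"

lemma dec_enc_low: "b \<in> lower \<Longrightarrow> dec_low (enc_low b) = b"
  unfolding dec_low_def enc_low_def by (clarsimp simp only: lessThan_iff radix split simp_thms prod.inject)

lemma bij_enc_low: "bij_betw enc_low lower {..<18 * g}"
proof (rule bij_betw_byWitness[where f' = dec_low])
  show "\<forall>a\<in>lower. dec_low (enc_low a) = a"
    using dec_enc_low by blast
  show "\<forall>b\<in>{..<18 * g}. enc_low (dec_low b) = b"
    by (simp only: dec_low_def enc_low_def split div_mult_mod_eq ball_triv simp_thms)
  show "enc_low ` lower \<subseteq> {..<18 * g}"
    by (auto simp: enc_low_def)
  show "dec_low ` {..<18 * g} \<subseteq> lower"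
    by (auto simp: dec_low_def)
qed

abbreviation "upper \<equiv> {..<g} \<times> {..<24 * r} \<times> {..<2 :: nat}"

lemma dec_enc_up: "a \<in> upper \<Longrightarrow> dec_up (enc_up a) = a"
  unfolding dec_up_def enc_up_def by (clarsimp simp only: lessThan_iff radix split simp_thms prod.inject)

lemma bij_enc_up: "bij_betw enc_up upper {..<upper_size}"
proof (rule bij_betw_byWitness[where f' = dec_up])
  show "\<forall>a\<in>upper. dec_up (enc_up a) = a"
    using dec_enc_up by blast
  show "\<forall>b\<in>{..<upper_size}. enc_up (dec_up b) = b"
    by (simp only: dec_up_def enc_up_def split div_mult_mod_eq ball_triv simp_thms)
  have upper_size: "upper_size = g * (24 * r) * 2" by (simp add: upper_size_def)
  show "enc_up ` upper \<subseteq> {..<upper_size}"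
  proof clarify
    fix \<gamma> s d :: nat assume *: "\<gamma> < g" "s < 24 * r" "d < 2"
    then have "\<gamma> * (24 * r) + s < g * (24 * r)" by (intro radix_less)
    then show "enc_up (\<gamma>, s, d) < upper_size" using *
      unfolding enc_up_def split upper_size by (intro radix_less)
  qed
  show "dec_up ` {..<upper_size} \<subseteq> upper"
  proof (rule image_subsetI)
    fix a assume "a \<in> {..<upper_size}"
    then have "a < g * (24 * r) * 2" by (simp only: upper_size lessThan_iff)
    then have "a div 2 div (24 * r) < g" by (intro less_mult_imp_div_less)
    moreover have "a div 2 mod (24 * r) < 24 * r" "a mod 2 < 2" using r by simp_all
    ultimately show "dec_up a \<in> upper" unfolding dec_up_def by blast
  qed
qed

definition link :: "nat \<Rightarrow> nat \<Rightarrow> bool" where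
  "link a b \<longleftrightarrow> inc (fst (dec_up a)) (fst (snd (dec_up a))) (dec_low b)"

definition adj :: "nat \<Rightarrow> nat \<Rightarrow> bool" where
  "adj u v \<longleftrightarrow> u < upper_size \<and> upper_size \<le> v \<and> link u (v - upper_size) \<or>
     v < upper_size \<and> upper_size \<le> u \<and> link v (u - upper_size)"

definition graph :: "nat pair_pre_digraph" where
  "graph = graph_on size adj"

lemma enc_low_less: "b \<in> lower \<Longrightarrow> enc_low b < 18 * g"
  using bij_enc_low by (auto simp: bij_betw_def)

lemma enc_up_less: "a \<in> upper \<Longrightarrow> enc_up a < upper_size"
  using bij_enc_up by (auto simp: bij_betw_def)

lemma ex_enc_low: "b < 18 * g \<Longrightarrow> \<exists>c\<in>lower. b = enc_low c"
  using bij_betw_imp_surj_on[OF bij_enc_low] by blast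

lemma ex_enc_up: "a < upper_size \<Longrightarrow> \<exists>c\<in>upper. a = enc_up c"
  using bij_betw_imp_surj_on[OF bij_enc_up] by blast

lemma neighbors_upper:
  assumes "(\<gamma>, s, d) \<in> upper"
  shows "neighbors graph (enc_up (\<gamma>, s, d)) = (\<lambda>b. upper_size + enc_low b) ` {b \<in> lower. inc \<gamma> s b}"
proof -
  have "neighbors graph (enc_up (\<gamma>, s, d)) = {v. v < size \<and> adj (enc_up (\<gamma>, s, d)) v}"
    unfolding graph_def using enc_up_less[OF assms] by (intro neighbors_graph_on) (simp add: size_def)
  also have "\<dots> = (\<lambda>b. upper_size + b) ` {b. b < 18 * g \<and> link (enc_up (\<gamma>, s, d)) b}"
  proof (intro set_eqI iffI)
    fix v assume "v \<in> {v. v < size \<and> adj (enc_up (\<gamma>, s, d)) v}"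
    then have "v = upper_size + (v - upper_size)" "v - upper_size < 18 * g" "link (enc_up (\<gamma>, s, d)) (v - upper_size)"
      using enc_up_less[OF assms] by (auto simp: adj_def size_def)
    then show "v \<in> (\<lambda>b. upper_size + b) ` {b. b < 18 * g \<and> link (enc_up (\<gamma>, s, d)) b}" by blast
  qed (use enc_up_less[OF assms] in \<open>auto simp: adj_def size_def\<close>)
  also have "{b. b < 18 * g \<and> link (enc_up (\<gamma>, s, d)) b} = enc_low ` {b \<in> lower. inc \<gamma> s b}"
  proof (intro set_eqI iffI)
    fix b assume b: "b \<in> {b. b < 18 * g \<and> link (enc_up (\<gamma>, s, d)) b}"
    then obtain c where c: "c \<in> lower" "b = enc_low c" using ex_enc_low by blast
    then have "inc \<gamma> s c" using b assms by (simp only: link_def dec_enc_low dec_enc_up mem_Collect_eq fst_conv snd_conv)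
    then show "b \<in> enc_low ` {b \<in> lower. inc \<gamma> s b}" using c by blast
  next
    fix b assume "b \<in> enc_low ` {b \<in> lower. inc \<gamma> s b}"
    then obtain c where c: "c \<in> lower" "b = enc_low c" "inc \<gamma> s c" by blast
    then show "b \<in> {b. b < 18 * g \<and> link (enc_up (\<gamma>, s, d)) b}"
      using enc_low_less[OF c(1)] assms by (simp only: link_def dec_enc_low dec_enc_up mem_Collect_eq fst_conv snd_conv)
  qed
  finally show ?thesis by (simp add: image_image)
qed

lemma neighbors_lower:
  assumes "b \<in> lower"
  shows "neighbors graph (upper_size + enc_low b) = enc_up ` {a \<in> upper. inc (fst a) (fst (snd a)) b}"
proof -
  have "neighbors graph (upper_size + enc_low b) = {v. v < size \<and> adj (upper_size + enc_low b) v}"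
    unfolding graph_def using enc_low_less[OF assms] by (intro neighbors_graph_on) (simp add: size_def)
  also have "\<dots> = {a. a < upper_size \<and> link a (enc_low b)}"
    by (auto simp: adj_def size_def)
  also have "\<dots> = enc_up ` {a \<in> upper. inc (fst a) (fst (snd a)) b}"
  proof (intro set_eqI iffI)
    fix a assume a: "a \<in> {a. a < upper_size \<and> link a (enc_low b)}"
    then obtain c where c: "c \<in> upper" "a = enc_up c" using ex_enc_up by blast
    then have "inc (fst c) (fst (snd c)) b" using a assms by (simp only: link_def dec_enc_low dec_enc_up mem_Collect_eq)
    then show "a \<in> enc_up ` {a \<in> upper. inc (fst a) (fst (snd a)) b}" using c by blast
  next
    fix a assume "a \<in> enc_up ` {a \<in> upper. inc (fst a) (fst (snd a)) b}"
    then obtain c where c: "c \<in> upper" "a = enc_up c" "inc (fst c) (fst (snd c)) b" by blast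
    then show "a \<in> {a. a < upper_size \<and> link a (enc_low b)}"
      using enc_up_less[OF c(1)] assms by (simp only: link_def dec_enc_low dec_enc_up mem_Collect_eq)
  qed
  finally show ?thesis .
qed

lemma degree_upper:
  assumes "a < upper_size"
  shows "card (neighbors graph a) = 3"
proof -
  obtain \<gamma> s d where a: "(\<gamma>, s, d) \<in> upper" "a = enc_up (\<gamma>, s, d)"
    using ex_enc_up[OF assms] by fast
  have "inj_on (\<lambda>b. upper_size + enc_low b) {b \<in> lower. inc \<gamma> s b}"
    using bij_betw_imp_inj_on[OF bij_enc_low] by (auto simp: inj_on_def)
  then show ?thesis
    using a card_lower[of \<gamma> s] by (simp only: neighbors_upper card_image) simp
qed

text \<open>Serves twice: adding both parities gives the degree \<open>8 * r\<close>, and colouring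
  the triples by parity balances the point.\<close>

lemma lower_half:
  assumes "b \<in> lower" "d < 2"
  shows "card {a \<in> neighbors graph (upper_size + enc_low b). a mod 2 = d} = 4 * r"
proof -
  let ?S = "{(\<gamma>, s). \<gamma> < g \<and> s < 24 * r \<and> inc \<gamma> s b}"
  have "enc_up (\<gamma>, s, d') mod 2 = d'" if "d' < 2" for \<gamma> s d'
    using that unfolding enc_up_def split by (rule radix(2))
  then have "{a \<in> enc_up ` {a \<in> upper. inc (fst a) (fst (snd a)) b}. a mod 2 = d}
      = enc_up ` {a \<in> upper. inc (fst a) (fst (snd a)) b \<and> snd (snd a) = d}"
    by fastforce
  also have "{a \<in> upper. inc (fst a) (fst (snd a)) b \<and> snd (snd a) = d} = (\<lambda>(\<gamma>, s). (\<gamma>, s, d)) ` ?S"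
    using assms(2) by auto
  finally have "{a \<in> neighbors graph (upper_size + enc_low b). a mod 2 = d} = (\<lambda>(\<gamma>, s). enc_up (\<gamma>, s, d)) ` ?S"
    unfolding neighbors_lower[OF assms(1)] by (simp add: image_image split_def)
  moreover have "inj_on (\<lambda>(\<gamma>, s). enc_up (\<gamma>, s, d)) ?S"
    using bij_betw_imp_inj_on[OF bij_enc_up] assms(2) by (auto simp: inj_on_def)
  moreover have "card ?S = 4 * r"
    using assms(1) card_upper by auto
  ultimately show ?thesis by (simp add: card_image)
qed

lemma finite_neighbors: "u < size \<Longrightarrow> finite (neighbors graph u)"
  unfolding graph_def by (subst neighbors_graph_on) auto

lemma degree_lower:
  assumes "b \<in> lower"
  shows "card (neighbors graph (upper_size + enc_low b)) = 8 * r"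
proof -
  let ?N = "neighbors graph (upper_size + enc_low b)"
  have "finite ?N" using finite_neighbors enc_low_less[OF assms] by (simp add: size_def)
  have "card ?N = card ({a \<in> ?N. a mod 2 = 0} \<union> {a \<in> ?N. a mod 2 = 1})"
    by (intro arg_cong[where f = card]) auto
  also have "\<dots> = card {a \<in> ?N. a mod 2 = 0} + card {a \<in> ?N. a mod 2 = 1}"
    using \<open>finite ?N\<close> by (intro card_Un_disjoint) auto
  finally show ?thesis using lower_half[OF assms, of 0] lower_half[OF assms, of 1] by simp
qed

lemma is_instance_graph: "is_instance r graph"
  unfolding is_instance_def
proof (intro conjI)
  show "pair_graph graph"
    unfolding graph_def by (rule pair_graph_graph_on) (auto simp: adj_def)
  show "\<exists>n. pverts graph = {..<n}" by (auto simp: graph_def)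
  show "biregular_bipartite 3 (8 * r) graph"
    unfolding biregular_bipartite_def
  proof (intro exI conjI ballI)
    show "{..<upper_size} \<union> {upper_size..<size} = pverts graph"
      by (auto simp: graph_def size_def)
    show "{..<upper_size} \<inter> {upper_size..<size} = {}" by auto
    show "parcs graph \<subseteq> {..<upper_size} \<times> {upper_size..<size} \<union> {upper_size..<size} \<times> {..<upper_size}"
      by (auto simp: graph_def adj_def)
    show "card (neighbors graph v) = 3" if "v \<in> {..<upper_size}" for v
      using that degree_upper by simp
    show "card (neighbors graph v) = 8 * r" if "v \<in> {upper_size..<size}" for v
    proof -
      have "v - upper_size < 18 * g" using that by (auto simp: size_def)
      then obtain b where "b \<in> lower" "v - upper_size = enc_low b"
        using ex_enc_low by blast
      moreover from this have "v = upper_size + enc_low b" using that by auto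
      ultimately show ?thesis using degree_lower[of b] by simp
    qed
  qed
qed

text \<open>The two counts add up to 3, so they differ by 1 or by 3, and 3 means that a colour is
  missing.\<close>

lemma balanced_three_iff:
  assumes "card N = 3" "\<And>u. u \<in> N \<Longrightarrow> f u \<in> {0, 1 :: nat}"
  shows "\<bar>int (card {u \<in> N. f u = 0}) - int (card {u \<in> N. f u = 1})\<bar> \<le> 1 \<longleftrightarrow>
    (\<exists>u\<in>N. f u = 0) \<and> (\<exists>u\<in>N. f u = 1)"
proof -
  have fin: "finite N" using assms(1) card.infinite by fastforce
  let ?Z = "{u \<in> N. f u = 0}" and ?O = "{u \<in> N. f u = 1}"
  have "card N = card (?Z \<union> ?O)"
    using assms(2) by (intro arg_cong[where f = card]) auto
  also have "\<dots> = card ?Z + card ?O"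
    using fin by (intro card_Un_disjoint) auto
  finally have "card ?Z + card ?O = 3" using assms(1) by simp
  moreover have "card ?Z > 0 \<longleftrightarrow> (\<exists>u\<in>N. f u = 0)" "card ?O > 0 \<longleftrightarrow> (\<exists>u\<in>N. f u = 1)"
    using fin by (auto simp: card_gt_0_iff)
  ultimately show ?thesis by linarith
qed

section \<open>Colourings of the gadgets\<close>

definition good :: "(nat \<Rightarrow> bool) \<Rightarrow> bool" where
  "good h \<longleftrightarrow> (\<forall>\<gamma><g. h (nxt \<gamma>) = h \<gamma>) \<and>
     (\<forall>e<M. R e \<longrightarrow> (\<exists>\<gamma><g. trip \<gamma> = e \<and> h \<gamma>) \<and> (\<exists>\<gamma><g. trip \<gamma> = e \<and> \<not> h \<gamma>))"

text \<open>Two lines of a Fano plane meet in exactly one point. If the removed line gets one colour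
  and the other four points the opposite one, each remaining line has one point of the former colour
  and two of the latter. Copy 2 is inverted.\<close>

definition colour :: "(nat \<Rightarrow> bool) \<Rightarrow> nat \<times> nat \<times> nat \<Rightarrow> bool" where
  "colour h = (\<lambda>(\<gamma>, j, \<kappa>). (h \<gamma> \<noteq> (2 \<le> j)) \<noteq> (\<kappa> = 2))"

lemma colour_onto:
  assumes "good h" "\<gamma> < g" "s < 24 * r"
  shows "\<exists>b\<in>lower. inc \<gamma> s b \<and> colour h b = c"
proof -
  have wit: "\<exists>b\<in>lower. inc \<gamma> s b \<and> colour h b = c"
    if "inc \<gamma> s (\<gamma>', j, \<kappa>)" "\<gamma>' < g" "j < 6" "\<kappa> < 3" "((h \<gamma>' \<noteq> (2 \<le> j)) \<noteq> (\<kappa> = 2)) = c" for \<gamma>' j \<kappa>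
    using that by (intro bexI[of _ "(\<gamma>', j, \<kappa>)"]) (simp_all add: colour_def)
  consider "s < 18" | "s = 18" "R (trip \<gamma>)" | "s = 18" "\<not> R (trip \<gamma>)" | "18 < s" by linarith
  then show ?thesis
  proof cases
    case 1
    have "h (nxt \<gamma>) = h \<gamma>" using assms(1,2) by (simp add: good_def)
    \<comment> \<open>\<open>(a, j)\<close> is the point in which the line meets the removed one,
      and \<open>(\<gamma>, k)\<close> is a point off the removed line; they are coloured
      differently in every copy.\<close>
    then obtain a j k where a: "(a, j) \<in> points nxt \<gamma> (s div 3)" "a < g" "j < 2" "h a = h \<gamma>"
      and k: "(\<gamma>, k) \<in> points nxt \<gamma> (s div 3)" "2 \<le> k" "k < 6"
      using assms(2) nxt_less[OF assms(2)]
      by (cases "s div 3 = 0"; cases "s div 3 = 1"; cases "s div 3 = 2"; cases "s div 3 = 3"; cases "s div 3 = 4")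
         (fastforce simp: points_def)+
    show ?thesis
    proof (cases "(h \<gamma> \<noteq> (s mod 3 = 2)) = c")
      case True
      show ?thesis by (rule wit[of a j "s mod 3"]) (use True 1 a in \<open>auto simp: inc_def\<close>)
    next
      case False
      show ?thesis by (rule wit[of \<gamma> k "s mod 3"]) (use False 1 k assms(2) in \<open>auto simp: inc_def\<close>)
    qed
  next
    case 2
    have "(\<exists>\<gamma>'<g. trip \<gamma>' = trip \<gamma> \<and> h \<gamma>') \<and> (\<exists>\<gamma>'<g. trip \<gamma>' = trip \<gamma> \<and> \<not> h \<gamma>')"
      using assms(1) trip_less[OF assms(2)] 2 unfolding good_def by blast
    \<comment> \<open>If the row lies in copy 2, where colours are inverted, a slot with the
      opposite value is chosen.\<close>
    then obtain \<gamma>' where "\<gamma>' < g" "trip \<gamma>' = trip \<gamma>" "h \<gamma>' = (c \<noteq> (pos \<gamma> = 2))"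
      by (cases "c \<noteq> (pos \<gamma> = 2)") auto
    then show ?thesis
      by (intro wit[of \<gamma>' 1 "pos \<gamma>"]) (use 2 pos_less[OF assms(2)] in \<open>auto simp: inc_def\<close>)
  next
    case 3
    then show ?thesis using assms(2)
      by (intro wit[of \<gamma> 1 "if h \<gamma> = c then 0 else 2"]) (auto simp: inc_def)
  next
    case 4
    then show ?thesis using assms(2)
      by (intro wit[of \<gamma> "s mod 6" "if (h \<gamma> \<noteq> (2 \<le> s mod 6)) = c then 0 else 2"]) (auto simp: inc_def)
  qed
qed

text \<open>The graph is bipartite, so triples only test the colours of points and points only those
  of triples: the two sides can be coloured independently. Parity gives every point
  \<open>4 * r\<close> neighbours of either colour, and \<open>colour h\<close> takes care of the
  triples.\<close>

lemma balanced_of_good: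
  assumes "good h"
  defines "f \<equiv> \<lambda>u. if u < upper_size then u mod 2 else of_bool (colour h (dec_low (u - upper_size)))"
  shows "two_partition graph f \<and> locally_balanced_open graph f"
proof
  show tp: "two_partition graph f"
    by (auto simp: two_partition_def f_def split: if_splits)
  have f_low: "f (upper_size + enc_low b) = of_bool (colour h b)" if "b \<in> lower" for b
    using dec_enc_low[OF that] by (simp add: f_def)
  show "locally_balanced_open graph f"
    unfolding locally_balanced_open_def
  proof
    fix v assume "v \<in> pverts graph"
    then have v: "v < size" by (simp add: graph_def)
    show "\<bar>int (card {u \<in> neighbors graph v. f u = 0}) - int (card {u \<in> neighbors graph v. f u = 1})\<bar> \<le> 1"
    proof (cases "v < upper_size")
      case True
      then obtain \<gamma> s d where a: "(\<gamma>, s, d) \<in> upper" "v = enc_up (\<gamma>, s, d)"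
        using ex_enc_up[of v] by fast
      have "\<exists>u\<in>neighbors graph v. f u = of_bool c" for c
      proof -
        obtain b where "b \<in> lower" "inc \<gamma> s b" "colour h b = c"
          using colour_onto[OF assms(1), of \<gamma> s c] a(1) by auto
        then show ?thesis unfolding a(2) neighbors_upper[OF a(1)] using f_low by auto
      qed
      from this[of False] this[of True] have "(\<exists>u\<in>neighbors graph v. f u = 0) \<and> (\<exists>u\<in>neighbors graph v. f u = 1)"
        by simp
      then show ?thesis
        by (subst balanced_three_iff) (use degree_upper[OF True] in \<open>auto simp: f_def\<close>)
    next
      case False
      then have "v - upper_size < 18 * g" using v by (simp add: size_def)
      then obtain b where b: "b \<in> lower" "v - upper_size = enc_low b" using ex_enc_low by blast
      then have veq: "v = upper_size + enc_low b" using False by simp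
      have "u < upper_size" if "u \<in> neighbors graph v" for u
        using that enc_up_less unfolding veq neighbors_lower[OF b(1)] by blast
      then have "{u \<in> neighbors graph v. f u = c} = {u \<in> neighbors graph v. u mod 2 = c}" for c
        by (auto simp: f_def)
      then show ?thesis using lower_half[OF b(1), of 0] lower_half[OF b(1), of 1] veq by simp
    qed
  qed
qed

lemma good_of_balanced:
  assumes "two_partition graph f" "locally_balanced_open graph f"
  shows "good (\<lambda>\<gamma>. f (upper_size + enc_low (\<gamma>, 1, 0)) = 1)"
proof -
  define c where "c \<gamma> j \<longleftrightarrow> f (upper_size + enc_low (\<gamma>, j, 0)) = 1" for \<gamma> j
  have nae: "\<exists>(\<gamma>', j, \<kappa>)\<in>lower. inc \<gamma> s (\<gamma>', j, \<kappa>) \<and> (f (upper_size + enc_low (\<gamma>', j, \<kappa>)) = 1) = b"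
    if "\<gamma> < g" "s < 24 * r" for \<gamma> s b
  proof -
    have a: "(\<gamma>, s, 0) \<in> upper" using that by simp
    let ?v = "enc_up (\<gamma>, s, 0)"
    have v: "?v \<in> pverts graph" using enc_up_less[OF a] by (simp add: graph_def size_def)
    have "f u \<in> {0, 1}" if "u \<in> neighbors graph ?v" for u
    proof -
      have "u < size" using that v by (auto simp: neighbors_def graph_def)
      then show ?thesis using assms(1) by (auto simp: two_partition_def graph_def)
    qed
    then have "(\<exists>u\<in>neighbors graph ?v. f u = 0) \<and> (\<exists>u\<in>neighbors graph ?v. f u = 1)"
      using assms(2) v degree_upper[OF enc_up_less[OF a]] balanced_three_iff[of "neighbors graph ?v" f]
      unfolding locally_balanced_open_def by blast
    then have "\<exists>u\<in>neighbors graph ?v. (f u = 1) = b"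
      by (cases b) force+
    then show ?thesis unfolding neighbors_upper[OF a] by fast
  qed
  have line: "\<exists>(\<gamma>', j)\<in>points nxt \<gamma> l. c \<gamma>' j = b" if "\<gamma> < g" "l < 6" for \<gamma> l b
  proof -
    \<comment> \<open>Number \<open>3 * l\<close> stands for line \<open>l\<close> in copy 0, the
      copy from which \<open>c\<close> is read.\<close>
    have "3 * l < 24 * r" using that(2) r by linarith
    then show ?thesis
      using nae[OF that(1), of "3 * l" b] that(2) by (fastforce simp: inc_def c_def)
  qed
  \<comment> \<open>Every 2-colouring of the Fano plane has a monochromatic line. The six remaining
    lines show both colours, so it is the removed one that is monochromatic.\<close>
  have eq: "c (nxt \<gamma>) 0 = c \<gamma> 0 \<and> c \<gamma> 1 = c \<gamma> 0" if "\<gamma> < g" for \<gamma>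
    using line[OF that, of 0 True] line[OF that, of 0 False] line[OF that, of 1 True] line[OF that, of 1 False]
      line[OF that, of 2 True] line[OF that, of 2 False] line[OF that, of 3 True] line[OF that, of 3 False]
      line[OF that, of 4 True] line[OF that, of 4 False] line[OF that, of 5 True] line[OF that, of 5 False]
    by (simp add: points_def) argo
  have "good (\<lambda>\<gamma>. c \<gamma> 1)"
    unfolding good_def
  proof (intro conjI allI impI)
    show "c (nxt \<gamma>) 1 = c \<gamma> 1" if "\<gamma> < g" for \<gamma>
      using eq[OF that] eq[OF nxt_less[OF that]] by blast
    have "\<exists>\<gamma><g. trip \<gamma> = e \<and> c \<gamma> 1 = b" if e: "e < M" "R e" for e b
    proof -
      \<comment> \<open>The slot at position 0 names the row of the array that lies in copy
        0.\<close>
      obtain \<gamma> where \<gamma>: "\<gamma> < g" "trip \<gamma> = e" "pos \<gamma> = 0" using slot_ex1[OF e(1), of 0] by auto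
      have "18 < 24 * r" using r by linarith
      then obtain \<gamma>' j \<kappa> where "\<gamma>' < g" "inc \<gamma> 18 (\<gamma>', j, \<kappa>)" "(f (upper_size + enc_low (\<gamma>', j, \<kappa>)) = 1) = b"
        using nae[OF \<gamma>(1), of 18 b] by auto
      then show ?thesis using \<gamma> e(2) by (auto simp: inc_def c_def)
    qed
    from this[of _ True] this[of _ False]
    show "\<exists>\<gamma><g. trip \<gamma> = e \<and> c \<gamma> 1" "\<exists>\<gamma><g. trip \<gamma> = e \<and> \<not> c \<gamma> 1" if "e < M" "R e" for e
      using that by auto
  qed
  then show ?thesis by (simp add: c_def)
qed

theorem balanced_iff_good:
  "(\<exists>f. two_partition graph f \<and> locally_balanced_open graph f) \<longleftrightarrow> (\<exists>h. good h)"
  using balanced_of_good good_of_balanced by blast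

end


section \<open>Not-all-equal constraints\<close>

definition triple_code :: "nat \<Rightarrow> nat \<Rightarrow> nat \<Rightarrow> nat \<Rightarrow> nat" where
  "triple_code m p q s = (p * m + q) * m + s"

text \<open>The copy of variable \<open>v\<close> for position \<open>c\<close> of a triple whose other two entries are \<open>a\<close> and \<open>b\<close>.\<close>

definition slot_code :: "nat \<Rightarrow> nat \<Rightarrow> nat \<Rightarrow> nat \<Rightarrow> nat \<Rightarrow> nat" where
  "slot_code m v b a c = ((v * m + b) * m + a) * 3 + c"

definition slot_triple :: "nat \<Rightarrow> nat \<Rightarrow> nat" where
  "slot_triple m \<gamma> = (let a = \<gamma> div 3 mod m; b = \<gamma> div 3 div m mod m; v = \<gamma> div 3 div m div m in
     if \<gamma> mod 3 = 0 then triple_code m v a b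
     else if \<gamma> mod 3 = 1 then triple_code m a v b
     else triple_code m a b v)"

text \<open>The variable is the leading digit of a slot number, so its slots form a block of
  \<open>m * m * 3\<close> consecutive numbers. The chain runs through the block and returns from
  its last number to its first.\<close>

definition slot_next :: "nat \<Rightarrow> nat \<Rightarrow> nat" where
  "slot_next m \<gamma> = (if Suc \<gamma> mod (m * m * 3) = 0 then Suc \<gamma> - m * m * 3 else Suc \<gamma>)"

definition triple_rel :: "nat \<Rightarrow> (nat \<Rightarrow> nat \<Rightarrow> nat \<Rightarrow> bool) \<Rightarrow> nat \<Rightarrow> bool" where
  "triple_rel m Rel e = Rel (e div m div m) (e div m mod m) (e mod m)"

lemma triple_code_less: "p < m \<Longrightarrow> q < m \<Longrightarrow> s < m \<Longrightarrow> triple_code m p q s < m * m * m"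
  unfolding triple_code_def by (intro radix_less)

lemma slot_code_less:
  assumes "v < m" "b < m" "a < m" "c < 3"
  shows "slot_code m v b a c < m * m * m * 3"
  using triple_code_less[OF assms(1-3)] assms(4) by (simp add: slot_code_def triple_code_def)

lemma slot_code_exhaust:
  assumes "\<gamma> < m * m * m * 3"
  obtains v b a c where "v < m" "b < m" "a < m" "c < 3" "\<gamma> = slot_code m v b a c"
proof (rule that[of "\<gamma> div 3 div m div m" "\<gamma> div 3 div m mod m" "\<gamma> div 3 mod m" "\<gamma> mod 3"])
  have "0 < m" using assms by (cases m) auto
  then show "\<gamma> div 3 div m mod m < m" "\<gamma> div 3 mod m < m" "\<gamma> mod 3 < 3" by simp_all
  show "\<gamma> div 3 div m div m < m"
    using assms by (intro less_mult_imp_div_less)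
  show "\<gamma> = slot_code m (\<gamma> div 3 div m div m) (\<gamma> div 3 div m mod m) (\<gamma> div 3 mod m) (\<gamma> mod 3)"
    by (simp only: slot_code_def div_mult_mod_eq)
qed

lemma triple_code_inj:
  assumes "triple_code m p q s = triple_code m p' q' s'" "q < m" "s < m" "q' < m" "s' < m"
  shows "p = p' \<and> q = q' \<and> s = s'"
proof -
  have s: "s = s'" using arg_cong[OF assms(1), of "\<lambda>k. k mod m"] assms(2-) unfolding triple_code_def by (simp only: radix)
  have 1: "p * m + q = p' * m + q'"
    using arg_cong[OF assms(1), of "\<lambda>k. k div m"] assms(2-) unfolding triple_code_def by (simp only: radix)
  have "q = q'" using arg_cong[OF 1, of "\<lambda>k. k mod m"] assms(2-) by (simp only: radix)
  moreover have "p = p'" using arg_cong[OF 1, of "\<lambda>k. k div m"] assms(2-) by (simp only: radix)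
  ultimately show ?thesis using s by simp
qed

lemma slot_decode:
  assumes "b < m" "a < m" "c < 3"
  shows "slot_code m v b a c mod 3 = c" "slot_code m v b a c div 3 mod m = a"
    "slot_code m v b a c div 3 div m mod m = b" "slot_code m v b a c div 3 div m div m = v"
  unfolding slot_code_def using assms by (simp_all only: radix)

lemma slot_triple_code:
  assumes "b < m" "a < m" "c < 3"
  shows "slot_triple m (slot_code m v b a c) =
    (if c = 0 then triple_code m v a b else if c = 1 then triple_code m a v b else triple_code m a b v)"
  unfolding slot_triple_def slot_decode[OF assms] Let_def ..

lemma triple_rel_code: "q < m \<Longrightarrow> s < m \<Longrightarrow> triple_rel m Rel (triple_code m p q s) = Rel p q s"
  unfolding triple_rel_def triple_code_def by (simp only: radix)

lemma triple_exhaust: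
  assumes "e < m * m * m"
  obtains p q s where "p < m" "q < m" "s < m" "e = triple_code m p q s"
proof (rule that[of "e div m div m" "e div m mod m" "e mod m"])
  have "0 < m" using assms by (cases m) auto
  then show "e div m mod m < m" "e mod m < m" by simp_all
  show "e div m div m < m"
    using assms by (intro less_mult_imp_div_less)
  show "e = triple_code m (e div m div m) (e div m mod m) (e mod m)"
    by (simp only: triple_code_def div_mult_mod_eq)
qed

text \<open>The position is a digit of the slot number, so a triple has three different slots even
  when its entries coincide. Triples with repeated entries thus need no special treatment.\<close>

lemma slots_of_triple:
  assumes "p < m" "q < m" "s < m"
  shows "{\<gamma>. \<gamma> < m * m * m * 3 \<and> slot_triple m \<gamma> = triple_code m p q s} =
    {slot_code m p s q 0, slot_code m q s p 1, slot_code m s q p 2}"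
proof (intro set_eqI iffI)
  fix \<gamma> assume \<gamma>: "\<gamma> \<in> {\<gamma>. \<gamma> < m * m * m * 3 \<and> slot_triple m \<gamma> = triple_code m p q s}"
  then obtain v b a c where *: "v < m" "b < m" "a < m" "c < 3" "\<gamma> = slot_code m v b a c"
    using slot_code_exhaust by blast
  consider "c = 0" | "c = 1" | "c = 2" using *(4) by linarith
  then show "\<gamma> \<in> {slot_code m p s q 0, slot_code m q s p 1, slot_code m s q p 2}"
  proof cases
    case 1
    then have "triple_code m v a b = triple_code m p q s" using \<gamma> * by (simp add: slot_triple_code)
    then show ?thesis using triple_code_inj[of m v a b p q s] assms * 1 by simp
  next
    case 2
    then have "triple_code m a v b = triple_code m p q s" using \<gamma> * by (simp add: slot_triple_code)
    then show ?thesis using triple_code_inj[of m a v b p q s] assms * 2 by simp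
  next
    case 3
    then have "triple_code m a b v = triple_code m p q s" using \<gamma> * by (simp add: slot_triple_code)
    then show ?thesis using triple_code_inj[of m a b v p q s] assms * 3 by simp
  qed
qed (use assms slot_code_less in \<open>auto simp: slot_triple_code\<close>)

lemma slot_next_block:
  assumes "\<gamma> < m * m * m * 3"
  shows "slot_next m \<gamma> < m * m * m * 3" "slot_next m \<gamma> div (m * m * 3) = \<gamma> div (m * m * 3)"
proof -
  let ?L = "m * m * 3"
  have L: "0 < ?L" using assms by (cases m) auto
  have eq: "m * m * m * 3 = m * ?L" by simp
  have lt: "\<gamma> div ?L < m" using assms eq by (metis less_mult_imp_div_less)
  show div: "slot_next m \<gamma> div ?L = \<gamma> div ?L"
  proof (cases "Suc \<gamma> mod ?L = 0")
    case True
    then have "?L \<le> Suc \<gamma>" using L by (metis dvd_imp_le mod_0_imp_dvd zero_less_Suc)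
    then have "(Suc \<gamma> - ?L) div ?L = Suc \<gamma> div ?L - 1" using L by (simp add: le_div_geq)
    moreover have "Suc \<gamma> div ?L = Suc (\<gamma> div ?L)" using True by (simp add: div_Suc)
    ultimately show ?thesis using True by (simp add: slot_next_def)
  next
    case False
    then show ?thesis unfolding slot_next_def by (simp add: div_Suc)
  qed
  have "slot_next m \<gamma> div ?L * ?L + slot_next m \<gamma> mod ?L < m * ?L"
    using L div lt by (intro radix_less) simp_all
  then show "slot_next m \<gamma> < m * m * m * 3" unfolding eq by (simp only: div_mult_mod_eq)
qed

lemma bij_slot_next:
  "bij_betw (slot_next m) {..<m * m * m * 3} {..<m * m * m * 3}"
proof -
  let ?L = "m * m * 3"
  have "inj_on (slot_next m) {..<m * m * m * 3}"
  proof (rule inj_onI)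
    fix \<gamma> \<delta> assume *: "\<gamma> \<in> {..<m * m * m * 3}" "\<delta> \<in> {..<m * m * m * 3}" "slot_next m \<gamma> = slot_next m \<delta>"
    then have L: "0 < ?L" by (cases m) auto
    have le: "?L \<le> Suc \<gamma>" if "Suc \<gamma> mod ?L = 0" for \<gamma>
      using that L by (metis dvd_imp_le mod_0_imp_dvd zero_less_Suc)
    have mod: "slot_next m \<gamma> mod ?L = Suc \<gamma> mod ?L" for \<gamma>
      using le[of \<gamma>] by (auto simp: slot_next_def le_mod_geq[symmetric])
    \<comment> \<open>Equal images have successors with equal remainder, so either both slots are
      the last of their block or neither is.\<close>
    have "Suc \<gamma> mod ?L = Suc \<delta> mod ?L" using mod[of \<gamma>] mod[of \<delta>] *(3) by simp
    then have "Suc \<gamma> = Suc \<delta>" using *(3) le[of \<gamma>] le[of \<delta>] unfolding slot_next_def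
      by (auto split: if_splits)
    then show "\<gamma> = \<delta>" by simp
  qed
  moreover have "slot_next m ` {..<m * m * m * 3} \<subseteq> {..<m * m * m * 3}"
    using slot_next_block(1) by blast
  ultimately show ?thesis
    using endo_inj_surj[of "{..<m * m * m * 3}" "slot_next m"] by (simp add: bij_betw_def)
qed

lemma bij_slots:
  "bij_betw (\<lambda>\<gamma>. (slot_triple m \<gamma>, \<gamma> mod 3)) {..<m * m * m * 3} ({..<m * m * m} \<times> {..<3})"
proof (rule bij_betw_imageI)
  show "inj_on (\<lambda>\<gamma>. (slot_triple m \<gamma>, \<gamma> mod 3)) {..<m * m * m * 3}"
  proof (rule inj_onI)
    fix \<gamma> \<delta> assume *: "\<gamma> \<in> {..<m * m * m * 3}" "\<delta> \<in> {..<m * m * m * 3}"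
      "(slot_triple m \<gamma>, \<gamma> mod 3) = (slot_triple m \<delta>, \<delta> mod 3)"
    have \<gamma>: "\<gamma> < m * m * m * 3" and \<delta>: "\<delta> < m * m * m * 3" using * by auto
    obtain v b a c where 1: "v < m" "b < m" "a < m" "c < 3" "\<gamma> = slot_code m v b a c"
      using slot_code_exhaust[OF \<gamma>] .
    obtain v' b' a' c' where 2: "v' < m" "b' < m" "a' < m" "c' < 3" "\<delta> = slot_code m v' b' a' c'"
      using slot_code_exhaust[OF \<delta>] .
    have c: "c' = c" using *(3) 1 2 by (simp add: slot_decode)
    have "slot_triple m (slot_code m v b a c) = slot_triple m (slot_code m v' b' a' c)"
      using *(3) 1 2 c by simp
    then have "v = v' \<and> b = b' \<and> a = a'"
      using 1 2 by (auto simp: slot_triple_code split: if_splits dest!: triple_code_inj)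
    then show "\<gamma> = \<delta>" using 1 2 c by simp
  qed
  show "(\<lambda>\<gamma>. (slot_triple m \<gamma>, \<gamma> mod 3)) ` {..<m * m * m * 3} = {..<m * m * m} \<times> {..<3}"
  proof (intro subset_antisym subsetI)
    fix t assume "t \<in> (\<lambda>\<gamma>. (slot_triple m \<gamma>, \<gamma> mod 3)) ` {..<m * m * m * 3}"
    then obtain \<gamma> where \<gamma>: "\<gamma> < m * m * m * 3" "t = (slot_triple m \<gamma>, \<gamma> mod 3)" by auto
    obtain v b a c where 1: "v < m" "b < m" "a < m" "c < 3" "\<gamma> = slot_code m v b a c"
      using slot_code_exhaust[OF \<gamma>(1)] .
    show "t \<in> {..<m * m * m} \<times> {..<3}"
      unfolding \<gamma>(2) using 1 triple_code_less by (simp add: slot_triple_code)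
  next
    fix t :: "nat \<times> nat" assume t: "t \<in> {..<m * m * m} \<times> {..<3}"
    obtain e c where ec: "t = (e, c)" "e < m * m * m" "c < 3" using t by auto
    obtain p q s where e: "p < m" "q < m" "s < m" "e = triple_code m p q s"
      using triple_exhaust[OF ec(2)] .
    let ?\<gamma> = "if c = 0 then slot_code m p s q 0 else if c = 1 then slot_code m q s p 1 else slot_code m s q p 2"
    have "?\<gamma> \<in> {\<gamma>. \<gamma> < m * m * m * 3 \<and> slot_triple m \<gamma> = triple_code m p q s}"
      unfolding slots_of_triple[OF e(1-3)] by simp
    moreover have "?\<gamma> mod 3 = c" using e ec(3) by (auto simp: slot_decode)
    ultimately show "t \<in> (\<lambda>\<gamma>. (slot_triple m \<gamma>, \<gamma> mod 3)) ` {..<m * m * m * 3}"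
      using ec(1) e(4) by (intro image_eqI[of _ _ ?\<gamma>]) auto
  qed
qed

lemma gadgets_slots:
  "r \<ge> 1 \<Longrightarrow> gadgets r (m * m * m) (m * m * m * 3) (slot_triple m) (\<lambda>\<gamma>. \<gamma> mod 3) (slot_next m)"
  by unfold_locales (auto intro: bij_slots bij_slot_next)

definition nae :: "nat \<Rightarrow> (nat \<Rightarrow> nat \<Rightarrow> nat \<Rightarrow> bool) \<Rightarrow> (nat \<Rightarrow> bool) \<Rightarrow> bool" where
  "nae m Rel c \<longleftrightarrow> (\<forall>p<m. \<forall>q<m. \<forall>s<m. Rel p q s \<longrightarrow> \<not> (c p = c q \<and> c q = c s))"

lemma slot_block: "a < m \<Longrightarrow> b < m \<Longrightarrow> c < 3 \<Longrightarrow> slot_code m v b a c div (m * m * 3) = v"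
  by (simp add: slot_decode div_mult2_eq[of _ 3] div_mult2_eq[of _ m] mult.commute[of _ 3])

text \<open>A colouring of the slots that is constant along \<open>slot_next\<close> is constant on
  blocks, and blocks correspond to variables. Conversely each slot takes the colour of the variable
  that is its leading digit.\<close>

lemma good_iff_nae:
  fixes r :: nat
  assumes "r \<ge> 1"
  shows "(\<exists>h. gadgets.good (m * m * m) (m * m * m * 3) (slot_triple m) (slot_next m) (triple_rel m Rel) h)
    \<longleftrightarrow> (\<exists>c. nae m Rel c)"
proof -
  interpret gadgets r "m * m * m" "m * m * m * 3" "slot_triple m" "\<lambda>\<gamma>. \<gamma> mod 3" "slot_next m" "triple_rel m Rel"
    using assms by (rule gadgets_slots)
  let ?L = "m * m * 3" and ?g = "m * m * m * 3"
  have slots: "(\<exists>\<gamma><?g. slot_triple m \<gamma> = triple_code m p q s \<and> P \<gamma>) \<longleftrightarrow>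
      P (slot_code m p s q 0) \<or> P (slot_code m q s p 1) \<or> P (slot_code m s q p 2)"
    if "p < m" "q < m" "s < m" for p q s P
  proof -
    have "(\<exists>\<gamma><?g. slot_triple m \<gamma> = triple_code m p q s \<and> P \<gamma>) \<longleftrightarrow>
        (\<exists>\<gamma>\<in>{\<gamma>. \<gamma> < ?g \<and> slot_triple m \<gamma> = triple_code m p q s}. P \<gamma>)" by blast
    then show ?thesis unfolding slots_of_triple[OF that] by simp
  qed
  show ?thesis
  proof
    assume "\<exists>h. good h"
    then obtain h where h: "good h" ..
    have block: "h (v * ?L + i) = h (v * ?L)" if "v < m" "i < ?L" for v i
      using that(2)
    proof (induction i)
      case (Suc i)
      have "v * ?L + i < m * ?L" using Suc.prems that(1) by (intro radix_less) simp_all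
      then have "v * ?L + i < ?g" by simp
      moreover have "Suc (v * ?L + i) mod ?L = Suc i"
        using Suc.prems radix(2)[of "Suc i" ?L v] by simp
      then have "slot_next m (v * ?L + i) = v * ?L + Suc i" by (simp add: slot_next_def)
      moreover have "h (slot_next m \<gamma>) = h \<gamma>" if "\<gamma> < ?g" for \<gamma>
        using h that unfolding good_def by blast
      ultimately have "h (v * ?L + Suc i) = h (v * ?L + i)" by metis
      then show ?case using Suc.IH Suc.prems by (simp only: Suc_lessD)
    qed simp
    have h_block: "h \<gamma> = h (\<gamma> div ?L * ?L)" if "\<gamma> < ?g" for \<gamma>
    proof -
      have "0 < ?L" using that by (cases m) auto
      moreover have "\<gamma> div ?L < m" using that by (intro less_mult_imp_div_less) (simp add: mult.assoc)
      ultimately have "h (\<gamma> div ?L * ?L + \<gamma> mod ?L) = h (\<gamma> div ?L * ?L)"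
        by (intro block mod_less_divisor)
      then show ?thesis by (simp only: div_mult_mod_eq)
    qed
    have h_slot: "h (slot_code m v b a c) = h (v * ?L)" if "v < m" "b < m" "a < m" "c < 3" for v b a c
      unfolding h_block[OF slot_code_less[OF that]] slot_block[OF that(3,2,4)] ..
    have "nae m Rel (\<lambda>v. h (v * ?L))"
      unfolding nae_def
    proof (intro allI impI)
      fix p q s assume pqs: "p < m" "q < m" "s < m" "Rel p q s"
      have "(\<exists>\<gamma><?g. slot_triple m \<gamma> = triple_code m p q s \<and> h \<gamma>)
          \<and> (\<exists>\<gamma><?g. slot_triple m \<gamma> = triple_code m p q s \<and> \<not> h \<gamma>)"
        using h triple_code_less[OF pqs(1-3)] triple_rel_code[OF pqs(2,3), of Rel p] pqs(4)
        unfolding good_def by blast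
      then show "\<not> (h (p * ?L) = h (q * ?L) \<and> h (q * ?L) = h (s * ?L))"
        using pqs unfolding slots[OF pqs(1-3)] by (auto simp: h_slot)
    qed
    then show "\<exists>c. nae m Rel c" by blast
  next
    assume "\<exists>c. nae m Rel c"
    then obtain c where c: "nae m Rel c" ..
    let ?h = "\<lambda>\<gamma>. c (\<gamma> div ?L)"
    have "good ?h"
      unfolding good_def
    proof (intro conjI allI impI)
      show "?h (slot_next m \<gamma>) = ?h \<gamma>" if "\<gamma> < ?g" for \<gamma>
        using slot_next_block(2)[OF that] by simp
      fix e assume e: "e < m * m * m" "triple_rel m Rel e"
      obtain p q s where pqs: "p < m" "q < m" "s < m" "e = triple_code m p q s"
        using triple_exhaust[OF e(1)] .
      have "\<not> (c p = c q \<and> c q = c s)"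
        using c e(2) pqs triple_rel_code[OF pqs(2,3), of Rel p] unfolding nae_def by blast
      then show "\<exists>\<gamma><?g. slot_triple m \<gamma> = e \<and> ?h \<gamma>" "\<exists>\<gamma><?g. slot_triple m \<gamma> = e \<and> \<not> ?h \<gamma>"
        using pqs unfolding pqs(4) slots[OF pqs(1-3)] by (auto simp: slot_block)
    qed
    then show "\<exists>h. good h" by blast
  qed
qed

text \<open>Membership in the sets is turned into an arithmetical condition that the definability
  rules can take apart.\<close>

lemma points_iff:
  "(\<gamma>', j) \<in> points nxt \<gamma> l \<longleftrightarrow> \<gamma>' = (if j = 0 \<and> (l = 2 \<or> l = 3) then nxt \<gamma> else \<gamma>) \<and>
     (if l = 0 then j = 0 \<or> j = 2 \<or> j = 3 else if l = 1 then j = 0 \<or> j = 4 \<or> j = 5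
      else if l = 2 then j = 0 \<or> j = 2 \<or> j = 4 else if l = 3 then j = 0 \<or> j = 3 \<or> j = 5
      else if l = 4 then j = 1 \<or> j = 2 \<or> j = 5 else j = 1 \<or> j = 3 \<or> j = 4)"
  by (auto simp: points_def)

text \<open>Vertex numbers are strings of digits, so adjacency is a formula in quotients and
  remainders in which \<open>Rel\<close> is consulted for one triple; for fixed \<open>r\<close> the
  number of vertices depends on \<open>m x\<close> only.\<close>

theorem nae_reduction:
  fixes r :: nat
  assumes r: "r \<ge> 1"
    and m: "definable (\<lambda>x \<rho>. m x)"
    and Rel: "decidable (\<lambda>x \<rho>. Rel x (\<rho> 0) (\<rho> 1) (\<rho> 2))"
  shows "\<exists>f. polytime f \<and> (\<forall>x. f x \<in> LBP_instances r \<and> (f x \<in> LBP_yes r \<longleftrightarrow> (\<exists>c. nae (m x) (Rel x) c)))"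
proof -
  let ?M = "\<lambda>x. m x * m x * m x"
  have gad: "gadgets r (?M x) (?M x * 3) (slot_triple (m x)) (\<lambda>\<gamma>. \<gamma> mod 3) (slot_next (m x))" for x
    using r by (rule gadgets_slots)
  \<comment> \<open>Definability speaks about all inputs at once, so the locale constants are taken
    as functions of the input rather than under a single interpretation.\<close>
  define gsize where "gsize x = gadgets.size r (?M x * 3)" for x
  define gadj where "gadj x = gadgets.adj r (?M x * 3) (slot_triple (m x)) (\<lambda>\<gamma>. \<gamma> mod 3) (slot_next (m x))
    (triple_rel (m x) (Rel x))" for x
  define ginc where "ginc x = gadgets.inc (slot_triple (m x)) (\<lambda>\<gamma>. \<gamma> mod 3) (slot_next (m x))
    (triple_rel (m x) (Rel x))" for x
  have trip: "definable (\<lambda>x \<rho>. slot_triple (m x) (f x \<rho>))" if "definable f" for f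
    by (rule definable_comp1[OF _ that]) (unfold slot_triple_def triple_code_def Let_def, intro definability m)
  have nxt: "definable (\<lambda>x \<rho>. slot_next (m x) (f x \<rho>))" if "definable f" for f
    unfolding slot_next_def by (intro definability m that)
  have rel: "decidable (\<lambda>x \<rho>. triple_rel (m x) (Rel x) (f x \<rho>))" if "definable f" for f
    unfolding triple_rel_def by (intro decidable_comp3[OF Rel] definability m that)
  have inc: "decidable (\<lambda>x \<rho>. ginc x (a x \<rho>) (b x \<rho>) (c x \<rho>, d x \<rho>, e x \<rho>))"
    if "definable a" "definable b" "definable c" "definable d" "definable e" for a b c d e
    unfolding ginc_def gadgets.inc_def[OF gad] split points_iff
    by (intro definability trip nxt rel that)
  have adj: "decidable (\<lambda>x \<rho>. gadj x (a x \<rho>) (b x \<rho>))" if "definable a" "definable b" for a b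
    unfolding gadj_def gadgets.adj_def[OF gad] gadgets.link_def[OF gad] ginc_def[symmetric]
      gadgets.dec_up_def[OF gad] gadgets.dec_low_def[OF gad] gadgets.upper_size_def[OF gad] fst_conv snd_conv
    by (intro definability inc m that)
  have size: "definable (\<lambda>x \<rho>. gsize x)"
    unfolding gsize_def gadgets.size_def[OF gad] gadgets.upper_size_def[OF gad] by (intro definability m)
  let ?f = "\<lambda>x. map (\<lambda>k. gadj x (k div gsize x) (k mod gsize x)) [0..<gsize x * gsize x]"
  have "polytime ?f"
    by (rule polytime_definable) (intro definability size adj)+
  moreover have "?f x \<in> LBP_instances r \<and> (?f x \<in> LBP_yes r \<longleftrightarrow> (\<exists>c. nae (m x) (Rel x) c))" for x
  proof -
    interpret gadgets r "?M x" "?M x * 3" "slot_triple (m x)" "\<lambda>\<gamma>. \<gamma> mod 3" "slot_next (m x)" "triple_rel (m x) (Rel x)"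
      by (rule gad)
    have code: "?f x = graph_code graph"
      unfolding graph_def graph_code_graph_on gadj_def gsize_def ..
    show ?thesis
      unfolding code graph_code_in_LBP_yes_iff[OF is_instance_graph] balanced_iff_good good_iff_nae[OF r]
      using is_instance_graph unfolding LBP_instances_def by blast
  qed
  ultimately show ?thesis by blast
qed


section \<open>Constraint satisfaction with a fixed finite domain\<close>

text \<open>All constraints are binary; a unary constraint is the case \<open>u = v\<close>.\<close>

definition csp :: "nat \<Rightarrow> nat \<Rightarrow> (nat \<Rightarrow> nat \<Rightarrow> nat \<Rightarrow> nat \<Rightarrow> bool) \<Rightarrow> (nat \<Rightarrow> nat) \<Rightarrow> bool" where
  "csp N K F \<tau> \<longleftrightarrow> (\<forall>u<N. \<tau> u < K) \<and> (\<forall>u<N. \<forall>v<N. \<not> F u (\<tau> u) v (\<tau> v))"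

text \<open>The Boolean variable \<open>lit K u a t\<close> stands for \<open>\<tau> u < a\<close> if \<open>t = 0\<close>, for its negation if \<open>t = 1\<close>, and for
  \<open>\<tau> u = a\<close> if \<open>t = 2\<close>. In particular \<open>K * 3 = lit K 0 K 0\<close> is the constant True, up to complementing
  all variables.\<close>

definition lit :: "nat \<Rightarrow> nat \<Rightarrow> nat \<Rightarrow> nat \<Rightarrow> nat" where
  "lit K u a t = (u * Suc K + a) * 3 + t"

text \<open>The clauses say in turn: the literals of kinds 0 and 1 are complementary;
  \<open>\<tau> u < 0\<close> is false; \<open>\<not> \<tau> u < K\<close> is false; if
  \<open>\<tau> u < a\<close> and \<open>\<not> \<tau> u < Suc a\<close> are both false then
  \<open>\<tau> u = a\<close> is true; two values that \<open>F\<close> forbids together are not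
  both taken.\<close>

definition csp_rel :: "nat \<Rightarrow> (nat \<Rightarrow> nat \<Rightarrow> nat \<Rightarrow> nat \<Rightarrow> bool) \<Rightarrow> nat \<Rightarrow> nat \<Rightarrow> nat \<Rightarrow> bool" where
  "csp_rel K F \<alpha> \<beta> \<gamma> \<longleftrightarrow>
     \<alpha> = \<beta> \<and> \<alpha> mod 3 = 0 \<and> \<gamma> mod 3 = 1 \<and> \<alpha> div 3 = \<gamma> div 3 \<or>
     \<alpha> = \<beta> \<and> \<alpha> mod 3 = 0 \<and> \<alpha> div 3 mod Suc K = 0 \<and> \<gamma> = K * 3 \<or>
     \<alpha> = \<beta> \<and> \<alpha> mod 3 = 1 \<and> \<alpha> div 3 mod Suc K = K \<and> \<gamma> = K * 3 \<or>
     \<alpha> mod 3 = 0 \<and> \<beta> mod 3 = 1 \<and> \<gamma> mod 3 = 2 \<and> \<alpha> div 3 mod Suc K < K \<and>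
       \<beta> div 3 = Suc (\<alpha> div 3) \<and> \<gamma> div 3 = \<alpha> div 3 \<or>
     \<alpha> mod 3 = 2 \<and> \<beta> mod 3 = 2 \<and> \<gamma> = K * 3 \<and>
       F (\<alpha> div 3 div Suc K) (\<alpha> div 3 mod Suc K) (\<beta> div 3 div Suc K) (\<beta> div 3 mod Suc K)"

lemma lit_decode:
  assumes "a \<le> K" "t < 3"
  shows "lit K u a t mod 3 = t" "lit K u a t div 3 = u * Suc K + a"
    "(u * Suc K + a) mod Suc K = a" "(u * Suc K + a) div Suc K = u"
proof -
  have a: "a < Suc K" using assms(1) by simp
  show "lit K u a t mod 3 = t" "lit K u a t div 3 = u * Suc K + a"
    unfolding lit_def using assms(2) by (simp_all only: radix)
  show "(u * Suc K + a) mod Suc K = a" "(u * Suc K + a) div Suc K = u"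
    using a by (simp_all only: radix)
qed

lemma lit_less:
  assumes "u < N" "a \<le> K" "t < 3"
  shows "lit K u a t < N * Suc K * 3"
  unfolding lit_def using assms by (intro radix_less) simp_all

lemma nae_of_csp:
  assumes "csp N K F \<tau>" "N \<ge> 1"
  shows "nae (N * Suc K * 3) (csp_rel K F) (\<lambda>\<alpha>. let u = \<alpha> div 3 div Suc K; a = \<alpha> div 3 mod Suc K in
    if \<alpha> mod 3 = 0 then \<tau> u < a else if \<alpha> mod 3 = 1 then \<not> \<tau> u < a else \<tau> u = a)"
    (is "nae _ _ ?c")
  unfolding nae_def
proof (intro allI impI notI, elim conjE)
  fix \<alpha> \<beta> \<gamma>
  assume m: "\<alpha> < N * Suc K * 3" "\<beta> < N * Suc K * 3" "\<gamma> < N * Suc K * 3"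
    and rel: "csp_rel K F \<alpha> \<beta> \<gamma>" and eq: "?c \<alpha> = ?c \<beta>" "?c \<beta> = ?c \<gamma>"
  have less: "\<alpha> div 3 div Suc K < N" "\<beta> div 3 div Suc K < N"
    using m by (auto intro!: less_mult_imp_div_less simp del: mult_Suc_right)
  \<comment> \<open>\<open>K * 3\<close> stands for \<open>\<tau> 0 < K\<close>, which holds because
    variable 0 exists.\<close>
  have o: "?c (K * 3)"
    using assms by (auto simp: csp_def Let_def)
  from rel[unfolded csp_rel_def] show False
  proof (elim disjE conjE, goal_cases)
    case 1
    then show ?thesis using eq by (simp add: Let_def)
  next
    case 2
    then show ?thesis using eq o by (simp add: Let_def)
  next
    case 3
    then show ?thesis using eq o less assms(1) by (simp add: Let_def csp_def)
  next
    case 4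
    \<comment> \<open>The digit \<open>a\<close> is below \<open>K\<close>, so passing to the next
      threshold does not carry into the variable \<open>u\<close>.\<close>
    have "Suc (\<alpha> div 3) mod Suc K = Suc (\<alpha> div 3 mod Suc K)"
      using 4(4) by (simp add: mod_Suc)
    moreover have "Suc (\<alpha> div 3) div Suc K = \<alpha> div 3 div Suc K"
      using calculation by (simp add: div_Suc)
    ultimately show ?thesis using eq 4 by (auto simp: Let_def less_Suc_eq)
  next
    case 5
    have "\<tau> (\<alpha> div 3 div Suc K) = \<alpha> div 3 mod Suc K" "\<tau> (\<beta> div 3 div Suc K) = \<beta> div 3 mod Suc K"
      using eq o 5 by (simp_all add: Let_def)
    then show ?thesis using 5 less assms(1) unfolding csp_def by metis
  qed
qed

text \<open>The thresholds may fail to be monotone, and several equality literals of one variable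
  may be true. It suffices that the thresholds are false at 0 and true at \<open>K\<close>:
  somewhere they jump from false to true, the fourth clause makes the equality literal true there,
  and any such value is admissible.\<close>

lemma csp_of_nae:
  assumes c: "nae (N * Suc K * 3) (csp_rel K F) c" and N: "N \<ge> 1"
  shows "\<exists>\<tau>. csp N K F \<tau>"
proof -
  define T where "T = c (K * 3)"
  have o: "lit K 0 K 0 = K * 3" by (simp add: lit_def)
  have o_less: "K * 3 < N * Suc K * 3" using lit_less[of 0 N K K 0] N o by simp
  have nae: "\<not> (c \<alpha> = c \<beta> \<and> c \<beta> = c \<gamma>)"
    if "csp_rel K F \<alpha> \<beta> \<gamma>" "\<alpha> < N * Suc K * 3" "\<beta> < N * Suc K * 3" "\<gamma> < N * Suc K * 3" for \<alpha> \<beta> \<gamma>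
    using c that unfolding nae_def by blast
  have neg: "c (lit K u a 1) = (\<not> c (lit K u a 0))" if "u < N" "a \<le> K" for u a
    using nae[of "lit K u a 0" "lit K u a 0" "lit K u a 1"] that lit_less[OF that]
    by (auto simp: csp_rel_def lit_decode simp del: mult_Suc_right)
  have first: "c (lit K u 0 0) = (\<not> T)" if "u < N" for u
    using nae[of "lit K u 0 0" "lit K u 0 0" "K * 3"] that lit_less[OF that] o_less
    by (auto simp: csp_rel_def lit_decode T_def simp del: mult_Suc_right)
  have last: "c (lit K u K 0) = T" if "u < N" for u
    using nae[of "lit K u K 1" "lit K u K 1" "K * 3"] neg[OF that] that lit_less[OF that] o_less
    by (auto simp: csp_rel_def lit_decode T_def simp del: mult_Suc_right)
  have "\<exists>a<K. c (lit K u a 2) = T" if u: "u < N" for u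
  proof -
    let ?P = "\<lambda>a. c (lit K u a 0) = T"
    have P: "?P K" "\<not> ?P 0" using first[OF u] last[OF u] by auto
    \<comment> \<open>The least true threshold; it is positive, and its predecessor \<open>a\<close>
      is the value sought.\<close>
    define b where "b = (LEAST b. ?P b)"
    have b: "?P b" "b \<le> K"
      unfolding b_def by (rule LeastI[of ?P, OF P(1)], rule Least_le[of ?P, OF P(1)])
    then obtain a where a: "b = Suc a" using P(2) by (cases b) auto
    have na: "\<not> ?P a" using not_less_Least[of a ?P] a unfolding b_def[symmetric] by simp
    have "csp_rel K F (lit K u a 0) (lit K u (Suc a) 1) (lit K u a 2)"
      using a b(2) by (simp add: csp_rel_def lit_decode del: mult_Suc_right)
    then have "c (lit K u a 2) = T"
      using nae[of "lit K u a 0" "lit K u (Suc a) 1" "lit K u a 2"] neg[OF u, of "Suc a"] na b a lit_less[OF u]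
      by auto
    then show ?thesis using a b(2) Suc_le_lessD by blast
  qed
  then obtain \<tau> where \<tau>: "\<And>u. u < N \<Longrightarrow> \<tau> u < K \<and> c (lit K u (\<tau> u) 2) = T" by metis
  have "\<not> F u (\<tau> u) v (\<tau> v)" if uv: "u < N" "v < N" for u v
  proof
    assume "F u (\<tau> u) v (\<tau> v)"
    then have "csp_rel K F (lit K u (\<tau> u) 2) (lit K v (\<tau> v) 2) (K * 3)"
      using \<tau>[OF uv(1)] \<tau>[OF uv(2)] by (simp add: csp_rel_def lit_decode del: mult_Suc_right)
    from nae[OF this] show False
      using \<tau>[OF uv(1)] \<tau>[OF uv(2)] lit_less[OF uv(1)] lit_less[OF uv(2)] o_less by (auto simp: T_def)
  qed
  then have "csp N K F \<tau>" using \<tau> unfolding csp_def by blast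
  then show ?thesis by blast
qed

theorem csp_reduction:
  fixes r :: nat
  assumes "r \<ge> 1" "definable (\<lambda>x \<rho>. N x)" "\<And>x. N x \<ge> 1"
    and F: "decidable (\<lambda>x \<rho>. F x (\<rho> 0) (\<rho> 1) (\<rho> 2) (\<rho> 3))"
  shows "\<exists>f. polytime f \<and> (\<forall>x. f x \<in> LBP_instances r \<and> (f x \<in> LBP_yes r \<longleftrightarrow> (\<exists>\<tau>. csp (N x) K (F x) \<tau>)))"
proof -
  have "definable (\<lambda>x \<rho>. N x * Suc K * 3)"
    by (intro definability assms(2))
  moreover have "decidable (\<lambda>x \<rho>. csp_rel K (F x) (\<rho> 0) (\<rho> 1) (\<rho> 2))"
    unfolding csp_rel_def by (intro decidable_comp4[OF F] definability)
  ultimately have "\<exists>f. polytime f \<and> (\<forall>x. f x \<in> LBP_instances r \<and>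
      (f x \<in> LBP_yes r \<longleftrightarrow> (\<exists>c. nae (N x * Suc K * 3) (csp_rel K (F x)) c)))"
    by (rule nae_reduction[OF assms(1)])
  moreover have "(\<exists>c. nae (N x * Suc K * 3) (csp_rel K (F x)) c) \<longleftrightarrow> (\<exists>\<tau>. csp (N x) K (F x) \<tau>)" for x
    using nae_of_csp csp_of_nae assms(3) by blast
  ultimately show ?thesis by simp
qed


section \<open>Local descriptions of Turing machine computations\<close>

type_synonym tile = "nat \<times> nat list \<times> (nat \<times> int) list"

abbreviation tile_state :: "tile \<Rightarrow> nat" where "tile_state d \<equiv> fst d"
abbreviation tile_scan :: "tile \<Rightarrow> nat list" where "tile_scan d \<equiv> fst (snd d)"
abbreviation tile_cells :: "tile \<Rightarrow> (nat \<times> int) list" where "tile_cells d \<equiv> snd (snd d)"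
abbreviation tile_sym :: "tile \<Rightarrow> nat \<Rightarrow> nat" where "tile_sym d j \<equiv> fst (tile_cells d ! j)"
abbreviation tile_dir :: "tile \<Rightarrow> nat \<Rightarrow> int" where "tile_dir d j \<equiv> snd (tile_cells d ! j)"

definition tile_at :: "config \<Rightarrow> int \<Rightarrow> tile" where
  "tile_at c i = (fst c, map scan (snd c), map (\<lambda>t. (snd t i, sgn (fst t - i))) (snd c))"

text \<open>The pairs \<open>(sgn z, sgn (z - 1))\<close> are (1, 1), (1, 0), (0, -1) and (-1, -1).
  A zero therefore forces -1 everywhere to its right and 1 everywhere to its left, and a row has at
  most one head.\<close>

lemma sgn_row:
  fixes \<sigma> :: "int \<Rightarrow> int"
  assumes row: "\<And>i. -B \<le> i \<Longrightarrow> i < B \<Longrightarrow> \<exists>z. \<sigma> i = sgn z \<and> \<sigma> (i + 1) = sgn (z - 1)"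
    and h: "-B \<le> h" "h \<le> B" "\<sigma> h = 0"
    and i: "-B \<le> i" "i \<le> B"
  shows "\<sigma> i = sgn (h - i)"
proof -
  have right: "\<sigma> i = sgn (h - i)" if "h \<le> i" "i \<le> B" for i
    using that
  proof (induction i rule: int_ge_induct)
    case (step i)
    then have "\<sigma> i = sgn (h - i)" by simp
    moreover obtain z where "\<sigma> i = sgn z" "\<sigma> (i + 1) = sgn (z - 1)"
      using row[of i] step h by auto
    ultimately show ?case using step by (auto simp: sgn_if split: if_splits)
  qed (use h in simp)
  have left: "\<sigma> i = sgn (h - i)" if "i \<le> h" "-B \<le> i" for i
    using that
  proof (induction i rule: int_le_induct)
    case (step i)
    then have "\<sigma> i = sgn (h - i)" by simp
    moreover obtain z where "\<sigma> (i - 1) = sgn z" "\<sigma> i = sgn (z - 1)"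
      using row[of "i - 1"] step h by auto
    ultimately show ?case using step by (auto simp: sgn_if split: if_splits)
  qed (use h in simp)
  show ?thesis using left right i by (cases "h \<le> i") auto
qed

text \<open>For a moving head \<open>move\<close> determines the new sign of the cell that is left,
  but allows the cell that is entered to keep its sign or to become 0. The row condition between
  these two cells decides for 0. The strict bounds on \<open>h\<close> keep both inside the
  window.\<close>

lemma sgn_step:
  fixes \<sigma> \<sigma>' :: "int \<Rightarrow> int"
  assumes row: "\<And>i. -B \<le> i \<Longrightarrow> i < B \<Longrightarrow> \<exists>z. \<sigma>' i = sgn z \<and> \<sigma>' (i + 1) = sgn (z - 1)"
    and old: "\<And>i. -B \<le> i \<Longrightarrow> i \<le> B \<Longrightarrow> \<sigma> i = sgn (h - i)"
    and move: "\<And>i. -B \<le> i \<Longrightarrow> i \<le> B \<Longrightarrow> \<exists>z. \<sigma> i = sgn z \<and> \<sigma>' i = sgn (z + offset m)"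
    and h: "-B < h" "h < B" and i: "-B \<le> i" "i \<le> B"
  shows "\<sigma>' i = sgn (h + offset m - i)"
proof (rule sgn_row[where \<sigma> = \<sigma>' and h = "h + offset m" and B = B, OF _ _ _ _ i])
  have h0: "\<sigma> h = 0" "\<sigma> (h + 1) = -1" "\<sigma> (h - 1) = 1" using old[of h] old[of "h + 1"] old[of "h - 1"] h by auto
  show "\<sigma>' (h + offset m) = 0"
  proof (cases m)
    case Stay
    then show ?thesis using move[of h] h h0 by (auto simp: sgn_if split: if_splits)
  next
    case MoveRight
    obtain z where "\<sigma> h = sgn z" "\<sigma>' h = sgn (z + 1)" using move[of h] h MoveRight by auto
    moreover obtain z' where "\<sigma>' h = sgn z'" "\<sigma>' (h + 1) = sgn (z' - 1)" using row[of h] h by auto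
    moreover obtain z'' where "\<sigma> (h + 1) = sgn z''" "\<sigma>' (h + 1) = sgn (z'' + 1)"
      using move[of "h + 1"] h MoveRight by auto
    ultimately show ?thesis using h0 MoveRight by (auto simp: sgn_if split: if_splits)
  next
    case MoveLeft
    obtain z where "\<sigma> h = sgn z" "\<sigma>' h = sgn (z - 1)" using move[of h] h MoveLeft by auto
    moreover obtain z' where "\<sigma>' (h - 1) = sgn z'" "\<sigma>' h = sgn (z' - 1)" using row[of "h - 1"] h by auto
    moreover obtain z'' where "\<sigma> (h - 1) = sgn z''" "\<sigma>' (h - 1) = sgn (z'' - 1)"
      using move[of "h - 1"] h MoveLeft by auto
    ultimately show ?thesis using h0 MoveLeft by (auto simp: sgn_if split: if_splits)
  qed
  show "- B \<le> h + offset m" "h + offset m \<le> B" using h by (cases m; simp)+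
  show "\<exists>z. \<sigma>' i = sgn z \<and> \<sigma>' (i + 1) = sgn (z - 1)" if "-B \<le> i" "i < B" for i
    using that by (rule row)
qed

section \<open>Tiles of a fixed machine\<close>

locale turing =
  fixes M :: turing_machine
  assumes wf: "wf_tm M"
begin

definition "k = num_tapes M"

lemma k_pos: "0 < k"
  using wf by (auto simp: wf_tm_def k_def)

text \<open>Idling in the halting state becomes an ordinary transition, so every step obeys one
  rule.\<close>

definition trans :: "nat \<Rightarrow> nat list \<Rightarrow> nat \<times> (nat \<times> head_move) list" where
  "trans q ss = (if q = halt M then (q, keep ss) else delta M q ss)"

definition valid :: "config \<Rightarrow> bool" where
  "valid c \<longleftrightarrow> fst c \<in> states M \<and> length (snd c) = k \<and> (\<forall>t\<in>set (snd c). range (snd t) \<subseteq> symbols M)"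

lemma scan_eq: "scan t = snd t (fst t)"
  by (cases t) simp

lemma act_eq: "act a t = (fst t + offset (snd a), (snd t)(fst t := fst a))"
  by (cases t; cases a) simp

lemma step_eq: "tm_step M c = (fst (trans (fst c) (map scan (snd c))),
    map2 act (snd (trans (fst c) (map scan (snd c)))) (snd c))"
proof (cases c)
  case (Pair q ts)
  have "map2 act (keep (map scan ts)) ts = ts"
    by (induction ts) (auto simp: keep_def act_keep)
  then show ?thesis using Pair by (simp add: trans_def split_def Let_def)
qed

lemma valid_scan: "valid c \<Longrightarrow> set (map scan (snd c)) \<subseteq> symbols M"
  unfolding valid_def scan_eq[abs_def] by fastforce

lemma trans_wf:
  assumes "valid c"
  defines "a \<equiv> trans (fst c) (map scan (snd c))"
  shows "fst a \<in> states M" "length (snd a) = k" "fst ` set (snd a) \<subseteq> symbols M"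
proof -
  have "length (map scan (snd c)) = num_tapes M" "fst c \<in> states M"
    using assms(1) by (auto simp: valid_def k_def)
  moreover have "fst ` set (keep (map scan (snd c))) \<subseteq> symbols M"
    using valid_scan[OF assms(1)] by (auto simp: keep_def)
  ultimately show "fst a \<in> states M" "length (snd a) = k" "fst ` set (snd a) \<subseteq> symbols M"
    using wf valid_scan[OF assms(1)] unfolding a_def trans_def wf_tm_def k_def
    by (auto simp: keep_def)
qed

lemma step_nth:
  assumes "valid c" "j < k"
  shows "snd (tm_step M c) ! j = act (snd (trans (fst c) (map scan (snd c))) ! j) (snd c ! j)"
  using assms trans_wf(2)[OF assms(1)] by (subst step_eq) (simp add: valid_def)

lemma valid_step:
  assumes "valid c"
  shows "valid (tm_step M c)"
proof -
  let ?a = "snd (trans (fst c) (map scan (snd c)))"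
  have len: "length (snd (tm_step M c)) = k"
    using assms trans_wf(2)[OF assms] by (subst step_eq) (simp add: valid_def)
  have "range (snd (snd (tm_step M c) ! j)) \<subseteq> symbols M" if "j < k" for j
  proof -
    have "snd c ! j \<in> set (snd c)" "?a ! j \<in> set ?a"
      using assms that trans_wf(2)[OF assms] by (auto simp: valid_def)
    then have "range (snd (snd c ! j)) \<subseteq> symbols M" "fst (?a ! j) \<in> symbols M"
      using assms trans_wf(3)[OF assms] by (auto simp: valid_def)
    then show ?thesis unfolding step_nth[OF assms that] act_eq by auto
  qed
  then have "\<forall>t\<in>set (snd (tm_step M c)). range (snd t) \<subseteq> symbols M"
    using len by (metis in_set_conv_nth)
  then show ?thesis
    using len trans_wf(1)[OF assms] unfolding valid_def by (simp add: step_eq)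
qed

lemma valid_init: "valid (init_config M x)"
  using wf unfolding valid_def init_config_def wf_tm_def k_def
  by (auto simp: string_cells_def)

definition tiles :: "tile set" where
  "tiles = states M \<times> {ss. set ss \<subseteq> symbols M \<and> length ss = k} \<times>
     {cs. set cs \<subseteq> symbols M \<times> {-1, 0, 1} \<and> length cs = k}"

lemma finite_tiles: "finite tiles"
  using wf unfolding tiles_def wf_tm_def by (auto intro!: finite_cartesian_product finite_lists_length_eq)

lemma tile_at_in_tiles:
  assumes "valid c"
  shows "tile_at c i \<in> tiles"
proof -
  have "(snd t i, sgn (fst t - i)) \<in> symbols M \<times> {-1, 0, 1}" if "t \<in> set (snd c)" for t
    using assms that by (auto simp: valid_def sgn_if)
  then show ?thesis
    using assms valid_scan[OF assms] unfolding tiles_def tile_at_def valid_def by auto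
qed

text \<open>Legality means occurrence in some valid configuration, so genuine computations are legal
  by definition; what the converse needs is extracted afterwards. The set of tiles is finite and
  fixed with the machine, so the relation is a finite table.\<close>

definition beside :: "tile \<Rightarrow> tile \<Rightarrow> bool" where
  "beside d d' \<longleftrightarrow> (\<exists>c i. valid c \<and> d = tile_at c i \<and> d' = tile_at c (i + 1))"

definition above :: "tile \<Rightarrow> tile \<Rightarrow> bool" where
  "above d d' \<longleftrightarrow> (\<exists>c i. valid c \<and> d = tile_at c i \<and> d' = tile_at (tm_step M c) i)"

lemma tile_at_cell:
  assumes "valid c" "j < k"
  shows "tile_cells (tile_at c i) ! j = (snd (snd c ! j) i, sgn (fst (snd c ! j) - i))"
  using assms by (simp add: tile_at_def valid_def)

lemma besideD:
  assumes "beside d d'"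
  shows "tile_scan d' = tile_scan d" "length (tile_scan d) = k" "length (tile_cells d) = k"
    "length (tile_scan d') = k" "length (tile_cells d') = k"
    "j < k \<Longrightarrow> \<exists>z. tile_dir d j = sgn z \<and> tile_dir d' j = sgn (z - 1)"
    "j < k \<Longrightarrow> tile_dir d j = 0 \<Longrightarrow> tile_sym d j = tile_scan d ! j"
    "j < k \<Longrightarrow> tile_dir d' j = 0 \<Longrightarrow> tile_sym d' j = tile_scan d' ! j"
proof -
  obtain c i where c: "valid c" "d = tile_at c i" "d' = tile_at c (i + 1)"
    using assms unfolding beside_def by blast
  show "tile_scan d' = tile_scan d" "length (tile_scan d) = k" "length (tile_cells d) = k"
    "length (tile_scan d') = k" "length (tile_cells d') = k"
    using c by (auto simp: tile_at_def valid_def)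
  show "\<exists>z. tile_dir d j = sgn z \<and> tile_dir d' j = sgn (z - 1)" if "j < k"
    by (rule exI[of _ "fst (snd c ! j) - i"]) (simp add: c(2,3) tile_at_cell[OF c(1) that] algebra_simps)
  have "tile_scan d ! j = scan (snd c ! j)" "tile_scan d' ! j = scan (snd c ! j)" if "j < k"
    using c that by (simp_all add: tile_at_def valid_def)
  then show "j < k \<Longrightarrow> tile_dir d j = 0 \<Longrightarrow> tile_sym d j = tile_scan d ! j"
    "j < k \<Longrightarrow> tile_dir d' j = 0 \<Longrightarrow> tile_sym d' j = tile_scan d' ! j"
    by (simp_all add: c(2,3) tile_at_cell[OF c(1)] scan_eq sgn_0_0)
qed

lemma aboveD:
  assumes "above d d'"
  defines "a \<equiv> trans (tile_state d) (tile_scan d)"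
  shows "tile_state d' = fst a"
    "j < k \<Longrightarrow> tile_sym d' j = (if tile_dir d j = 0 then fst (snd a ! j) else tile_sym d j)"
    "j < k \<Longrightarrow> \<exists>z. tile_dir d j = sgn z \<and> tile_dir d' j = sgn (z + offset (snd (snd a ! j)))"
proof -
  obtain c i where c: "valid c" "d = tile_at c i" "d' = tile_at (tm_step M c) i"
    using assms(1) unfolding above_def by blast
  have a: "a = trans (fst c) (map scan (snd c))"
    unfolding a_def c by (simp add: tile_at_def)
  show "tile_state d' = fst a"
    unfolding a c by (simp add: tile_at_def step_eq)
  show "tile_sym d' j = (if tile_dir d j = 0 then fst (snd a ! j) else tile_sym d j)" if "j < k"
    using that by (simp add: c(2,3) tile_at_cell[OF c(1)] tile_at_cell[OF valid_step[OF c(1)]]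
        step_nth[OF c(1)] a act_eq sgn_0_0)
  show "\<exists>z. tile_dir d j = sgn z \<and> tile_dir d' j = sgn (z + offset (snd (snd a ! j)))" if "j < k"
    using that
    by (intro exI[of _ "fst (snd c ! j) - i"])
       (simp add: c(2,3) tile_at_cell[OF c(1)] tile_at_cell[OF valid_step[OF c(1)]]
        step_nth[OF c(1)] a act_eq algebra_simps)
qed

definition heads_in :: "int \<Rightarrow> config \<Rightarrow> bool" where
  "heads_in b c \<longleftrightarrow> (\<forall>j<k. \<bar>fst (snd c ! j)\<bar> \<le> b)"

lemma heads_in_step:
  assumes "valid c" "heads_in b c"
  shows "heads_in (b + 1) (tm_step M c)"
proof -
  have "\<bar>h + offset m\<bar> \<le> b + 1" if "\<bar>h\<bar> \<le> b" for h m
    using that by (cases m) auto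
  then show ?thesis
    using assms(2) by (simp add: heads_in_def step_nth[OF assms(1)] act_eq)
qed

text \<open>The scanned symbols in the tiles are only guessed; a head inside the window verifies them.\<close>

lemma row_determined:
  assumes c: "valid c" "heads_in B c" and B: "0 < B"
    and beside: "\<And>i. -B \<le> i \<Longrightarrow> i < B \<Longrightarrow> beside (D i) (D (i + 1))"
    and st: "\<And>i. -B \<le> i \<Longrightarrow> i \<le> B \<Longrightarrow> tile_state (D i) = fst c"
    and sym: "\<And>i j. -B \<le> i \<Longrightarrow> i \<le> B \<Longrightarrow> j < k \<Longrightarrow> tile_sym (D i) j = snd (snd c ! j) i"
    and dir: "\<And>i j. -B \<le> i \<Longrightarrow> i \<le> B \<Longrightarrow> j < k \<Longrightarrow> tile_dir (D i) j = sgn (fst (snd c ! j) - i)"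
    and i: "-B \<le> i" "i \<le> B"
  shows "D i = tile_at c i"
proof -
  have ends: "(\<exists>d. beside (D i) d) \<or> (\<exists>d. beside d (D i))" if "-B \<le> i" "i \<le> B" for i
  proof (cases "i < B")
    case True
    then show ?thesis using beside[OF that(1)] by blast
  next
    case False
    then have "beside (D (i - 1)) (D i)" using beside[of "i - 1"] that B by simp
    then show ?thesis by blast
  qed
  have const: "tile_scan (D i) = tile_scan (D (-B))" if "-B \<le> i" "i \<le> B" for i
    using that
  proof (induction i rule: int_ge_induct)
    case (step i)
    then show ?case using besideD(1)[OF beside[of i]] by simp
  qed simp
  have len: "length (tile_scan (D i)) = k" "length (tile_cells (D i)) = k"
    using ends[OF i] besideD(2-5) by blast+
  have "tile_scan (D i) ! j = scan (snd c ! j)" if j: "j < k" for j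
  proof -
    let ?h = "fst (snd c ! j)"
    have h: "-B \<le> ?h" "?h \<le> B" using c(2) j by (auto simp: heads_in_def abs_le_iff)
    have "tile_dir (D ?h) j = 0" using dir[OF h j] by simp
    then have "tile_sym (D ?h) j = tile_scan (D ?h) ! j"
      using ends[OF h] besideD(7,8) j by blast
    then show ?thesis using sym[OF h j] const[OF h] const[OF i] by (simp add: scan_eq)
  qed
  then have "tile_scan (D i) = map scan (snd c)"
    using len c(1) by (intro nth_equalityI) (auto simp: valid_def)
  moreover have "tile_cells (D i) ! j = (snd (snd c ! j) i, sgn (fst (snd c ! j) - i))" if "j < k" for j
    using sym[OF i that] dir[OF i that] by (intro prod_eqI) auto
  then have "tile_cells (D i) = map (\<lambda>t. (snd t i, sgn (fst t - i))) (snd c)"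
    using len c(1) by (intro nth_equalityI) (auto simp: valid_def)
  ultimately show ?thesis using st[OF i] unfolding tile_at_def by (intro prod_eqI) auto
qed

text \<open>The old row is known exactly, so \<open>above\<close> dictates the new states and
  symbols. The directions also need the neighbours, by \<open>sgn_step\<close>, and the scanned
  symbols are then confirmed by \<open>row_determined\<close>. With heads within
  \<open>B - 1\<close> no head leaves the window in this step.\<close>

lemma row_step:
  assumes c: "valid c" "heads_in (B - 1) c" and B: "0 < B"
    and beside: "\<And>i. -B \<le> i \<Longrightarrow> i < B \<Longrightarrow> beside (D' i) (D' (i + 1))"
    and above: "\<And>i. -B \<le> i \<Longrightarrow> i \<le> B \<Longrightarrow> above (tile_at c i) (D' i)"
    and i: "-B \<le> i" "i \<le> B"
  shows "D' i = tile_at (tm_step M c) i"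
proof -
  let ?a = "trans (fst c) (map scan (snd c))"
  have a: "trans (tile_state (tile_at c i)) (tile_scan (tile_at c i)) = ?a" for i
    by (simp add: tile_at_def)
  have st: "tile_state (D' i) = fst (tm_step M c)" if "-B \<le> i" "i \<le> B" for i
    using aboveD(1)[OF above[OF that]] unfolding a by (simp add: step_eq)
  have sym: "tile_sym (D' i) j = snd (snd (tm_step M c) ! j) i" if "-B \<le> i" "i \<le> B" "j < k" for i j
    using aboveD(2)[OF above[OF that(1,2)] that(3)] unfolding a tile_at_cell[OF c(1) that(3)]
    by (simp add: step_nth[OF c(1) that(3)] act_eq sgn_0_0)
  have dir: "tile_dir (D' i) j = sgn (fst (snd (tm_step M c) ! j) - i)" if "-B \<le> i" "i \<le> B" "j < k" for i j
  proof -
    let ?h = "fst (snd c ! j)" and ?m = "snd (snd ?a ! j)"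
    have h: "-B < ?h" "?h < B" using c(2) that(3) by (auto simp: heads_in_def abs_le_iff)
    have "tile_dir (D' i) j = sgn (?h + offset ?m - i)"
    proof (rule sgn_step[where \<sigma> = "\<lambda>i. tile_dir (tile_at c i) j" and B = B])
      show "\<exists>z. tile_dir (D' i) j = sgn z \<and> tile_dir (D' (i + 1)) j = sgn (z - 1)" if "-B \<le> i" "i < B" for i
        using besideD(6)[OF beside[OF that] \<open>j < k\<close>] .
      show "tile_dir (tile_at c i) j = sgn (?h - i)" for i
        by (simp add: tile_at_cell[OF c(1) \<open>j < k\<close>])
      show "\<exists>z. tile_dir (tile_at c i) j = sgn z \<and> tile_dir (D' i) j = sgn (z + offset ?m)"
        if "-B \<le> i" "i \<le> B" for i
        using aboveD(3)[OF above[OF that] \<open>j < k\<close>] unfolding a .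
    qed (use h that in auto)
    then show ?thesis by (simp add: step_nth[OF c(1) that(3)] act_eq)
  qed
  have "heads_in B (tm_step M c)" using heads_in_step[OF c] by simp
  from row_determined[OF valid_step[OF c(1)] this B beside st sym dir i] show ?thesis .
qed

end


section \<open>NP-hardness\<close>

locale verifier = turing +
  fixes V :: "bool list \<Rightarrow> bool list" and q p :: "nat poly"
  assumes computes: "computes_in_time M V (poly q)"
begin

definition run :: "bool list \<Rightarrow> nat \<Rightarrow> config" where
  "run y t = (tm_step M ^^ t) (init_config M y)"

lemma run_simps [simp]: "run y 0 = init_config M y" "run y (Suc t) = tm_step M (run y t)"
  by (simp_all add: run_def)

lemma init_tape:
  assumes "j < k"
  shows "snd (init_config M y) ! j = (0, string_cells (if j = 0 then y else []))"
  using assms by (auto simp: init_config_def k_def nth_Cons split: nat.split)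

lemma valid_run: "valid (run y t)"
  by (induction t) (auto intro: valid_init valid_step)

lemma heads_in_run: "heads_in (int t) (run y t)"
proof (induction t)
  case (Suc t)
  then show ?case using heads_in_step[OF valid_run Suc] by (simp add: add.commute)
qed (simp add: heads_in_def init_tape)

lemma output_run:
  assumes "poly q (length y) \<le> t"
  shows "snd (snd (run y t) ! (k - 1)) = string_cells (V y)"
proof -
  let ?c = "run y (poly q (length y))"
  have fin: "fst ?c = halt M" "snd (last (snd ?c)) = string_cells (V y)"
    using computes unfolding computes_in_time_def run_def by (auto simp: Let_def split_def)
  have "tm_step M ?c = ?c" using fin(1) by (cases ?c) simp
  then have "(tm_step M ^^ s) ?c = ?c" for s by (induction s) auto
  then have "run y (t - poly q (length y) + poly q (length y)) = ?c"
    by (simp only: run_def funpow_add o_apply)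
  then have "run y t = ?c" using assms by simp
  moreover have "length (snd ?c) = k" using valid_run by (auto simp: valid_def)
  then have "last (snd ?c) = snd ?c ! (k - 1)" using k_pos by (subst last_conv_nth) auto
  ultimately show ?thesis using fin(2) by simp
qed

text \<open>A string fills an initial segment of the cells, so a blank in cell 1 bounds its length
  by 1: acceptance is visible in two cells.\<close>

lemma accepts_iff: "y = [True] \<longleftrightarrow> string_cells y 0 = 2 \<and> string_cells y 1 = 0"
proof
  assume *: "string_cells y 0 = 2 \<and> string_cells y 1 = 0"
  then have "length y = 1" by (cases y) (auto simp: string_cells_def split: if_splits)
  then obtain b where "y = [b]" by (cases y) auto
  then show "y = [True]" using * by (auto simp: string_cells_def split: if_splits)
qed (simp add: string_cells_def)

section \<open>The tiling constraints of an input\<close>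

definition K :: nat where "K = card tiles"
definition dec :: "nat \<Rightarrow> tile" where "dec = (SOME h. bij_betw h {0..<K} tiles)"

lemma bij_dec: "bij_betw dec {0..<K} tiles"
  unfolding dec_def K_def using ex_bij_betw_nat_finite[OF finite_tiles] by (rule someI_ex)

definition enc :: "tile \<Rightarrow> nat" where "enc = inv_into {0..<K} dec"

lemma enc_less: "d \<in> tiles \<Longrightarrow> enc d < K" and dec_enc: "d \<in> tiles \<Longrightarrow> dec (enc d) = d"
  using bij_betw_imp_surj_on[OF bij_dec] inv_into_into[of d dec "{0..<K}"] f_inv_into_f[of d dec "{0..<K}"]
  by (auto simp: enc_def)

text \<open>\<open>z\<close> is the direction in which all heads lie at time 0. Classes 0 to 2
  prescribe the symbol on the first tape, while class 3 admits the blank and both bits.\<close>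

definition init_ok :: "int \<Rightarrow> nat \<Rightarrow> tile \<Rightarrow> bool" where
  "init_ok z s d \<longleftrightarrow> tile_state d = start M \<and> (\<forall>j<k. tile_dir d j = z \<and> (0 < j \<longrightarrow> tile_sym d j = 0)) \<and>
     (if s = 3 then tile_sym d 0 \<le> 2 else tile_sym d 0 = s)"

definition not_beside :: "(nat \<times> nat) set" where
  "not_beside = {(a, b). a < K \<and> b < K \<and> \<not> beside (dec a) (dec b)}"
definition not_above :: "(nat \<times> nat) set" where
  "not_above = {(a, b). a < K \<and> b < K \<and> \<not> above (dec a) (dec b)}"
definition gap :: "(nat \<times> nat) set" where
  "gap = {(a, b). a < K \<and> b < K \<and> tile_sym (dec a) 0 = 0 \<and> tile_sym (dec b) 0 \<noteq> 0}"
text \<open>A category packs a direction, increased by 1, and a class below 4 into one number; hence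
  12.\<close>

definition not_init :: "(nat \<times> nat) set" where
  "not_init = {(c, a). c < 12 \<and> a < K \<and> \<not> init_ok (int (c div 4) - 1) (c mod 4) (dec a)}"
definition not_final :: "nat \<Rightarrow> nat set" where
  "not_final s = {a. a < K \<and> tile_sym (dec a) (k - 1) \<noteq> s}"

lemma finite_tables:
  "finite not_beside" "finite not_above" "finite gap" "finite not_init" "finite (not_final s)"
proof -
  have "not_beside \<subseteq> {..<K} \<times> {..<K}" "not_above \<subseteq> {..<K} \<times> {..<K}" "gap \<subseteq> {..<K} \<times> {..<K}"
    "not_init \<subseteq> {..<12} \<times> {..<K}"
    by (auto simp: not_beside_def not_above_def gap_def not_init_def)
  then show "finite not_beside" "finite not_above" "finite gap" "finite not_init"
    by (auto intro: finite_subset)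
qed (simp add: not_final_def)

text \<open>The position of the marker that ends \<open>x\<close> in \<open>pair_code x u\<close>;
  the witness starts in the next cell.\<close>

definition len :: "bool list \<Rightarrow> nat" where "len x = 2 * length x"
definition wit :: "bool list \<Rightarrow> nat" where "wit x = poly p (length x)"
text \<open>The first summand is a time bound for the longest admissible witness. The others make
  the window so wide that it contains all cells reserved for the witness and the blank cell behind
  them.\<close>

definition T :: "bool list \<Rightarrow> nat" where "T x = poly q (len x + 1 + wit x) + len x + wit x + 2"
definition B :: "bool list \<Rightarrow> nat" where "B x = T x + 1"
definition W :: "bool list \<Rightarrow> nat" where "W x = 2 * B x + 1"
definition N :: "bool list \<Rightarrow> nat" where "N x = (T x + 1) * W x"

text \<open>The symbol of the first tape at position \<open>y - B x\<close> at time 0, where 3 marks the cells of the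
  guessed witness, whose length is not fixed in advance.\<close>

definition cell :: "bool list \<Rightarrow> nat \<Rightarrow> nat" where
  "cell x y =
     (if y < B x then 0
      else if y < B x + len x then
        (if (y - B x) mod 2 = 0 then 2 else if bit_at x ((y - B x) div 2) then 2 else 1)
      else if y = B x + len x then 1
      else if y \<le> B x + len x + wit x then 3 else 0)"

definition category :: "bool list \<Rightarrow> nat \<Rightarrow> nat" where
  "category x y = (if y < B x then 2 else if y = B x then 1 else 0) * 4 + cell x y"

text \<open>The fourth clause makes the guessed witness a prefix of the cells reserved for it, and the last two
  say that the output is \<open>[True]\<close>.\<close>

definition forbidden :: "bool list \<Rightarrow> nat \<Rightarrow> nat \<Rightarrow> nat \<Rightarrow> nat \<Rightarrow> bool" where
  "forbidden x u a v b \<longleftrightarrow>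
     v = Suc u \<and> Suc (u mod W x) < W x \<and> (a, b) \<in> not_beside \<or>
     v = u + W x \<and> (a, b) \<in> not_above \<or>
     u = v \<and> u < W x \<and> (category x u, a) \<in> not_init \<or>
     v = Suc u \<and> B x + len x < u \<and> Suc u < W x \<and> (a, b) \<in> gap \<or>
     u = v \<and> u = T x * W x + B x \<and> a \<in> not_final 2 \<or>
     u = v \<and> u = Suc (T x * W x + B x) \<and> a \<in> not_final 0"

lemma definable_len: "definable (\<lambda>x \<rho>. len x)"
  unfolding len_def by (intro definability)
lemma definable_wit: "definable (\<lambda>x \<rho>. wit x)"
  unfolding wit_def by (intro definability)
lemma definable_T: "definable (\<lambda>x \<rho>. T x)"
  unfolding T_def by (intro definability definable_len definable_wit)
lemma definable_B: "definable (\<lambda>x \<rho>. B x)"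
  unfolding B_def by (intro definability definable_T)
lemma definable_W: "definable (\<lambda>x \<rho>. W x)"
  unfolding W_def by (intro definability definable_B)
lemma definable_N: "definable (\<lambda>x \<rho>. N x)"
  unfolding N_def by (intro definability definable_T definable_W)

lemma definable_category: "definable f \<Longrightarrow> definable (\<lambda>x \<rho>. category x (f x \<rho>))"
  unfolding category_def cell_def
  by (intro definability definable_B definable_len definable_wit decidable_bit_at)

lemma decidable_forbidden: "decidable (\<lambda>x \<rho>. forbidden x (\<rho> 0) (\<rho> 1) (\<rho> 2) (\<rho> 3))"
  unfolding forbidden_def
  by (intro definability definable_T definable_B definable_W definable_len definable_category
      decidable_finite decidable_finite2 finite_tables)

lemma category_simps:
  "int (category x y div 4) - 1 = sgn (int (B x) - int y)" "category x y mod 4 = cell x y" "category x y < 12"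
proof -
  have "cell x y < 4" by (simp add: cell_def)
  then show "int (category x y div 4) - 1 = sgn (int (B x) - int y)" "category x y mod 4 = cell x y" "category x y < 12"
    by (auto simp: category_def sgn_if)
qed

text \<open>Outside the reserved cells the initial tape is the same for all witnesses of admissible
  length, so constraints that depend on \<open>x\<close> alone can prescribe it.\<close>

lemma pair_cells:
  assumes "\<not> (int (len x) < i \<and> i \<le> int (len x + wit x))" "length u \<le> wit x" "- int (B x) \<le> i"
  shows "string_cells (pair_code x u) i = cell x (nat (i + int (B x)))"
proof -
  let ?y = "nat (i + int (B x))"
  consider "i < 0" | "0 \<le> i" "i < int (len x)" "even (nat i)" | "0 \<le> i" "i < int (len x)" "odd (nat i)"
    | "i = int (len x)" | "i > int (len x + wit x)"
    using assms(1) by linarith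
  then show ?thesis
  proof cases
    case 1
    then have "?y < B x" using assms(3) by linarith
    then show ?thesis using 1 by (simp add: cell_def string_cells_def)
  next
    case 2
    then obtain j where j: "nat i = 2 * j" by (elim evenE)
    then have "j < length x" using 2 by (simp add: len_def)
    moreover have "?y = B x + 2 * j" using 2 j by linarith
    ultimately show ?thesis
      using 2 j nth_pair_code_marker[of j x u] by (simp add: cell_def string_cells_def len_def length_pair_code)
  next
    case 3
    then obtain j where j: "nat i = 2 * j + 1" by (elim oddE)
    then have "j < length x" using 3 by (simp add: len_def)
    moreover have "?y = B x + Suc (2 * j)" using 3 j by linarith
    ultimately show ?thesis
      using 3 j nth_pair_code_left[of j x u]
      by (simp add: cell_def string_cells_def len_def length_pair_code bit_at_def)
  next
    case 4
    then have "?y = B x + len x" by linarith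
    then show ?thesis
      using 4 nth_pair_code_end[of x u]
      by (simp add: cell_def string_cells_def len_def length_pair_code nat_mult_distrib)
  next
    case 5
    then have "?y > B x + len x + wit x" by linarith
    then show ?thesis
      using 5 assms(2) by (simp add: cell_def string_cells_def len_def length_pair_code)
  qed
qed

lemma cell_free:
  assumes "int (len x) < i" "i \<le> int (len x + wit x)"
  shows "cell x (nat (i + int (B x))) = 3"
proof -
  have "B x + len x < nat (i + int (B x))" "nat (i + int (B x)) \<le> B x + len x + wit x"
    using assms by linarith+
  then show ?thesis by (simp add: cell_def)
qed

lemma W_pos: "0 < W x"
  by (simp add: W_def)

lemma time_enough:
  assumes "length u \<le> wit x"
  shows "poly q (length (pair_code x u)) \<le> T x"
proof -
  have "poly q (length (pair_code x u)) \<le> poly q (len x + 1 + wit x)"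
    using assms by (intro poly_nat_mono) (simp add: length_pair_code len_def)
  then show ?thesis by (simp add: T_def)
qed

lemma csp_of_witness:
  assumes u: "length u \<le> wit x" and acc: "V (pair_code x u) = [True]"
  shows "\<exists>\<tau>. csp (N x) K (forbidden x) \<tau>"
proof -
  define y where "y = pair_code x u"
  \<comment> \<open>Grid point \<open>w\<close> is time \<open>w div W x\<close> and tape position
    \<open>w mod W x - B x\<close>; the tape origin is column \<open>B x\<close>.\<close>
  define D where "D w = tile_at (run y (w div W x)) (int (w mod W x) - int (B x))" for w
  have D: "D w \<in> tiles" for w
    unfolding D_def by (rule tile_at_in_tiles[OF valid_run])
  have tape0: "tile_sym (D w) 0 = string_cells y (int w - int (B x))" if "w < W x" for w
    using that k_pos by (simp add: D_def tile_at_cell[OF valid_init] init_tape)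
  have "\<not> forbidden x a (enc (D a)) b (enc (D b))" for a b
  proof
    assume "forbidden x a (enc (D a)) b (enc (D b))"
    then show False unfolding forbidden_def
    proof (elim disjE conjE, goal_cases)
      case 1
      then have "Suc a mod W x = Suc (a mod W x)" "Suc a div W x = a div W x"
        by (auto simp: mod_Suc div_Suc)
      then have "beside (D a) (D b)"
        using 1(1) valid_run unfolding beside_def D_def
        by (intro exI[of _ "run y (a div W x)"] exI[of _ "int (a mod W x) - int (B x)"]) (simp add: algebra_simps)
      then show ?thesis using 1(3) by (simp add: not_beside_def dec_enc D)
    next
      case 2
      then have "above (D a) (D b)"
        using valid_run W_pos unfolding above_def D_def
        by (intro exI[of _ "run y (a div W x)"] exI[of _ "int (a mod W x) - int (B x)"]) simp
      then show ?thesis using 2(2) by (simp add: not_above_def dec_enc D)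
    next
      case 3
      have "tile_dir (D a) j = sgn (int (B x) - int a)" "0 < j \<Longrightarrow> tile_sym (D a) j = 0" if "j < k" for j
        using 3(2) that by (simp_all add: D_def tile_at_cell[OF valid_init] init_tape string_cells_def)
      moreover have "tile_state (D a) = start M"
        using 3(2) by (simp add: D_def tile_at_def init_config_def)
      moreover have "if cell x a = 3 then tile_sym (D a) 0 \<le> 2 else tile_sym (D a) 0 = cell x a"
      proof (cases "int (len x) < int a - int (B x) \<and> int a - int (B x) \<le> int (len x + wit x)")
        case True
        then have "cell x a = 3" using cell_free[of x "int a - int (B x)"] by simp
        then show ?thesis using tape0[OF 3(2)] by (simp add: string_cells_def)
      next
        case False
        then have "tile_sym (D a) 0 = cell x a"
          using tape0[OF 3(2)] pair_cells[OF False u] by (simp add: y_def)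
        moreover have "tile_sym (D a) 0 \<le> 2" using tape0[OF 3(2)] by (simp add: string_cells_def)
        ultimately show ?thesis by simp
      qed
      ultimately have "init_ok (sgn (int (B x) - int a)) (cell x a) (D a)"
        unfolding init_ok_def by blast
      then show ?thesis using 3(3) by (simp add: not_init_def category_simps dec_enc D)
    next
      case 4
      \<comment> \<open>To the right of the end marker a blank means that the string is over, so the
        next cell is blank too.\<close>
      have "string_cells y (int a - int (B x)) = 0" "string_cells y (int b - int (B x)) \<noteq> 0"
        using 4 tape0[of a] tape0[of b] by (simp_all add: gap_def dec_enc D)
      then show ?thesis using 4(1,2) by (auto simp: string_cells_def split: if_splits)
    next
      case 5
      have "a div W x = T x" "a mod W x = B x" using 5(2) radix[of "B x" "W x" "T x"] by (simp_all add: W_def)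
      then have "tile_sym (D a) (k - 1) = string_cells (V y) 0"
        using k_pos output_run[OF time_enough[OF u]] by (simp add: D_def tile_at_cell[OF valid_run] y_def)
      then show ?thesis using 5(3) acc by (simp add: not_final_def dec_enc D y_def string_cells_def)
    next
      case 6
      have "a div W x = T x" "a mod W x = Suc (B x)"
        using 6(2) radix[of "Suc (B x)" "W x" "T x"] by (simp_all add: W_def B_def)
      then have "tile_sym (D a) (k - 1) = string_cells (V y) 1"
        using k_pos output_run[OF time_enough[OF u]] by (simp add: D_def tile_at_cell[OF valid_run] y_def)
      then show ?thesis using 6(3) acc by (simp add: not_final_def dec_enc D y_def string_cells_def)
    qed
  qed
  then have "csp (N x) K (forbidden x) (\<lambda>w. enc (D w))"
    using enc_less[OF D] by (simp add: csp_def)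
  then show ?thesis by blast
qed

text \<open>Row 0 is prescribed except for the reserved cells; the witness is read off there up to
  the first blank. By induction every row is then the row of the run on this very input, so the
  output cells of the last row show that it is accepted.\<close>

lemma witness_of_csp:
  assumes csp: "csp (N x) K (forbidden x) \<tau>"
  obtains u where "length u \<le> wit x" "V (pair_code x u) = [True]"
proof -
  define D where "D t i = dec (\<tau> (t * W x + nat (i + int (B x))))" for t i
  let ?B = "int (B x)"
  have idx: "t * W x + nat (i + ?B) < N x" "nat (i + ?B) < W x" if "t \<le> T x" "-?B \<le> i" "i \<le> ?B" for t i
  proof -
    show "nat (i + ?B) < W x" using that by (simp add: W_def)
    then show "t * W x + nat (i + ?B) < N x" unfolding N_def using that(1) by (intro radix_less) simp_all
  qed
  have \<tau>: "\<tau> u < K" "\<not> forbidden x u (\<tau> u) v (\<tau> v)" if "u < N x" "v < N x" for u v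
    using csp that unfolding csp_def by blast+
  have beside: "beside (D t i) (D t (i + 1))" if "t \<le> T x" "-?B \<le> i" "i < ?B" for t i
  proof -
    have i: "i \<le> ?B" "-?B \<le> i + 1" "i + 1 \<le> ?B" using that by simp_all
    have Suc: "nat (i + 1 + ?B) = Suc (nat (i + ?B))" using that by simp
    let ?u = "t * W x + nat (i + ?B)"
    have u: "?u < N x" "Suc ?u < N x" "Suc (?u mod W x) < W x"
      using idx[OF that(1,2) i(1)] idx[OF that(1) i(2,3)] unfolding Suc by (simp_all only: add_Suc_right radix)
    have "(\<tau> ?u, \<tau> (Suc ?u)) \<notin> not_beside"
      using \<tau>(2)[OF u(1,2)] u(3) unfolding forbidden_def by blast
    then show ?thesis unfolding D_def Suc using \<tau>(1)[OF u(1,1)] \<tau>(1)[OF u(2,2)]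
      by (simp add: not_beside_def)
  qed
  have above: "above (D t i) (D (Suc t) i)" if "Suc t \<le> T x" "-?B \<le> i" "i \<le> ?B" for t i
  proof -
    let ?u = "t * W x + nat (i + ?B)"
    have eq: "Suc t * W x + nat (i + ?B) = ?u + W x" by simp
    have u: "?u < N x" "?u + W x < N x"
      using idx(1)[OF _ that(2,3), of t] idx(1)[OF that] that(1) unfolding eq by simp_all
    have "(\<tau> ?u, \<tau> (?u + W x)) \<notin> not_above"
      using \<tau>(2)[OF u] unfolding forbidden_def by blast
    then show ?thesis unfolding D_def eq using \<tau>(1)[OF u(1,1)] \<tau>(1)[OF u(2,2)]
      by (simp add: not_above_def)
  qed
  have init: "init_ok (sgn (- i)) (cell x (nat (i + ?B))) (D 0 i)" if "-?B \<le> i" "i \<le> ?B" for i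
  proof -
    let ?u = "nat (i + ?B)"
    have u: "?u < N x" "?u < W x" using idx[OF le0 that] by simp_all
    have "(category x ?u, \<tau> ?u) \<notin> not_init"
      using \<tau>(2)[OF u(1,1)] u(2) unfolding forbidden_def by blast
    moreover have "sgn (?B - int ?u) = sgn (- i)" using that by simp
    ultimately show ?thesis
      using \<tau>(1)[OF u(1,1)] by (simp add: not_init_def category_simps D_def)
  qed
  have gap: "tile_sym (D 0 (i + 1)) 0 = 0" if "int (len x) < i" "i < ?B" "tile_sym (D 0 i) 0 = 0" for i
  proof -
    have i: "-?B \<le> i" "i \<le> ?B" "-?B \<le> i + 1" "i + 1 \<le> ?B" using that by simp_all
    let ?u = "nat (i + ?B)"
    have Suc: "nat (i + 1 + ?B) = Suc ?u" using that by simp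
    have u: "?u < N x" "Suc ?u < N x" "Suc ?u < W x" "B x + len x < ?u"
      using idx[OF le0 i(1,2)] idx[OF le0 i(3,4)] that(1) unfolding Suc by simp_all
    have "(\<tau> ?u, \<tau> (Suc ?u)) \<notin> gap"
      using \<tau>(2)[OF u(1,2)] u(3,4) unfolding forbidden_def by blast
    then show ?thesis using that(3) \<tau>(1)[OF u(1,1)] \<tau>(1)[OF u(2,2)]
      unfolding D_def Suc by (simp add: gap_def)
  qed
  have final: "tile_sym (D (T x) 0) (k - 1) = 2" "tile_sym (D (T x) 1) (k - 1) = 0"
  proof -
    have B: "(0 :: int) \<le> ?B" "(1 :: int) \<le> ?B" by (simp_all add: B_def)
    have u: "T x * W x + B x < N x" "Suc (T x * W x + B x) < N x"
      using idx(1)[OF order.refl, of 0] idx(1)[OF order.refl, of 1] B by (simp_all add: nat_add_distrib)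
    have "\<tau> (T x * W x + B x) \<notin> not_final 2" "\<tau> (Suc (T x * W x + B x)) \<notin> not_final 0"
      using \<tau>(2)[OF u(1,1)] \<tau>(2)[OF u(2,2)] unfolding forbidden_def by blast+
    then show "tile_sym (D (T x) 0) (k - 1) = 2" "tile_sym (D (T x) 1) (k - 1) = 0"
      using \<tau>(1)[OF u(1,1)] \<tau>(1)[OF u(2,2)] by (simp_all add: not_final_def D_def nat_add_distrib)
  qed
  define s where "s l = tile_sym (D 0 (int (len x + 1 + l))) 0" for l
  have room: "len x + 1 + wit x < B x" by (simp add: B_def T_def)
  have s_le: "s l \<le> 2" if "l < wit x" for l
    using init[of "int (len x + 1 + l)"] cell_free[of x "int (len x + 1 + l)"] that room
    by (auto simp: s_def init_ok_def)
  \<comment> \<open>This is the first cell behind the reserved ones. It is blank for every witness,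
    so its class is computed with the empty one, and it guarantees that a first blank
    exists.\<close>
  have s_end: "s (wit x) = 0"
  proof -
    have "cell x (nat (int (len x + 1 + wit x) + ?B)) = 0"
      using pair_cells[of x "int (len x + 1 + wit x)" "[]"]
      by (simp add: string_cells_def length_pair_code len_def)
    then show ?thesis using init[of "int (len x + 1 + wit x)"] room by (simp add: s_def init_ok_def)
  qed
  define l where "l = (LEAST l. s l = 0)"
  have l: "s l = 0" "l \<le> wit x"
    unfolding l_def by (rule LeastI[of "\<lambda>l. s l = 0", OF s_end], rule Least_le[of "\<lambda>l. s l = 0", OF s_end])
  have before: "s j \<noteq> 0" if "j < l" for j
    using not_less_Least[of j "\<lambda>l. s l = 0"] that by (simp add: l_def)
  \<comment> \<open>The constraint \<open>gap\<close> propagates the first blank to the right, so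
    what precedes it is the whole witness.\<close>
  have after: "s j = 0" if "l \<le> j" "j \<le> wit x" for j
    using that
  proof (induction j rule: dec_induct)
    case (step j)
    then show ?case using gap[of "int (len x + 1 + j)"] room by (simp add: s_def algebra_simps)
  qed (use l in simp)
  define u where "u = map (\<lambda>j. s j = 2) [0..<l]"
  let ?y = "pair_code x u"
  have u: "length u \<le> wit x" using l(2) by (simp add: u_def)
  have tape: "tile_sym (D 0 i) 0 = string_cells ?y i" if i: "-?B \<le> i" "i \<le> ?B" for i
  proof (cases "int (len x) < i \<and> i \<le> int (len x + wit x)")
    case True
    define j where "j = nat (i - int (len x) - 1)"
    have j: "i = int (len x + 1 + j)" "j < wit x" using True by (auto simp: j_def)
    have nat_i: "nat i = Suc (2 * length x + j)" using j(1) by (simp add: len_def)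
    have "string_cells ?y i = (if j < l then if s j = 2 then 2 else 1 else 0)"
      using nth_pair_code_right[of x u j] True
      by (simp add: string_cells_def nat_i) (auto simp: j(1) len_def length_pair_code u_def)
    also have "\<dots> = s j"
      using before[of j] after[of j] s_le[OF j(2)] j(2) by auto
    finally show ?thesis by (simp add: s_def j(1))
  next
    case False
    have "cell x (nat (i + ?B)) = string_cells ?y i"
      using pair_cells[OF False u i(1)] by simp
    moreover have "string_cells ?y i \<noteq> 3" by (simp add: string_cells_def)
    ultimately show ?thesis using init[OF i] by (auto simp: init_ok_def)
  qed
  have B0: "0 < ?B" by (simp add: B_def)
  have rows: "D t i = tile_at (run ?y t) i" if "t \<le> T x" "-?B \<le> i" "i \<le> ?B" for t i
    using that
  proof (induction t arbitrary: i)
    case 0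
    have "D 0 i = tile_at (init_config M ?y) i"
    proof (rule row_determined[where B = ?B])
      show "valid (init_config M ?y)" by (rule valid_init)
      show "heads_in ?B (init_config M ?y)" by (simp add: heads_in_def init_tape)
      show "beside (D 0 i) (D 0 (i + 1))" if "-?B \<le> i" "i < ?B" for i
        using beside[OF le0 that] .
      show "tile_state (D 0 i) = fst (init_config M ?y)" if "-?B \<le> i" "i \<le> ?B" for i
        using init[OF that] by (simp add: init_ok_def init_config_def)
      show "tile_sym (D 0 i) j = snd (snd (init_config M ?y) ! j) i" if "-?B \<le> i" "i \<le> ?B" "j < k" for i j
        using init[OF that(1,2)] tape[OF that(1,2)] that(3)
        by (cases "j = 0") (simp_all add: init_ok_def init_tape string_cells_def)
      show "tile_dir (D 0 i) j = sgn (fst (snd (init_config M ?y) ! j) - i)" if "-?B \<le> i" "i \<le> ?B" "j < k" for i j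
        using init[OF that(1,2)] that(3) by (simp add: init_ok_def init_tape)
    qed (use B0 0 in auto)
    then show ?case by simp
  next
    case (Suc t)
    have t: "t \<le> T x" using Suc.prems(1) by simp
    \<comment> \<open>Within \<open>t \<le> T x\<close> steps no head gets further than
      \<open>T x = B x - 1\<close> from the origin.\<close>
    have "heads_in (?B - 1) (run ?y t)"
      using heads_in_run[of t ?y] t unfolding heads_in_def B_def by force
    then have "D (Suc t) i = tile_at (tm_step M (run ?y t)) i"
    proof (rule row_step[OF valid_run _ B0])
      show "beside (D (Suc t) i) (D (Suc t) (i + 1))" if "-?B \<le> i" "i < ?B" for i
        using beside[OF Suc.prems(1) that] .
      show "above (tile_at (run ?y t) i) (D (Suc t) i)" if "-?B \<le> i" "i \<le> ?B" for i
        using above[OF Suc.prems(1) that] Suc.IH[OF t that] by simp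
    qed (use Suc.prems in auto)
    then show ?case by simp
  qed
  have "string_cells (V ?y) i = tile_sym (D (T x) i) (k - 1)" if "-?B \<le> i" "i \<le> ?B" for i
    using rows[OF order.refl that] k_pos output_run[OF time_enough[OF u]]
    by (simp add: tile_at_cell[OF valid_run])
  from this[of 0] this[of 1] have "V ?y = [True]"
    unfolding accepts_iff[of "V ?y"] using final by (simp add: B_def)
  then show thesis using that u by blast
qed

lemma csp_iff_witness:
  "(\<exists>\<tau>. csp (N x) K (forbidden x) \<tau>) \<longleftrightarrow> (\<exists>u. length u \<le> poly p (length x) \<and> V (pair_code x u) = [True])"
  using csp_of_witness witness_of_csp unfolding wit_def by metis

end

theorem NP_hard_LBP:
  fixes r :: nat
  assumes "r \<ge> 1"
  shows "NP_hard (LBP_instances r) (LBP_yes r)"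
  unfolding NP_hard_def
proof
  fix L assume "L \<in> NP"
  then obtain V and p :: "nat poly" where V: "polytime V"
      "\<And>x. x \<in> L \<longleftrightarrow> (\<exists>u. length u \<le> poly p (length x) \<and> V (pair_code x u) = [True])"
    unfolding NP_def by blast
  then obtain M and q :: "nat poly" where M: "wf_tm M" "computes_in_time M V (poly q)"
    unfolding polytime_def by blast
  then interpret verifier M V q p
    by unfold_locales
  have "\<exists>f. polytime f \<and> (\<forall>x. f x \<in> LBP_instances r \<and> (f x \<in> LBP_yes r \<longleftrightarrow> (\<exists>\<tau>. csp (N x) K (forbidden x) \<tau>)))"
    using assms definable_N _ decidable_forbidden
    by (rule csp_reduction) (simp add: N_def W_def)
  then show "\<exists>f. polytime f \<and> (\<forall>x. f x \<in> LBP_instances r \<and> (x \<in> L) = (f x \<in> LBP_yes r))"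
    unfolding V(2) csp_iff_witness by metis
qed

theorem theorem3p3:
  fixes r :: nat
  assumes "r \<ge> 1"
  shows "NP_complete (LBP_instances r) (LBP_yes r)"
  unfolding NP_complete_def
proof (intro conjI)
  show "LBP_yes r \<subseteq> LBP_instances r"
    by (auto simp: LBP_yes_def LBP_instances_def)
qed (use LBP_yes_in_NP NP_hard_LBP[OF assms] in auto)

end
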